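(* Let $M=(M_t)_{t\in\mathbb R_+}$ be a local martingale with respect to $\mathbb F$ with the representation (up to $\mathsf P$-indistinguishability) $$M_t=F(t)\mathbf 1_{\{t<\gamma\}}+L\,\mathbf 1_{\{t\geqslant\gamma\}},\qquad t\in\mathbb R_+,$$ where $L=H(\gamma)+L'$, a pair $(F,H)$ satisfies Condition M, and a random variable $L'$ satisfies $\mathsf E(|L'|\mathbf 1_{\{\gamma\leqslant t\}})<\infty$ for all $t\in\mathcal T$ and $\mathsf E[L'|\gamma]=0$. Then in Case B the local martingale $M$ has type 4. In Case A all types are possible. Namely (in Case A): (i) $M$ has type 1 if and only if $\mathsf E\bigl(|L'|\mathbf 1_{\{\gamma<\infty\}}\bigr)=\infty$ or $\int_{[0,t_G)}|H(s)|\,dG(s)=\infty$. (ii) If $\mathsf P(\gamma=\infty)>0$, $\mathsf E\bigl(|L'|\mathbf 1_{\{\gamma<\infty\}}\bigr)<\infty$ and $\int_{\mathbb R_+}|H(s)|\,dG(s)<\infty$, then $M$ has type 4. (iii) If $\mathsf P(\gamma=\infty)=0$, $\mathsf E|L'|<\infty$ and $\int_{[0,t_G)}|H(s)|\,dG(s)<\infty$, then: (iii.i) $M$ has type 2a (resp. 2b) if and only if $\lim_{t\uparrow t_G,\,t<t_G}F(t)\overline G(t)>0$ (resp. $\lim_{t\uparrow t_G,\,t<t_G}F(t)\overline G(t)<0$); (iii.ii) $M$ has type 3 if and only if $\lim_{t\uparrow t_G,\,t<t_G}F(t)\overline G(t)=0$ and $\int_{[0,t_G)}\overline G(s)\bigl|\frac{dF}{dG}(s)\bigr|\,dG(s)=\infty$;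 (iii.iii) $M$ has type 4 if and only if $\int_{[0,t_G)}\overline G(s)\bigl|\frac{dF}{dG}(s)\bigr|\,dG(s)<\infty$.
   Context: Setting. $(\Omega,\mathscr F,\mathsf P)$ is a probability space, $\gamma$ is a random variable with values in $[0,+\infty]$ with $\mathsf P(\gamma>0)>0$, $\mathbb R_+=[0,\infty)$, $G(t)=\mathsf P(\gamma\leqslant t)$ for $t\in\mathbb R_+$, $\overline G=1-G$, $t_G=\sup\{t\in\mathbb R_+: G(t)<1\}$, $\mathcal T=\{t\in\mathbb R_+:\mathsf P(\gamma\geqslant t)>0\}$. Case A: $\mathsf P(\gamma=t_G<\infty)=0$ (then $\mathcal T=[0,t_G)$). Case B: $\mathsf P(\gamma=t_G<\infty)>0$ (then $\mathcal T=[0,t_G]$). Single jump filtration: $\mathbb F=(\mathscr F_t)_{t\in\mathbb R_+}$, where $\mathscr F_t$ is the collection of all $A\in\mathscr F$ such that $A\cap\{t<\gamma\}$ is either $\varnothing$ or equal to $\{t<\gamma\}$; it is increasing and right-continuous, not assumed complete. $L^1_{\mathrm{loc}}(dG)$ is the set of Borel functions $z:\mathcal T\to\mathbb R$ with $\int_{[0,t]}|z(s)|\,dG(s)<\infty$ for all $t\in\mathcal T$ (the measure $dG$ has mass $G(0)$ at $0$). For $Z:[0,t_G)\to\mathbb R$ write $Z\overset{\mathrm{loc}}{\ll}G$ if there is $z\in L^1_{\mathrm{loc}}(dG)$ with $Z(t)=Z(0)+\int_{(0,t]}z(s)\,dG(s)$ for all $t<t_G$; then $\frac{dZ}{dG}(t):=z(t)$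 for $0<t<t_G$ (the value at $0$ can be chosen as an arbitrary real number). A pair $(F,H)$ satisfies Condition M if: $F:[0,t_G)\to\mathbb R$ with $F\overset{\mathrm{loc}}{\ll}G$; $H:\mathcal T\to\mathbb R$ with $H\in L^1_{\mathrm{loc}}(dG)$; $$F(t)\overline G(t)+\int_{(0,t]}H(s)\,dG(s)=F(0)\overline G(0),\qquad t<t_G;$$ and, additionally in Case B, $\lim_{t\uparrow t_G,\,t<t_G}F(t)=H(t_G)$. Conventions. In the representation, $F$ is extended arbitrarily to a right-continuous function on $[t_G,\infty)$ if $t_G<\infty$, and $H$ is extended by $0$ outside $\mathcal T$. Conditional expectations are understood in the generalized sense, $\mathsf E[Y|\gamma]=\mathsf E[Y^+|\gamma]-\mathsf E[Y^-|\gamma]$. Two processes are $\mathsf P$-indistinguishable if the set where they differ is contained in $N\times\mathbb R_+$ with $\mathsf P(N)=0$. $\mathrm{Var}(M)_\infty$ is the total variation of the path over $[0,\infty)$, including $|M_0|$. An adapted process $M$ with almost all paths càdlàg is a local martingale if there are stopping times $T_n\uparrow\infty$ a.s. such that each stopped process $M^{T_n}$ is a uniformly integrable martingale. Types of a local martingale $M$ (with $M_\infty=\lim_{t\to\infty}M_t$ when it exists): - type 1: the limit $M_\infty$ does not exist with positive probability, or exists with probability one but is not integrable, $\mathsf E|M_\infty|=\infty$; - type 2a: $M$ is a closed supermartingale (in particular, $\mathsf E|M_\infty|<\infty$) and $\mathsf E(M_\infty)<\mathsf E(M_0)$; - type 2b: $M$ is a closed submartingale (in particular, $\mathsf E|M_\infty|<\infty$)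 and $\mathsf E(M_\infty)>\mathsf E(M_0)$; - type 3: $M$ is a uniformly integrable martingale (in particular, $\mathsf E|M_\infty|<\infty$ and $\mathsf E(M_\infty)=\mathsf E(M_0)$) and $\mathsf E(\sup_t|M_t|)=\infty$; - type 4: $M$ has integrable variation, $\mathsf E\bigl(\mathrm{Var}(M)_\infty\bigr)<\infty$. Closed supermartingale (submartingale) means that $(M_t)_{t\in[0,\infty]}$, with $M_\infty$ included, is a supermartingale (submartingale). *)

theory Defs
  imports "HOL-Probability.Probability"
begin

section \<open>Martingales and local martingales\<close>

text \<open>Filtrations are indexed by \<open>[0,\<infinity>]\<close>, that is by the type \<^typ>\<open>ennreal\<close>, so that the library
  notion \<^const>\<open>stopping_time\<close> covers stopping times with values in \<open>[0,\<infinity>]\<close>. Processes with time set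
  \<open>[0,\<infinity>)\<close> are functions of a \<^typ>\<open>real\<close> argument of which only the values at nonnegative times
  are used.\<close>

definition adapted :: "('t \<Rightarrow> 'a measure) \<Rightarrow> 't set \<Rightarrow> ('t \<Rightarrow> 'a \<Rightarrow> real) \<Rightarrow> bool" where
  "adapted F I X \<longleftrightarrow> (\<forall>t\<in>I. X t \<in> borel_measurable (F t))"

definition martingale ::
    "'a measure \<Rightarrow> ('t::linorder \<Rightarrow> 'a measure) \<Rightarrow> 't set \<Rightarrow> ('t \<Rightarrow> 'a \<Rightarrow> real) \<Rightarrow> bool" where
  "martingale P F I X \<longleftrightarrow> adapted F I X \<and> (\<forall>t\<in>I. integrable P (X t)) \<and>
     (\<forall>s\<in>I. \<forall>t\<in>I. s \<le> t \<longrightarrow> (AE \<omega> in P. real_cond_exp P (F s) (X t) \<omega> = X s \<omega>))"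

definition supermartingale ::
    "'a measure \<Rightarrow> ('t::linorder \<Rightarrow> 'a measure) \<Rightarrow> 't set \<Rightarrow> ('t \<Rightarrow> 'a \<Rightarrow> real) \<Rightarrow> bool" where
  "supermartingale P F I X \<longleftrightarrow> adapted F I X \<and> (\<forall>t\<in>I. integrable P (X t)) \<and>
     (\<forall>s\<in>I. \<forall>t\<in>I. s \<le> t \<longrightarrow> (AE \<omega> in P. real_cond_exp P (F s) (X t) \<omega> \<le> X s \<omega>))"

definition submartingale ::
    "'a measure \<Rightarrow> ('t::linorder \<Rightarrow> 'a measure) \<Rightarrow> 't set \<Rightarrow> ('t \<Rightarrow> 'a \<Rightarrow> real) \<Rightarrow> bool" where
  "submartingale P F I X \<longleftrightarrow> adapted F I X \<and> (\<forall>t\<in>I. integrable P (X t)) \<and>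
     (\<forall>s\<in>I. \<forall>t\<in>I. s \<le> t \<longrightarrow> (AE \<omega> in P. X s \<omega> \<le> real_cond_exp P (F s) (X t) \<omega>))"

definition uniformly_integrable :: "'a measure \<Rightarrow> 't set \<Rightarrow> ('t \<Rightarrow> 'a \<Rightarrow> real) \<Rightarrow> bool" where
  "uniformly_integrable P I X \<longleftrightarrow>
     ((\<lambda>c::real. SUP t\<in>I. \<integral>\<^sup>+\<omega>. ennreal \<bar>X t \<omega>\<bar> * indicator {\<omega>. c < \<bar>X t \<omega>\<bar>} \<omega> \<partial>P)
        \<longlongrightarrow> 0) at_top"

definition ui_martingale ::
    "'a measure \<Rightarrow> (ennreal \<Rightarrow> 'a measure) \<Rightarrow> (real \<Rightarrow> 'a \<Rightarrow> real) \<Rightarrow> bool" where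
  "ui_martingale P F X \<longleftrightarrow>
     martingale P (\<lambda>t. F (ennreal t)) {0..} X \<and> uniformly_integrable P {0..} X"

definition cadlag :: "(real \<Rightarrow> real) \<Rightarrow> bool" where
  "cadlag x \<longleftrightarrow> (\<forall>t\<ge>0. continuous (at_right t) x) \<and> (\<forall>t>0. \<exists>l. (x \<longlongrightarrow> l) (at_left t))"

definition stopped :: "(real \<Rightarrow> 'a \<Rightarrow> real) \<Rightarrow> ('a \<Rightarrow> ennreal) \<Rightarrow> real \<Rightarrow> 'a \<Rightarrow> real" where
  "stopped X T t \<omega> = X (enn2real (min (ennreal t) (T \<omega>))) \<omega>"

definition local_martingale ::
    "'a measure \<Rightarrow> (ennreal \<Rightarrow> 'a measure) \<Rightarrow> (real \<Rightarrow> 'a \<Rightarrow> real) \<Rightarrow> bool" where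
  "local_martingale P F X \<longleftrightarrow>
     adapted (\<lambda>t. F (ennreal t)) {0..} X \<and>
     (AE \<omega> in P. cadlag (\<lambda>t. X t \<omega>)) \<and>
     (\<exists>T :: nat \<Rightarrow> 'a \<Rightarrow> ennreal.
        (\<forall>n. stopping_time F (T n)) \<and>
        (AE \<omega> in P. incseq (\<lambda>n. T n \<omega>) \<and> (\<lambda>n. T n \<omega>) \<longlonglongrightarrow> \<infinity>) \<and>
        (\<forall>n. ui_martingale P F (stopped X (T n))))"


section \<open>Types of local martingales\<close>

definition has_limit :: "'a measure \<Rightarrow> (real \<Rightarrow> 'a \<Rightarrow> real) \<Rightarrow> bool" where
  "has_limit P X \<longleftrightarrow> (AE \<omega> in P. \<exists>l. ((\<lambda>t. X t \<omega>) \<longlongrightarrow> l) at_top)"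

text \<open>The limit is taken along integer times, which gives the value of the limit over real times
  whenever the latter exists and keeps the terminal variable measurable even though the paths
  may be irregular on a null set. It is only used together with \<^const>\<open>has_limit\<close>.\<close>

definition terminal :: "(real \<Rightarrow> 'a \<Rightarrow> real) \<Rightarrow> 'a \<Rightarrow> real" where
  "terminal X \<omega> = lim (\<lambda>n::nat. X (real n) \<omega>)"

definition closed_process :: "(real \<Rightarrow> 'a \<Rightarrow> real) \<Rightarrow> ennreal \<Rightarrow> 'a \<Rightarrow> real" where
  "closed_process X t = (if t = \<infinity> then terminal X else X (enn2real t))"

definition closed_supermartingale ::
    "'a measure \<Rightarrow> (ennreal \<Rightarrow> 'a measure) \<Rightarrow> (real \<Rightarrow> 'a \<Rightarrow> real) \<Rightarrow> bool" where
  "closed_supermartingale P F X \<longleftrightarrow>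
     has_limit P X \<and> supermartingale P F UNIV (closed_process X)"

definition closed_submartingale ::
    "'a measure \<Rightarrow> (ennreal \<Rightarrow> 'a measure) \<Rightarrow> (real \<Rightarrow> 'a \<Rightarrow> real) \<Rightarrow> bool" where
  "closed_submartingale P F X \<longleftrightarrow>
     has_limit P X \<and> submartingale P F UNIV (closed_process X)"

text \<open>Total variation over \<open>[0,\<infinity>)\<close>, including the absolute value at \<open>0\<close>.\<close>

definition variation :: "(real \<Rightarrow> real) \<Rightarrow> ennreal" where
  "variation x = ennreal \<bar>x 0\<bar> +
     (SUP \<tau>\<in>{\<tau> :: nat \<Rightarrow> real. mono \<tau> \<and> 0 \<le> \<tau> 0}. SUP n. \<Sum>i<n. ennreal \<bar>x (\<tau> (Suc i)) - x (\<tau> i)\<bar>)"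

datatype lm_type = Type1 | Type2a | Type2b | Type3 | Type4

primrec has_type ::
    "'a measure \<Rightarrow> (ennreal \<Rightarrow> 'a measure) \<Rightarrow> (real \<Rightarrow> 'a \<Rightarrow> real) \<Rightarrow> lm_type \<Rightarrow> bool" where
  "has_type P F X Type1 \<longleftrightarrow>
     \<not> has_limit P X \<or> (has_limit P X \<and> (\<integral>\<^sup>+\<omega>. ennreal \<bar>terminal X \<omega>\<bar> \<partial>P) = \<infinity>)"
| "has_type P F X Type2a \<longleftrightarrow>
     closed_supermartingale P F X \<and> (\<integral>\<omega>. terminal X \<omega> \<partial>P) < (\<integral>\<omega>. X 0 \<omega> \<partial>P)"
| "has_type P F X Type2b \<longleftrightarrow>
     closed_submartingale P F X \<and> (\<integral>\<omega>. terminal X \<omega> \<partial>P) > (\<integral>\<omega>. X 0 \<omega> \<partial>P)"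
| "has_type P F X Type3 \<longleftrightarrow>
     ui_martingale P F X \<and> (\<integral>\<^sup>+\<omega>. (SUP t\<in>{0..}. ennreal \<bar>X t \<omega>\<bar>) \<partial>P) = \<infinity>"
| "has_type P F X Type4 \<longleftrightarrow>
     (\<integral>\<^sup>+\<omega>. variation (\<lambda>t. X t \<omega>) \<partial>P) < \<infinity>"


section \<open>Single jump filtrations\<close>

definition jump_time :: "'a measure \<Rightarrow> ('a \<Rightarrow> ennreal) \<Rightarrow> bool" where
  "jump_time P \<gamma> \<longleftrightarrow> prob_space P \<and> \<gamma> \<in> borel_measurable P \<and> measure P {\<omega>\<in>space P. 0 < \<gamma> \<omega>} > 0"

definition sj_sets :: "'a measure \<Rightarrow> ('a \<Rightarrow> ennreal) \<Rightarrow> ennreal \<Rightarrow> 'a set set" where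
  "sj_sets P \<gamma> t = {A \<in> sets P. A \<inter> {\<omega>\<in>space P. t < \<gamma> \<omega>} = {} \<or>
     A \<inter> {\<omega>\<in>space P. t < \<gamma> \<omega>} = {\<omega>\<in>space P. t < \<gamma> \<omega>}}"

definition sj_filtration :: "'a measure \<Rightarrow> ('a \<Rightarrow> ennreal) \<Rightarrow> ennreal \<Rightarrow> 'a measure" where
  "sj_filtration P \<gamma> t = sigma (space P) (sj_sets P \<gamma> t)"

lemma space_sj_filtration: "space (sj_filtration P \<gamma> t) = space P"
  unfolding sj_filtration_def sj_sets_def
  by (intro space_measure_of) (auto dest: sets.sets_into_space)

lemma sets_sj_filtration: "sets (sj_filtration P \<gamma> t) = sj_sets P \<gamma> t"
proof -
  have "sigma_algebra (space P) (sj_sets P \<gamma> t)"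
    unfolding sigma_algebra_iff2
  proof (intro conjI ballI allI impI)
    show "sj_sets P \<gamma> t \<subseteq> Pow (space P)"
      by (auto simp: sj_sets_def dest: sets.sets_into_space)
    show "{} \<in> sj_sets P \<gamma> t"
      by (auto simp: sj_sets_def)
    show "space P - A \<in> sj_sets P \<gamma> t" if "A \<in> sj_sets P \<gamma> t" for A
      using that by (auto simp: sj_sets_def)
    show "(\<Union>i. A i) \<in> sj_sets P \<gamma> t" if "range A \<subseteq> sj_sets P \<gamma> t" for A :: "nat \<Rightarrow> 'a set"
    proof -
      have A: "A i \<in> sets P"
        "A i \<inter> {\<omega>\<in>space P. t < \<gamma> \<omega>} = {} \<or> A i \<inter> {\<omega>\<in>space P. t < \<gamma> \<omega>} = {\<omega>\<in>space P. t < \<gamma> \<omega>}" for i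
        using that by (auto simp: sj_sets_def)
      show ?thesis
      proof (cases "\<exists>i. A i \<inter> {\<omega>\<in>space P. t < \<gamma> \<omega>} = {\<omega>\<in>space P. t < \<gamma> \<omega>}")
        case True
        then have "(\<Union>i. A i) \<inter> {\<omega>\<in>space P. t < \<gamma> \<omega>} = {\<omega>\<in>space P. t < \<gamma> \<omega>}" by blast
        then show ?thesis using A(1) by (auto simp: sj_sets_def)
      next
        case False
        then have "(\<Union>i. A i) \<inter> {\<omega>\<in>space P. t < \<gamma> \<omega>} = {}" using A(2) by blast
        then show ?thesis using A(1) by (auto simp: sj_sets_def)
      qed
    qed
  qed
  then show ?thesis
    unfolding sj_filtration_def by (rule sigma_algebra.sets_measure_of_eq)
qed

lemma filtration_sj_filtration: "filtration (space P) (sj_filtration P \<gamma>)"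
proof
  fix s t :: ennreal assume "s \<le> t"
  then have "{\<omega>\<in>space P. t < \<gamma> \<omega>} \<subseteq> {\<omega>\<in>space P. s < \<gamma> \<omega>}" by auto
  then show "sets (sj_filtration P \<gamma> s) \<le> sets (sj_filtration P \<gamma> t)"
    unfolding sets_sj_filtration sj_sets_def by blast
qed (rule space_sj_filtration)

definition G :: "'a measure \<Rightarrow> ('a \<Rightarrow> ennreal) \<Rightarrow> real \<Rightarrow> real" where
  "G P \<gamma> t = measure P {\<omega>\<in>space P. \<gamma> \<omega> \<le> ennreal t}"

definition Gbar :: "'a measure \<Rightarrow> ('a \<Rightarrow> ennreal) \<Rightarrow> real \<Rightarrow> real" where
  "Gbar P \<gamma> t = 1 - G P \<gamma> t"

text \<open>Continuing \<^const>\<open>G\<close> by \<open>0\<close> to the left of the origin gives the measure an atom of mass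
  \<open>G(0)\<close> at \<open>0\<close>. The formula for \<^const>\<open>G\<close> itself cannot be used there, since \<^const>\<open>ennreal\<close>
  maps negative numbers to \<open>0\<close>.\<close>

definition dG :: "'a measure \<Rightarrow> ('a \<Rightarrow> ennreal) \<Rightarrow> real measure" where
  "dG P \<gamma> = interval_measure (\<lambda>t. if t < 0 then 0 else G P \<gamma> t)"

definition t_G :: "'a measure \<Rightarrow> ('a \<Rightarrow> ennreal) \<Rightarrow> ennreal" where
  "t_G P \<gamma> = (SUP t\<in>{t. 0 \<le> t \<and> G P \<gamma> t < 1}. ennreal t)"

definition before_tG :: "'a measure \<Rightarrow> ('a \<Rightarrow> ennreal) \<Rightarrow> real set" where
  "before_tG P \<gamma> = {t. 0 \<le> t \<and> ennreal t < t_G P \<gamma>}"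

definition TT :: "'a measure \<Rightarrow> ('a \<Rightarrow> ennreal) \<Rightarrow> real set" where
  "TT P \<gamma> = {t. 0 \<le> t \<and> measure P {\<omega>\<in>space P. \<gamma> \<omega> \<ge> ennreal t} > 0}"

definition case_A :: "'a measure \<Rightarrow> ('a \<Rightarrow> ennreal) \<Rightarrow> bool" where
  "case_A P \<gamma> \<longleftrightarrow> measure P {\<omega>\<in>space P. \<gamma> \<omega> = t_G P \<gamma> \<and> t_G P \<gamma> < \<infinity>} = 0"

definition case_B :: "'a measure \<Rightarrow> ('a \<Rightarrow> ennreal) \<Rightarrow> bool" where
  "case_B P \<gamma> \<longleftrightarrow> measure P {\<omega>\<in>space P. \<gamma> \<omega> = t_G P \<gamma> \<and> t_G P \<gamma> < \<infinity>} > 0"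

text \<open>The filter of \<open>t \<up> t_G\<close>, \<open>t < t_G\<close>.\<close>

definition to_tG :: "'a measure \<Rightarrow> ('a \<Rightarrow> ennreal) \<Rightarrow> real filter" where
  "to_tG P \<gamma> = (if t_G P \<gamma> = \<infinity> then at_top else at_left (enn2real (t_G P \<gamma>)))"

definition L1_loc :: "'a measure \<Rightarrow> ('a \<Rightarrow> ennreal) \<Rightarrow> (real \<Rightarrow> real) set" where
  "L1_loc P \<gamma> = {z. set_borel_measurable borel (TT P \<gamma>) z \<and>
     (\<forall>t\<in>TT P \<gamma>. (\<integral>\<^sup>+s\<in>{0..t}. ennreal \<bar>z s\<bar> \<partial>dG P \<gamma>) < \<infinity>)}"

text \<open>\<open>z\<close> is a version of \<open>dZ/dG\<close>; the value \<open>z 0\<close> is unconstrained.\<close>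

definition has_dG_derivative ::
    "'a measure \<Rightarrow> ('a \<Rightarrow> ennreal) \<Rightarrow> (real \<Rightarrow> real) \<Rightarrow> (real \<Rightarrow> real) \<Rightarrow> bool" where
  "has_dG_derivative P \<gamma> Z z \<longleftrightarrow> z \<in> L1_loc P \<gamma> \<and>
     (\<forall>t\<in>before_tG P \<gamma>. Z t = Z 0 + (LINT s:{0<..t}|dG P \<gamma>. z s))"

definition loc_abs_cont :: "'a measure \<Rightarrow> ('a \<Rightarrow> ennreal) \<Rightarrow> (real \<Rightarrow> real) \<Rightarrow> bool" where
  "loc_abs_cont P \<gamma> Z \<longleftrightarrow> (\<exists>z. has_dG_derivative P \<gamma> Z z)"

definition condition_M ::
    "'a measure \<Rightarrow> ('a \<Rightarrow> ennreal) \<Rightarrow> (real \<Rightarrow> real) \<Rightarrow> (real \<Rightarrow> real) \<Rightarrow> bool" where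
  "condition_M P \<gamma> F H \<longleftrightarrow>
     loc_abs_cont P \<gamma> F \<and> H \<in> L1_loc P \<gamma> \<and>
     (\<forall>t\<in>before_tG P \<gamma>.
        F t * Gbar P \<gamma> t + (LINT s:{0<..t}|dG P \<gamma>. H s) = F 0 * Gbar P \<gamma> 0) \<and>
     (case_B P \<gamma> \<longrightarrow> (F \<longlongrightarrow> H (enn2real (t_G P \<gamma>))) (to_tG P \<gamma>))"

text \<open>Since \<open>\<infinity> - \<infinity> = \<infinity>\<close> in \<^typ>\<open>ereal\<close>, the value \<open>0\<close> is taken exactly where
  both conditional expectations are finite and equal.\<close>

definition gen_cond_exp :: "'a measure \<Rightarrow> 'a measure \<Rightarrow> ('a \<Rightarrow> real) \<Rightarrow> 'a \<Rightarrow> ereal" where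
  "gen_cond_exp P A Y \<omega> =
     enn2ereal (nn_cond_exp P A (\<lambda>\<omega>. ennreal (max 0 (Y \<omega>))) \<omega>) -
     enn2ereal (nn_cond_exp P A (\<lambda>\<omega>. ennreal (max 0 (- Y \<omega>))) \<omega>)"

text \<open>\<open>H(\<gamma>)\<close>, where \<open>H\<close> is continued by \<open>0\<close> outside \<^const>\<open>TT\<close>, in particular at \<open>\<infinity>\<close>.\<close>

definition H_at :: "'a measure \<Rightarrow> ('a \<Rightarrow> ennreal) \<Rightarrow> (real \<Rightarrow> real) \<Rightarrow> 'a \<Rightarrow> real" where
  "H_at P \<gamma> H \<omega> =
     (if \<gamma> \<omega> < \<infinity> \<and> enn2real (\<gamma> \<omega>) \<in> TT P \<gamma> then H (enn2real (\<gamma> \<omega>)) else 0)"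

text \<open>Right-continuity on \<open>[t_G,\<infinity>)\<close> is the only requirement on the values of \<open>F\<close> there.\<close>

definition sj_representation ::
    "'a measure \<Rightarrow> ('a \<Rightarrow> ennreal) \<Rightarrow> (real \<Rightarrow> real) \<Rightarrow> (real \<Rightarrow> real) \<Rightarrow> ('a \<Rightarrow> real) \<Rightarrow>
     (real \<Rightarrow> 'a \<Rightarrow> real) \<Rightarrow> bool" where
  "sj_representation P \<gamma> F H L' M \<longleftrightarrow>
     condition_M P \<gamma> F H \<and>
     (\<forall>t\<ge>0. t_G P \<gamma> \<le> ennreal t \<longrightarrow> continuous (at_right t) F) \<and>
     L' \<in> borel_measurable P \<and>
     (\<forall>t\<in>TT P \<gamma>. (\<integral>\<^sup>+\<omega>. ennreal \<bar>L' \<omega>\<bar> * indicator {\<omega>. \<gamma> \<omega> \<le> ennreal t} \<omega> \<partial>P) < \<infinity>) \<and>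
     (AE \<omega> in P. gen_cond_exp P (vimage_algebra (space P) \<gamma> borel) L' \<omega> = 0) \<and>
     (AE \<omega> in P. \<forall>t\<ge>0. M t \<omega> =
        F t * indicator {\<omega>. ennreal t < \<gamma> \<omega>} \<omega> +
        (H_at P \<gamma> H \<omega> + L' \<omega>) * indicator {\<omega>. \<gamma> \<omega> \<le> ennreal t} \<omega>)"

end

theory Submission
  imports Defs "HOL-Real_Asymp.Real_Asymp"
begin

text \<open>On \<open>{t < \<gamma>}\<close> the sigma-algebra at time \<open>t\<close> is trivial and on \<open>{\<gamma> \<le> t}\<close> it contains every event. A
conditional expectation at time \<open>s\<close> therefore reproduces a process that is constant after \<open>\<gamma>\<close>, up
to a constant on \<open>{s < \<gamma>}\<close> (\<open>real_cond_exp_sj\<close>), and all questions about \<open>M\<close> become questions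
about integrals with respect to \<open>dG\<close>, the law of \<open>\<gamma>\<close> on \<open>{\<gamma> < \<infinity>}\<close> (\<open>dG_eq_distr\<close>). Condition M
amounts to \<open>E[M t; s < \<gamma>] = F s * Gbar s\<close> for \<open>s \<le> t < t_G\<close> (\<open>expectation_M_jump\<close>). Hence \<open>M\<close> is a
martingale before \<open>t_G\<close>, and its type is decided by what happens as \<open>t \<up> t_G\<close>.

In Case B the point \<open>t_G\<close> itself lies in \<open>TT\<close>, so \<open>H\<close>, \<open>L'\<close> and \<open>dF/dG\<close> are integrable up to and
including it, and the variation is integrable. In Case A write \<open>L = H(\<gamma>) + L'\<close>. As \<open>L'\<close> averages to
\<open>0\<close> given \<open>\<gamma>\<close>, testing \<open>L\<close> against the sign of \<open>H(\<gamma>)\<close> gives \<open>E|H(\<gamma>)| \<le> E|L|\<close>, so \<open>L\<close> is integrable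
on \<open>{\<gamma> < \<infinity>}\<close> exactly when both summands are (\<open>L_finite_iff\<close>). This is the dichotomy of type 1,
because \<open>L\<close> is the limit of \<open>M\<close> on \<open>{\<gamma> < \<infinity>}\<close>, while on \<open>{\<gamma> = \<infinity>}\<close>, if this event is not null, \<open>F\<close>
converges when \<open>L\<close> is integrable on \<open>{\<gamma> < \<infinity>}\<close>.

Suppose, still in Case A, that \<open>\<gamma> < \<infinity>\<close> almost surely and \<open>L\<close> is integrable. Then \<open>F * Gbar\<close> has a limit at \<open>t_G\<close>, and
this limit is the loss \<open>E (M 0) - E L\<close> (\<open>expectation_terminal\<close>). Its sign separates the types 2a and
2b from the others. On \<open>{t < \<gamma>}\<close>, an event whose probability vanishes at \<open>t_G\<close>, the process carries
the absolute mass \<open>|F t| * Gbar t\<close>; so it is uniformly integrable exactly when there is no loss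
(\<open>uniformly_integrable_iff\<close>).

Type 4 is governed by the identity \<open>Gbar * f = F_left - H\<close> (\<open>Gbar_f_eq\<close>), which is Condition M in
differential form. By Fubini, the integral of \<open>Gbar * |f|\<close> is the expectation of the mass \<open>V\<close> of
\<open>|f| dG\<close> on \<open>(0,\<gamma>)\<close>, and \<open>V\<close> together with \<open>|L|\<close> bounds the variation of the path
(\<open>AE_variation_le\<close>). Conversely \<open>sup |M|\<close> dominates \<open>|F_left(\<gamma>)|\<close>, so by the identity an integrable
supremum forces this integral to be finite. The supremum and the variation are thus integrable
together, which settles the types 3 and 4. When \<open>\<gamma> = \<infinity>\<close> has positive probability, \<open>F\<close> is bounded and
the same identity yields type 4.

For the existence of all types, \<open>\<gamma>\<close> is taken exponential with mean \<open>1\<close>. Then \<open>F t = exp t * u t\<close> has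
\<open>F * Gbar = u\<close>, and every continuously differentiable \<open>u\<close> gives a local martingale whose type is
read off from \<open>u\<close> and its derivative.\<close>

section \<open>The jump time, its law and the time horizon\<close>

locale single_jump = prob_space P for P :: "'a measure" +
  fixes \<gamma> :: "'a \<Rightarrow> ennreal"
  assumes borel_measurable_jump [measurable]: "\<gamma> \<in> borel_measurable P"
    and jump_pos: "0 < prob {\<omega>\<in>space P. 0 < \<gamma> \<omega>}"
begin

text \<open>Both measures have the same distribution function. This turns integrals with respect to \<open>dG\<close> into
expectations of functions of \<open>\<gamma>\<close> on \<open>{\<gamma> < \<infinity>}\<close>.\<close>

lemma dG_eq_distr:
  "dG P \<gamma> = distr (density P (indicator {\<omega>. \<gamma> \<omega> < \<infinity>})) borel (\<lambda>\<omega>. enn2real (\<gamma> \<omega>))"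
    (is "_ = ?N")
  and finite_borel_measure_dG: "finite_borel_measure (dG P \<gamma>)"
  and cdf_dG: "cdf (dG P \<gamma>) t = (if t < 0 then 0 else G P \<gamma> t)"
proof -
  have [measurable]: "(indicator {\<omega>. \<gamma> \<omega> < \<infinity>} :: 'a \<Rightarrow> ennreal) \<in> borel_measurable P"
    by measurable
  have em: "emeasure ?N A = emeasure P {\<omega>\<in>space P. \<gamma> \<omega> < \<infinity> \<and> enn2real (\<gamma> \<omega>) \<in> A}"
    if [measurable]: "A \<in> sets borel" for A
  proof -
    have "emeasure ?N A = (\<integral>\<^sup>+\<omega>. indicator {\<omega>. \<gamma> \<omega> < \<infinity>} \<omega> *
        indicator ((\<lambda>\<omega>. enn2real (\<gamma> \<omega>)) -` A \<inter> space P) \<omega> \<partial>P)"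
      by (subst emeasure_distr) (simp_all add: emeasure_density)
    also have "\<dots> = (\<integral>\<^sup>+\<omega>. indicator {\<omega>\<in>space P. \<gamma> \<omega> < \<infinity> \<and> enn2real (\<gamma> \<omega>) \<in> A} \<omega> \<partial>P)"
      by (intro nn_integral_cong) (auto split: split_indicator)
    finally show ?thesis by simp
  qed
  have N: "finite_borel_measure ?N"
  proof (intro finite_borel_measure.intro finite_borel_measure_axioms.intro finite_measureI)
    show "emeasure ?N (space ?N) \<noteq> \<infinity>"
      using emeasure_finite by (subst space_distr, subst em) auto
  qed simp
  interpret N: finite_borel_measure ?N by (rule N)
  have cdf: "cdf ?N t = (if t < 0 then 0 else G P \<gamma> t)" for t
  proof -
    have "{\<omega>\<in>space P. \<gamma> \<omega> < \<infinity> \<and> enn2real (\<gamma> \<omega>) \<in> {..t}} = 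
       (if t < 0 then {} else {\<omega>\<in>space P. \<gamma> \<omega> \<le> ennreal t})"
    proof -
      have "(\<gamma> \<omega> < \<infinity> \<and> enn2real (\<gamma> \<omega>) \<le> t) \<longleftrightarrow> 0 \<le> t \<and> \<gamma> \<omega> \<le> ennreal t" for \<omega>
        by (cases "\<gamma> \<omega>") (auto simp: top_unique)
      then show ?thesis by auto
    qed
    then have "emeasure ?N {..t} = emeasure P (if t < 0 then {} else {\<omega>\<in>space P. \<gamma> \<omega> \<le> ennreal t})"
      by (subst em) auto
    then show ?thesis
      by (simp add: cdf_def measure_def G_def)
  qed
  have "dG P \<gamma> = interval_measure (cdf ?N)"
    unfolding dG_def by (intro arg_cong[where f=interval_measure] ext) (simp only: cdf)
  moreover have "interval_measure (cdf ?N) = ?N"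
  proof (rule cdf_unique')
    show "finite_borel_measure (interval_measure (cdf ?N))"
      by (rule finite_borel_measure_interval_measure[OF _ _ _ N.cdf_lim_at_top])
        (assumption | rule N.cdf_nondecreasing N.cdf_is_right_cont N.cdf_lim_at_bot measure_nonneg)+
    show "cdf (interval_measure (cdf ?N)) = cdf ?N"
      by (rule cdf_interval_measure)
        (assumption | rule N.cdf_nondecreasing N.cdf_is_right_cont N.cdf_lim_at_bot measure_nonneg)+
  qed (rule N)
  ultimately show *: "dG P \<gamma> = ?N" by simp
  show "finite_borel_measure (dG P \<gamma>)" unfolding * by (rule N)
  show "cdf (dG P \<gamma>) t = (if t < 0 then 0 else G P \<gamma> t)" unfolding * by (rule cdf)
qed

sublocale dG: finite_borel_measure "dG P \<gamma>"
  by (rule finite_borel_measure_dG)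

lemma sets_dG [simp, measurable_cong]: "sets (dG P \<gamma>) = sets borel"
  and space_dG [simp]: "space (dG P \<gamma>) = UNIV"
  by (simp_all add: dG_eq_distr)

lemma nn_integral_dG:
  assumes [measurable]: "h \<in> borel_measurable borel"
  shows "(\<integral>\<^sup>+s. h s \<partial>dG P \<gamma>) = (\<integral>\<^sup>+\<omega>. h (enn2real (\<gamma> \<omega>)) * indicator {\<omega>. \<gamma> \<omega> < \<infinity>} \<omega> \<partial>P)"
proof -
  have [measurable]: "(indicator {\<omega>. \<gamma> \<omega> < \<infinity>} :: 'a \<Rightarrow> ennreal) \<in> borel_measurable P"
    by measurable
  show ?thesis
    by (simp add: dG_eq_distr nn_integral_distr nn_integral_density mult.commute)
qed

lemma
  fixes h :: "real \<Rightarrow> real"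
  assumes [measurable]: "h \<in> borel_measurable borel"
  shows integral_dG: "(LINT s|dG P \<gamma>. h s) =
      (LINT \<omega>|P. h (enn2real (\<gamma> \<omega>)) * indicator {\<omega>. \<gamma> \<omega> < \<infinity>} \<omega>)"
    and integrable_dG_iff: "integrable (dG P \<gamma>) h \<longleftrightarrow>
      integrable P (\<lambda>\<omega>. h (enn2real (\<gamma> \<omega>)) * indicator {\<omega>. \<gamma> \<omega> < \<infinity>} \<omega>)"
proof -
  have m [measurable]: "(indicator {\<omega>. \<gamma> \<omega> < \<infinity>} :: 'a \<Rightarrow> real) \<in> borel_measurable P"
    by measurable
  have *: "density P (indicator {\<omega>. \<gamma> \<omega> < \<infinity>}) =
      density P (\<lambda>\<omega>. ennreal (indicator {\<omega>. \<gamma> \<omega> < \<infinity>} \<omega>))"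
    by (intro arg_cong[where f="density P"] ext) (simp split: split_indicator)
  show "(LINT s|dG P \<gamma>. h s) = (LINT \<omega>|P. h (enn2real (\<gamma> \<omega>)) * indicator {\<omega>. \<gamma> \<omega> < \<infinity>} \<omega>)"
    unfolding dG_eq_distr * by (simp add: integral_distr integral_density mult.commute)
  show "integrable (dG P \<gamma>) h \<longleftrightarrow>
      integrable P (\<lambda>\<omega>. h (enn2real (\<gamma> \<omega>)) * indicator {\<omega>. \<gamma> \<omega> < \<infinity>} \<omega>)"
    unfolding dG_eq_distr * by (simp add: integrable_distr_eq integrable_density mult.commute)
qed

lemma measure_dG_Ioc: "0 \<le> s \<Longrightarrow> s \<le> t \<Longrightarrow> measure (dG P \<gamma>) {s<..t} = G P \<gamma> t - G P \<gamma> s"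
  using dG.cdf_diff_eq[of s t] by (cases "s = t") (auto simp: cdf_dG)

lemma G_mono: "0 \<le> s \<Longrightarrow> s \<le> t \<Longrightarrow> G P \<gamma> s \<le> G P \<gamma> t"
  using dG.cdf_nondecreasing[of s t] by (simp add: cdf_dG)

lemma Gbar_eq: "Gbar P \<gamma> t = prob {\<omega>\<in>space P. ennreal t < \<gamma> \<omega>}"
proof -
  have "prob {\<omega>\<in>space P. \<not> \<gamma> \<omega> \<le> ennreal t} = 1 - prob {\<omega>\<in>space P. \<gamma> \<omega> \<le> ennreal t}"
    by (rule prob_neg) measurable
  then show ?thesis by (simp add: Gbar_def G_def not_le)
qed

lemma Gbar_nonneg: "0 \<le> Gbar P \<gamma> t" and Gbar_le_1: "Gbar P \<gamma> t \<le> 1"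
  by (simp_all add: Gbar_eq)

text \<open>As \<open>G\<close> is right-continuous, \<open>G t < 1\<close> persists a little to the right of \<open>t\<close>; hence no such \<open>t\<close> reaches
the supremum \<open>t_G\<close>.\<close>

lemma before_tG_iff: "t \<in> before_tG P \<gamma> \<longleftrightarrow> 0 \<le> t \<and> 0 < Gbar P \<gamma> t"
proof
  assume t: "t \<in> before_tG P \<gamma>"
  then have "ennreal t < (SUP t\<in>{t. 0 \<le> t \<and> G P \<gamma> t < 1}. ennreal t)"
    by (simp add: before_tG_def t_G_def)
  then obtain t' where "0 \<le> t'" "G P \<gamma> t' < 1" "ennreal t < ennreal t'"
    by (auto simp: less_SUP_iff)
  with t G_mono[of t t'] show "0 \<le> t \<and> 0 < Gbar P \<gamma> t"
    by (auto simp: Gbar_def before_tG_def ennreal_less_iff)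
next
  assume t: "0 \<le> t \<and> 0 < Gbar P \<gamma> t"
  have "continuous (at_right t) (cdf (dG P \<gamma>))"
    by (rule dG.cdf_is_right_cont)
  moreover have "cdf (dG P \<gamma>) t < 1"
    using t by (simp add: cdf_dG Gbar_def)
  ultimately have "eventually (\<lambda>s. cdf (dG P \<gamma>) s < 1) (at_right t)"
    by (simp add: continuous_within order_tendsto_iff)
  then obtain b where b: "t < b" "\<And>s. t < s \<Longrightarrow> s < b \<Longrightarrow> cdf (dG P \<gamma>) s < 1"
    by (auto simp: eventually_at_right[of t "t+1"])
  define s where "s = (t + b) / 2"
  have s: "t < s" "G P \<gamma> s < 1" "0 \<le> s"
    using b(1) b(2)[of s] t by (auto simp: s_def cdf_dG split: if_splits)
  then have "ennreal t < ennreal s"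
    using t by (simp add: ennreal_less_iff)
  also have "ennreal s \<le> t_G P \<gamma>"
    unfolding t_G_def using s by (intro SUP_upper) auto
  finally show "t \<in> before_tG P \<gamma>"
    using t by (simp add: before_tG_def)
qed

lemma before_tG_subset_TT: "before_tG P \<gamma> \<subseteq> TT P \<gamma>"
proof
  fix t assume t: "t \<in> before_tG P \<gamma>"
  have "Gbar P \<gamma> t \<le> prob {\<omega>\<in>space P. \<gamma> \<omega> \<ge> ennreal t}"
    unfolding Gbar_eq by (intro finite_measure_mono) auto
  with t show "t \<in> TT P \<gamma>"
    by (auto simp: before_tG_iff TT_def)
qed

lemma TT_down: "t \<in> TT P \<gamma> \<Longrightarrow> 0 \<le> s \<Longrightarrow> s \<le> t \<Longrightarrow> s \<in> TT P \<gamma>"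
proof -
  assume t: "t \<in> TT P \<gamma>" and s: "0 \<le> s" "s \<le> t"
  have "prob {\<omega>\<in>space P. \<gamma> \<omega> \<ge> ennreal t} \<le> prob {\<omega>\<in>space P. \<gamma> \<omega> \<ge> ennreal s}"
    using s by (intro finite_measure_mono) (auto intro: order_trans[OF ennreal_leI])
  with t s show "s \<in> TT P \<gamma>" by (auto simp: TT_def)
qed

lemma before_tG_down: "t \<in> before_tG P \<gamma> \<Longrightarrow> 0 \<le> s \<Longrightarrow> s \<le> t \<Longrightarrow> s \<in> before_tG P \<gamma>"
  using order.strict_trans1[OF ennreal_leI] by (auto simp: before_tG_def)

lemma sets_before_tG [measurable]: "before_tG P \<gamma> \<in> sets borel"
  unfolding before_tG_def by measurable

lemma zero_before_tG: "0 \<in> before_tG P \<gamma>"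
  using jump_pos by (simp add: before_tG_iff Gbar_eq)

lemma tG_pos: "0 < t_G P \<gamma>"
  using zero_before_tG by (simp add: before_tG_def)

lemma AE_le_tG: "AE \<omega> in P. \<gamma> \<omega> \<le> t_G P \<gamma>"
proof (cases "t_G P \<gamma>")
  case (real r)
  then have "r \<notin> before_tG P \<gamma>" by (simp add: before_tG_def)
  then have "prob {\<omega>\<in>space P. \<gamma> \<omega> \<le> ennreal r} = 1"
    using real Gbar_nonneg[of r] prob_le_1[of "{\<omega>\<in>space P. \<gamma> \<omega> \<le> ennreal r}"]
    by (simp add: before_tG_iff Gbar_def G_def)
  with real show ?thesis
    by (subst (asm) prob_Collect_eq_1) auto
qed simp

text \<open>\<open>TT\<close> exceeds \<open>[0,t_G)\<close> by at most the point \<open>t_G\<close>, since \<open>\<gamma> \<le> t_G\<close> almost surely.\<close>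

lemma sets_TT [measurable]: "TT P \<gamma> \<in> sets borel"
proof -
  have "TT P \<gamma> - before_tG P \<gamma> \<subseteq> {enn2real (t_G P \<gamma>)}"
  proof
    fix t assume t: "t \<in> TT P \<gamma> - before_tG P \<gamma>"
    have "\<not> t_G P \<gamma> < ennreal t"
    proof
      assume "t_G P \<gamma> < ennreal t"
      with AE_le_tG have "AE \<omega> in P. \<not> ennreal t \<le> \<gamma> \<omega>"
        by (auto simp: not_le)
      then have "prob {\<omega>\<in>space P. \<gamma> \<omega> \<ge> ennreal t} = 0"
        by (subst prob_Collect_eq_0) auto
      with t show False by (simp add: TT_def)
    qed
    with t have "t_G P \<gamma> = ennreal t" "0 \<le> t"
      by (auto simp: before_tG_def TT_def)
    then show "t \<in> {enn2real (t_G P \<gamma>)}" by simp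
  qed
  then have "TT P \<gamma> - before_tG P \<gamma> \<in> sets borel"
    by (metis borel_closed closed_empty closed_singleton subset_singletonD)
  then have "before_tG P \<gamma> \<union> (TT P \<gamma> - before_tG P \<gamma>) \<in> sets borel"
    by (intro sets.Un) auto
  with before_tG_subset_TT show ?thesis
    by (simp add: Un_absorb1)
qed

lemma case_B_iff_not_case_A: "case_B P \<gamma> \<longleftrightarrow> \<not> case_A P \<gamma>"
  by (simp add: case_A_def case_B_def less_le)

lemma case_B_tG:
  assumes "case_B P \<gamma>"
  obtains r where "t_G P \<gamma> = ennreal r" "0 < r" "r \<in> TT P \<gamma>"
proof (cases "t_G P \<gamma>")
  case (real r)
  have "measure P {\<omega>\<in>space P. \<gamma> \<omega> = t_G P \<gamma> \<and> t_G P \<gamma> < \<infinity>} \<le> measure P {\<omega>\<in>space P. ennreal r \<le> \<gamma> \<omega>}"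
    by (intro finite_measure_mono) (auto simp: real)
  with assms real that[of r] tG_pos show ?thesis
    by (auto simp: case_B_def TT_def)
qed (use assms in \<open>simp add: case_B_def\<close>)

lemma AE_finite_before_tG:
  assumes "case_A P \<gamma>"
  shows "AE \<omega> in P. \<gamma> \<omega> < \<infinity> \<longrightarrow> enn2real (\<gamma> \<omega>) \<in> before_tG P \<gamma> \<and> \<gamma> \<omega> < t_G P \<gamma>"
proof -
  have "AE \<omega> in P. \<not> (\<gamma> \<omega> = t_G P \<gamma> \<and> t_G P \<gamma> < \<infinity>)"
    using assms by (simp add: case_A_def prob_Collect_eq_0)
  with AE_le_tG show ?thesis
  proof eventually_elim
    case (elim \<omega>)
    then show ?case
      by (cases "\<gamma> \<omega>") (auto simp: before_tG_def less_le)
  qed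
qed

lemma TT_eq_before_tG:
  assumes "case_A P \<gamma>"
  shows "TT P \<gamma> = before_tG P \<gamma>"
proof (intro equalityI before_tG_subset_TT subsetI)
  fix t assume t: "t \<in> TT P \<gamma>"
  have "ennreal t < t_G P \<gamma>"
  proof (rule ccontr)
    assume *: "\<not> ennreal t < t_G P \<gamma>"
    have "AE \<omega> in P. \<not> (\<gamma> \<omega> \<ge> ennreal t)"
      using AE_finite_before_tG[OF assms] AE_le_tG 
    proof eventually_elim
      case (elim \<omega>)
      show ?case
      proof
        assume "ennreal t \<le> \<gamma> \<omega>"
        with * have "t_G P \<gamma> \<le> \<gamma> \<omega>" "t_G P \<gamma> < \<infinity>"
          by (auto simp: not_less intro: order_trans le_less_trans[OF _ ennreal_less_top])
        with elim show False by auto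
      qed
    qed
    then have "prob {\<omega>\<in>space P. \<gamma> \<omega> \<ge> ennreal t} = 0"
      by (subst prob_Collect_eq_0) auto
    with t show False by (simp add: TT_def)
  qed
  with t show "t \<in> before_tG P \<gamma>" by (simp add: before_tG_def TT_def)
qed

text \<open>A description of \<open>t \<up> t_G\<close> that does not distinguish finite from infinite \<open>t_G\<close>.\<close>

lemma eventually_to_tG:
  "eventually Q (to_tG P \<gamma>) \<longleftrightarrow> (\<exists>b\<in>before_tG P \<gamma>. \<forall>t\<in>before_tG P \<gamma>. b < t \<longrightarrow> Q t)"
proof (cases "t_G P \<gamma>")
  case (real r)
  then have r: "0 < r" using tG_pos by (simp add: ennreal_less_zero_iff)
  have b: "t \<in> before_tG P \<gamma> \<longleftrightarrow> 0 \<le> t \<and> t < r" for t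
    using real by (auto simp: before_tG_def ennreal_less_iff)
  show ?thesis
  proof
    assume "eventually Q (to_tG P \<gamma>)"
    then obtain c where c: "c < r" "\<And>t. c < t \<Longrightarrow> t < r \<Longrightarrow> Q t"
      using r real by (auto simp: to_tG_def eventually_at_left[of 0 r])
    show "\<exists>b\<in>before_tG P \<gamma>. \<forall>t\<in>before_tG P \<gamma>. b < t \<longrightarrow> Q t"
      using c r by (intro bexI[of _ "max 0 c"]) (auto simp: b)
  qed (use r real in \<open>auto simp: to_tG_def eventually_at_left[of 0 r] b\<close>)
next
  case top
  then have b: "t \<in> before_tG P \<gamma> \<longleftrightarrow> 0 \<le> t" for t
    by (auto simp: before_tG_def)
  show ?thesis
  proof
    assume "eventually Q (to_tG P \<gamma>)"
    then obtain c where c: "\<And>t. c < t \<Longrightarrow> Q t"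
      using top by (auto simp: to_tG_def eventually_at_top_dense)
    show "\<exists>b\<in>before_tG P \<gamma>. \<forall>t\<in>before_tG P \<gamma>. b < t \<longrightarrow> Q t"
      using c by (intro bexI[of _ "max 0 c"]) (auto simp: b)
  next
    assume "\<exists>c\<in>before_tG P \<gamma>. \<forall>t\<in>before_tG P \<gamma>. c < t \<longrightarrow> Q t"
    then obtain c where "0 \<le> c" "\<And>t. c < t \<Longrightarrow> Q t"
      by (auto simp: b)
    then show "eventually Q (to_tG P \<gamma>)"
      using top by (auto simp: to_tG_def eventually_at_top_dense)
  qed
qed

lemma to_tG_neq_bot [simp]: "to_tG P \<gamma> \<noteq> bot"
  using tG_pos by (auto simp: to_tG_def trivial_limit_at_left_real)

text \<open>Limits at \<open>t_G\<close> can be taken along sequences, which makes dominated convergence applicable.\<close>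

lemma tendsto_to_tG_sequentially:
  fixes X :: "real \<Rightarrow> real"
  assumes "\<And>S. (\<And>n. S n \<in> before_tG P \<gamma>) \<Longrightarrow> (\<lambda>n. ennreal (S n)) \<longlonglongrightarrow> t_G P \<gamma> \<Longrightarrow>
    (\<lambda>n. X (S n)) \<longlonglongrightarrow> l"
  shows "(X \<longlongrightarrow> l) (to_tG P \<gamma>)"
proof (cases "t_G P \<gamma>")
  case (real r)
  then have r: "0 < r" using tG_pos by (simp add: ennreal_less_zero_iff)
  have "(X \<longlongrightarrow> l) (at_left r)"
    using r
  proof (rule tendsto_at_left_sequentially)
    fix S :: "nat \<Rightarrow> real"
    assume S: "\<And>n. S n < r" "\<And>n. 0 < S n" "S \<longlonglongrightarrow> r"
    show "(\<lambda>n. X (S n)) \<longlonglongrightarrow> l"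
    proof (rule assms)
      show "S n \<in> before_tG P \<gamma>" for n
        using S(1,2)[of n] real by (auto simp: before_tG_def ennreal_less_iff)
      show "(\<lambda>n. ennreal (S n)) \<longlonglongrightarrow> t_G P \<gamma>"
        unfolding real by (intro tendsto_ennrealI S)
    qed
  qed
  with real show ?thesis by (simp add: to_tG_def)
next
  case top
  have "(X \<longlongrightarrow> l) at_top"
  proof (rule tendsto_at_topI_sequentially)
    fix S :: "nat \<Rightarrow> real" assume S: "filterlim S at_top sequentially"
    have "(\<lambda>n. X (max 0 (S n))) \<longlonglongrightarrow> l"
    proof (rule assms)
      show "max 0 (S n) \<in> before_tG P \<gamma>" for n
        using top by (auto simp: before_tG_def)
      have "(\<lambda>n. ennreal (S n)) \<longlonglongrightarrow> \<infinity>"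
        using S by (simp add: ennreal_tendsto_top_eq_at_top)
      moreover have "ennreal (max 0 (S n)) = ennreal (S n)" for n
        by (simp add: max_def ennreal_neg)
      ultimately show "(\<lambda>n. ennreal (max 0 (S n))) \<longlonglongrightarrow> t_G P \<gamma>"
        using top by simp
    qed
    moreover have "\<forall>\<^sub>F n in sequentially. X (max 0 (S n)) = X (S n)"
      using filterlim_at_top_dense[THEN iffD1, OF S, rule_format, of 0] 
      by eventually_elim simp
    ultimately show "(\<lambda>n. X (S n)) \<longlonglongrightarrow> l"
      by (simp add: tendsto_cong)
  qed
  with top show ?thesis by (simp add: to_tG_def)
qed

lemma ex_seq_to_tG:
  obtains S where "\<And>n. S n \<in> before_tG P \<gamma>" "incseq S" "(\<lambda>n. ennreal (S n)) \<longlonglongrightarrow> t_G P \<gamma>"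
proof (cases "t_G P \<gamma>")
  case (real r)
  then have r: "0 < r" using tG_pos by (simp add: ennreal_less_zero_iff)
  define S where "S n = r - r / real (Suc n)" for n
  show ?thesis
  proof (rule that[of S])
    show "S n \<in> before_tG P \<gamma>" for n
      using r real by (auto simp: before_tG_def S_def ennreal_less_iff field_simps)
    show "incseq S"
      using r by (auto simp: S_def incseq_def intro!: divide_left_mono)
    have "S \<longlonglongrightarrow> r - 0"
      unfolding S_def by (intro tendsto_intros lim_const_over_n[THEN LIMSEQ_Suc])
    then show "(\<lambda>n. ennreal (S n)) \<longlonglongrightarrow> t_G P \<gamma>"
      unfolding real by (intro tendsto_ennrealI) simp
  qed
next
  case top
  show ?thesis
  proof (rule that[of real])
    show "(\<lambda>n. ennreal (real n)) \<longlonglongrightarrow> t_G P \<gamma>"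
      unfolding top by (simp add: ennreal_tendsto_top_eq_at_top filterlim_real_sequentially)
  qed (use top in \<open>auto simp: before_tG_def incseq_def\<close>)
qed

end

section \<open>Conditional expectations and uniform integrability\<close>

lemma ennreal_tendsto_0I:
  fixes h :: "'b \<Rightarrow> ennreal"
  assumes "\<And>\<epsilon>::real. 0 < \<epsilon> \<Longrightarrow> eventually (\<lambda>x. h x \<le> ennreal \<epsilon>) F"
  shows "(h \<longlongrightarrow> 0) F"
proof (rule order_tendstoI)
  fix a :: ennreal assume "0 < a"
  then obtain e where e: "0 < e" "e < a"
    using dense by blast
  then obtain \<epsilon> :: real where "0 < \<epsilon>" "ennreal \<epsilon> < a"
    by (cases e) (auto simp: ennreal_less_zero_iff)
  with assms[of \<epsilon>] show "eventually (\<lambda>x. h x < a) F"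
    by (auto elim!: eventually_mono)
qed simp

lemma uniformly_integrableI:
  assumes "\<And>\<epsilon>::real. 0 < \<epsilon> \<Longrightarrow> \<exists>c0. \<forall>c\<ge>c0. \<forall>t\<in>I.
    (\<integral>\<^sup>+\<omega>. ennreal \<bar>X t \<omega>\<bar> * indicator {\<omega>. c < \<bar>X t \<omega>\<bar>} \<omega> \<partial>M) \<le> ennreal \<epsilon>"
  shows "uniformly_integrable M I X"
  unfolding uniformly_integrable_def
proof (rule ennreal_tendsto_0I)
  fix \<epsilon> :: real assume "0 < \<epsilon>"
  from assms[OF this] show "\<forall>\<^sub>F c in at_top. (SUP t\<in>I.
    \<integral>\<^sup>+\<omega>. ennreal \<bar>X t \<omega>\<bar> * indicator {\<omega>. c < \<bar>X t \<omega>\<bar>} \<omega> \<partial>M) \<le> ennreal \<epsilon>"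
    by (auto simp: eventually_at_top_linorder intro!: SUP_least)
qed

lemma uniformly_integrableD:
  assumes "uniformly_integrable M I X" "0 < (\<epsilon>::real)"
  obtains c where "\<And>t. t \<in> I \<Longrightarrow>
    (\<integral>\<^sup>+\<omega>. ennreal \<bar>X t \<omega>\<bar> * indicator {\<omega>. c < \<bar>X t \<omega>\<bar>} \<omega> \<partial>M) < ennreal \<epsilon>"
proof -
  have "\<forall>\<^sub>F c in at_top. (SUP t\<in>I.
    \<integral>\<^sup>+\<omega>. ennreal \<bar>X t \<omega>\<bar> * indicator {\<omega>. c < \<bar>X t \<omega>\<bar>} \<omega> \<partial>M) < ennreal \<epsilon>"
    using assms by (auto simp: uniformly_integrable_def order_tendsto_iff)
  then obtain c where "(SUP t\<in>I.
    \<integral>\<^sup>+\<omega>. ennreal \<bar>X t \<omega>\<bar> * indicator {\<omega>. c < \<bar>X t \<omega>\<bar>} \<omega> \<partial>M) < ennreal \<epsilon>"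
    by (auto simp: eventually_at_top_linorder)
  then have "(\<integral>\<^sup>+\<omega>. ennreal \<bar>X t \<omega>\<bar> * indicator {\<omega>. c < \<bar>X t \<omega>\<bar>} \<omega> \<partial>M) < ennreal \<epsilon>"
    if "t \<in> I" for t
    using SUP_lessD that by fast
  then show ?thesis by (rule that)
qed

lemma tendsto_nn_integral_tail_0:
  fixes D :: "'a \<Rightarrow> real"
  assumes D: "integrable M D"
  shows "((\<lambda>c. \<integral>\<^sup>+\<omega>. ennreal \<bar>D \<omega>\<bar> * indicator {\<omega>. c < \<bar>D \<omega>\<bar>} \<omega> \<partial>M) \<longlongrightarrow> 0) at_top"
proof (rule tendsto_at_topI_sequentially)
  fix S :: "nat \<Rightarrow> real" assume S: "filterlim S at_top sequentially"
  have [measurable]: "D \<in> borel_measurable M" using D by simp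
  have "(\<lambda>n. \<integral>\<^sup>+\<omega>. ennreal \<bar>D \<omega>\<bar> * indicator {\<omega>. S n < \<bar>D \<omega>\<bar>} \<omega> \<partial>M) \<longlonglongrightarrow> (\<integral>\<^sup>+\<omega>. 0 \<partial>M)"
  proof (rule nn_integral_dominated_convergence[where w="\<lambda>\<omega>. ennreal \<bar>D \<omega>\<bar>"])
    show "(\<integral>\<^sup>+\<omega>. ennreal \<bar>D \<omega>\<bar> \<partial>M) < \<infinity>"
      using D by (simp add: integrable_iff_bounded)
    show "AE \<omega> in M. (\<lambda>n. ennreal \<bar>D \<omega>\<bar> * indicator {\<omega>. S n < \<bar>D \<omega>\<bar>} \<omega>) \<longlonglongrightarrow> 0"
    proof (rule AE_I2)
      fix \<omega>
      have "\<forall>\<^sub>F n in sequentially. \<bar>D \<omega>\<bar> < S n"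
        using S by (simp add: filterlim_at_top_dense)
      then show "(\<lambda>n. ennreal \<bar>D \<omega>\<bar> * indicator {\<omega>. S n < \<bar>D \<omega>\<bar>} \<omega>) \<longlonglongrightarrow> 0"
        by (intro tendsto_eventually) (elim eventually_mono, auto)
    qed
  qed (auto split: split_indicator)
  then show "(\<lambda>n. \<integral>\<^sup>+\<omega>. ennreal \<bar>D \<omega>\<bar> * indicator {\<omega>. S n < \<bar>D \<omega>\<bar>} \<omega> \<partial>M) \<longlonglongrightarrow> 0"
    by simp
qed

text \<open>The tails of \<open>X t\<close> are smaller than those of the common bound \<open>D\<close>.\<close>

lemma uniformly_integrable_dominated:
  fixes D :: "'a \<Rightarrow> real"
  assumes D: "integrable M D" and le: "\<And>t. t \<in> I \<Longrightarrow> AE \<omega> in M. \<bar>X t \<omega>\<bar> \<le> D \<omega>"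
  shows "uniformly_integrable M I X"
proof (rule uniformly_integrableI)
  fix \<epsilon> :: real assume "0 < \<epsilon>"
  then have "\<forall>\<^sub>F c in at_top. (\<integral>\<^sup>+\<omega>. ennreal \<bar>D \<omega>\<bar> * indicator {\<omega>. c < \<bar>D \<omega>\<bar>} \<omega> \<partial>M) < ennreal \<epsilon>"
    using tendsto_nn_integral_tail_0[OF D] by (simp add: order_tendsto_iff)
  then obtain c0 where c0: "\<And>c. c0 \<le> c \<Longrightarrow>
      (\<integral>\<^sup>+\<omega>. ennreal \<bar>D \<omega>\<bar> * indicator {\<omega>. c < \<bar>D \<omega>\<bar>} \<omega> \<partial>M) < ennreal \<epsilon>"
    by (auto simp: eventually_at_top_linorder)
  show "\<exists>c0. \<forall>c\<ge>c0. \<forall>t\<in>I.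
    (\<integral>\<^sup>+\<omega>. ennreal \<bar>X t \<omega>\<bar> * indicator {\<omega>. c < \<bar>X t \<omega>\<bar>} \<omega> \<partial>M) \<le> ennreal \<epsilon>"
  proof (intro exI allI ballI impI)
    fix c t assume c: "c0 \<le> c" and t: "t \<in> I"
    have "(\<integral>\<^sup>+\<omega>. ennreal \<bar>X t \<omega>\<bar> * indicator {\<omega>. c < \<bar>X t \<omega>\<bar>} \<omega> \<partial>M)
        \<le> (\<integral>\<^sup>+\<omega>. ennreal \<bar>D \<omega>\<bar> * indicator {\<omega>. c < \<bar>D \<omega>\<bar>} \<omega> \<partial>M)"
      using le[OF t] by (intro nn_integral_mono_AE)
        (auto elim!: eventually_mono split: split_indicator intro!: ennreal_leI)
    with c0[OF c] show "(\<integral>\<^sup>+\<omega>. ennreal \<bar>X t \<omega>\<bar> * indicator {\<omega>. c < \<bar>X t \<omega>\<bar>} \<omega> \<partial>M) \<le> ennreal \<epsilon>"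
      by simp
  qed
qed

context single_jump
begin

abbreviation \<FF> :: "ennreal \<Rightarrow> 'a measure" where
  "\<FF> \<equiv> sj_filtration P \<gamma>"

lemma subalgebra_sj: "subalgebra P (\<FF> t)"
  by (auto simp: subalgebra_def space_sj_filtration sets_sj_filtration sj_sets_def)

lemma measurable_sjI:
  assumes X: "X \<in> borel_measurable P" and c: "\<And>\<omega>. \<omega> \<in> space P \<Longrightarrow> t < \<gamma> \<omega> \<Longrightarrow> X \<omega> = c"
  shows "X \<in> borel_measurable (\<FF> t)"
proof (rule measurableI)
  fix A :: "'b set" assume "A \<in> sets borel"
  with X have "X -` A \<inter> space P \<in> sets P" by (rule measurable_sets)
  with c show "X -` A \<inter> space (\<FF> t) \<in> sets (\<FF> t)"
    by (cases "c \<in> A") (auto simp: space_sj_filtration sets_sj_filtration sj_sets_def)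
qed simp

lemma measurable_sj_top: "X \<in> borel_measurable P \<Longrightarrow> X \<in> borel_measurable (\<FF> \<infinity>)"
  by (rule measurable_sjI) auto

lemma measurable_from_sj: "X \<in> borel_measurable (\<FF> t) \<Longrightarrow> X \<in> borel_measurable P"
  by (rule measurable_from_subalg[OF subalgebra_sj])

text \<open>An event at time \<open>s\<close> contains \<open>{s < \<gamma>}\<close> or is disjoint from it, and is arbitrary on \<open>{\<gamma> \<le> s}\<close>. So a
candidate \<open>Y\<close> that agrees with \<open>X\<close> on \<open>{\<gamma> \<le> s}\<close> needs correction only by one constant on \<open>{s < \<gamma>}\<close>,
namely the mean defect there. If \<open>{s < \<gamma>}\<close> is a null set, the quotient is \<open>0\<close> by convention.\<close>

lemma real_cond_exp_sj:
  fixes X Y :: "'a \<Rightarrow> real"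
  assumes X: "integrable P X" and Y: "integrable P Y"
    and Ym: "Y \<in> borel_measurable (\<FF> s)" and eq: "AE \<omega> in P. \<gamma> \<omega> \<le> s \<longrightarrow> X \<omega> = Y \<omega>"
  shows "AE \<omega> in P. real_cond_exp P (\<FF> s) X \<omega> = Y \<omega> +
    ((LINT \<omega>|P. X \<omega> * indicator {\<omega>. s < \<gamma> \<omega>} \<omega>) - (LINT \<omega>|P. Y \<omega> * indicator {\<omega>. s < \<gamma> \<omega>} \<omega>)) /
      prob {\<omega>\<in>space P. s < \<gamma> \<omega>} * indicator {\<omega>. s < \<gamma> \<omega>} \<omega>"
proof -
  interpret S: finite_measure_subalgebra P "\<FF> s"
    by unfold_locales (rule subalgebra_sj)
  let ?J = "{\<omega>\<in>space P. s < \<gamma> \<omega>}"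
  let ?j = "indicator {\<omega>. s < \<gamma> \<omega>} :: 'a \<Rightarrow> real"
  define dlt where "dlt = (LINT \<omega>|P. X \<omega> * ?j \<omega>) - (LINT \<omega>|P. Y \<omega> * ?j \<omega>)"
  define c where "c = dlt / prob ?J"
  have [measurable]: "X \<in> borel_measurable P" "Y \<in> borel_measurable P"
    using X Y by auto
  have jm: "?j \<in> borel_measurable P" by measurable
  have jm': "?j \<in> borel_measurable (\<FF> s)"
    by (rule measurable_sjI[OF jm, of _ 1]) auto
  have intj: "integrable P ?j"
    by (rule integrable_const_bound[of _ 1]) (use jm in auto)
  have Xj: "integrable P (\<lambda>\<omega>. X \<omega> * ?j \<omega>)"
    by (rule Bochner_Integration.integrable_bound[OF X]) (use jm in \<open>auto split: split_indicator\<close>)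
  have Yj: "integrable P (\<lambda>\<omega>. Y \<omega> * ?j \<omega>)"
    by (rule Bochner_Integration.integrable_bound[OF Y]) (use jm in \<open>auto split: split_indicator\<close>)
  have intj_eq: "(LINT \<omega>|P. ?j \<omega>) = prob ?J"
  proof -
    have "(LINT \<omega>|P. ?j \<omega>) = (LINT \<omega>|P. indicator ?J \<omega>)"
      by (intro Bochner_Integration.integral_cong) (auto split: split_indicator)
    then show ?thesis by simp
  qed
  have cp: "c * prob ?J = dlt"
  proof (cases "prob ?J = 0")
    case True
    then have "AE \<omega> in P. \<not> s < \<gamma> \<omega>"
      by (subst (asm) prob_Collect_eq_0) auto
    then have "(LINT \<omega>|P. X \<omega> * ?j \<omega>) = (LINT \<omega>|P. Y \<omega> * ?j \<omega>)"
      by (intro integral_cong_AE) (use jm in auto)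
    with True show ?thesis by (simp add: dlt_def)
  qed (simp add: c_def)
  have "AE \<omega> in P. real_cond_exp P (\<FF> s) X \<omega> = Y \<omega> + c * ?j \<omega>"
  proof (rule S.real_cond_exp_charact)
    show "integrable P (\<lambda>\<omega>. Y \<omega> + c * ?j \<omega>)"
      using Y intj by simp
    show "(\<lambda>\<omega>. Y \<omega> + c * ?j \<omega>) \<in> borel_measurable (\<FF> s)"
      using Ym jm' by simp
    fix A assume A: "A \<in> sets (\<FF> s)"
    then have [measurable]: "A \<in> sets P"
      by (simp add: sets_sj_filtration sj_sets_def)
    have *: "(LINT \<omega>:A|P. X \<omega>) = (LINT \<omega>|P. indicator A \<omega> * Y \<omega>) + (LINT \<omega>|P. indicator A \<omega> * (X \<omega> * ?j \<omega>))
         - (LINT \<omega>|P. indicator A \<omega> * (Y \<omega> * ?j \<omega>))"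
    proof -
      have "(LINT \<omega>:A|P. X \<omega>) = (LINT \<omega>|P. indicator A \<omega> * Y \<omega> + indicator A \<omega> * (X \<omega> * ?j \<omega>) -
          indicator A \<omega> * (Y \<omega> * ?j \<omega>))"
        unfolding set_lebesgue_integral_def
        using eq jm by (intro integral_cong_AE) (auto elim!: eventually_mono split: split_indicator simp: not_less)
      then show ?thesis
        using integrable_mult_indicator[OF _ Y] integrable_mult_indicator[OF _ Xj]
          integrable_mult_indicator[OF _ Yj] by simp
    qed
    have **: "(LINT \<omega>:A|P. Y \<omega> + c * ?j \<omega>) =
        (LINT \<omega>|P. indicator A \<omega> * Y \<omega>) + c * (LINT \<omega>|P. indicator A \<omega> * ?j \<omega>)"
    proof -
      have "(LINT \<omega>:A|P. Y \<omega> + c * ?j \<omega>) =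
          (LINT \<omega>|P. indicator A \<omega> * Y \<omega> + c * (indicator A \<omega> * ?j \<omega>))"
        unfolding set_lebesgue_integral_def
        by (intro Bochner_Integration.integral_cong) (auto simp: algebra_simps)
      then show ?thesis
        using integrable_mult_indicator[OF _ Y] integrable_mult_indicator[OF _ intj] by simp
    qed
    consider "A \<inter> ?J = {}" | "A \<inter> ?J = ?J"
      using A by (auto simp: sets_sj_filtration sj_sets_def)
    then show "(LINT \<omega>:A|P. X \<omega>) = (LINT \<omega>:A|P. Y \<omega> + c * ?j \<omega>)"
    proof cases
      case 1
      then have "(LINT \<omega>|P. indicator A \<omega> * (k \<omega> * ?j \<omega>)) = 0" for k
        by (intro integral_eq_zero_AE AE_I2) (auto split: split_indicator)
      from this[of X] this[of Y] this[of "\<lambda>_. 1"] * ** show ?thesis by simp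
    next
      case 2
      then have "(LINT \<omega>|P. indicator A \<omega> * (k \<omega> * ?j \<omega>)) = (LINT \<omega>|P. k \<omega> * ?j \<omega>)" for k
        by (intro Bochner_Integration.integral_cong) (auto split: split_indicator)
      from this[of X] this[of Y] this[of "\<lambda>_. 1"] * ** intj_eq cp show ?thesis
        by (simp add: dlt_def)
    qed
  qed (rule X)
  then show ?thesis by (simp add: c_def dlt_def)
qed

text \<open>The generalized conditional expectation vanishes only where those of the positive and the negative part
are finite and equal. Both parts can then be tested against any nonnegative function of \<open>\<gamma>\<close>.\<close>

lemma nn_integral_gen_cond_exp_0:
  fixes k :: "ennreal \<Rightarrow> ennreal"
  assumes Y [measurable]: "Y \<in> borel_measurable P" and k [measurable]: "k \<in> borel_measurable borel"
    and 0: "AE \<omega> in P. gen_cond_exp P (vimage_algebra (space P) \<gamma> borel) Y \<omega> = 0"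
  shows "(\<integral>\<^sup>+\<omega>. k (\<gamma> \<omega>) * ennreal (Y \<omega>) \<partial>P) = (\<integral>\<^sup>+\<omega>. k (\<gamma> \<omega>) * ennreal (- Y \<omega>) \<partial>P)"
proof -
  let ?A = "vimage_algebra (space P) \<gamma> borel"
  have "subalgebra P ?A"
    by (auto simp: subalgebra_def sets_vimage_algebra2 intro: measurable_sets)
  then interpret S: finite_measure_subalgebra P ?A
    by unfold_locales
  have g [measurable]: "\<gamma> \<in> measurable ?A borel"
    by (rule measurable_vimage_algebra1) auto
  have max0: "ennreal (max 0 y) = ennreal y" for y
    by (simp add: max_def ennreal_neg)
  have ae: "AE \<omega> in P. nn_cond_exp P ?A (\<lambda>\<omega>. ennreal (Y \<omega>)) \<omega> = nn_cond_exp P ?A (\<lambda>\<omega>. ennreal (- Y \<omega>)) \<omega>"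
    using 0
  proof eventually_elim
    case (elim \<omega>)
    let ?a = "nn_cond_exp P ?A (\<lambda>\<omega>. ennreal (Y \<omega>)) \<omega>"
    let ?b = "nn_cond_exp P ?A (\<lambda>\<omega>. ennreal (- Y \<omega>)) \<omega>"
    have "enn2ereal ?a - enn2ereal ?b = 0"
      using elim by (simp add: gen_cond_exp_def max0)
    then have "enn2ereal ?a = enn2ereal ?b"
      by (cases "enn2ereal ?a"; cases "enn2ereal ?b") (auto simp: zero_ereal_def)
    then show ?case by (simp add: enn2ereal_inject)
  qed
  have "(\<integral>\<^sup>+\<omega>. k (\<gamma> \<omega>) * ennreal (Y \<omega>) \<partial>P) =
      (\<integral>\<^sup>+\<omega>. k (\<gamma> \<omega>) * nn_cond_exp P ?A (\<lambda>\<omega>. ennreal (Y \<omega>)) \<omega> \<partial>P)"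
    by (rule S.nn_cond_exp_intg[symmetric]) auto
  also have "\<dots> = (\<integral>\<^sup>+\<omega>. k (\<gamma> \<omega>) * nn_cond_exp P ?A (\<lambda>\<omega>. ennreal (- Y \<omega>)) \<omega> \<partial>P)"
    using ae by (intro nn_integral_cong_AE) auto
  also have "\<dots> = (\<integral>\<^sup>+\<omega>. k (\<gamma> \<omega>) * ennreal (- Y \<omega>) \<partial>P)"
    by (rule S.nn_cond_exp_intg) auto
  finally show ?thesis .
qed

text \<open>If the product is not integrable, its integral is \<open>0\<close> by convention; otherwise split both factors into
positive and negative parts.\<close>

lemma integral_gen_cond_exp_0:
  fixes k :: "ennreal \<Rightarrow> real"
  assumes Y [measurable]: "Y \<in> borel_measurable P" and k [measurable]: "k \<in> borel_measurable borel"
    and 0: "AE \<omega> in P. gen_cond_exp P (vimage_algebra (space P) \<gamma> borel) Y \<omega> = 0"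
  shows "(LINT \<omega>|P. k (\<gamma> \<omega>) * Y \<omega>) = 0"
proof (cases "integrable P (\<lambda>\<omega>. k (\<gamma> \<omega>) * Y \<omega>)")
  case True
  let ?I = "\<lambda>\<sigma> \<tau>. \<integral>\<^sup>+\<omega>. ennreal (\<sigma> * k (\<gamma> \<omega>)) * ennreal (\<tau> * Y \<omega>) \<partial>P"
  have split: "ennreal (\<sigma> * (k (\<gamma> \<omega>) * Y \<omega>)) =
      ennreal (k (\<gamma> \<omega>)) * ennreal (\<sigma> * Y \<omega>) + ennreal (- 1 * k (\<gamma> \<omega>)) * ennreal (- \<sigma> * Y \<omega>)" 
    if "\<sigma> = 1 \<or> \<sigma> = - 1" for \<sigma> \<omega>
    using that by (cases "0 \<le> k (\<gamma> \<omega>)"; cases "0 \<le> Y \<omega>")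
      (auto simp: ennreal_neg ennreal_mult[symmetric] mult_nonpos_nonneg mult_nonneg_nonpos mult_nonpos_nonpos)
  have "(\<integral>\<^sup>+\<omega>. ennreal (k (\<gamma> \<omega>) * Y \<omega>) \<partial>P) = ?I 1 1 + ?I (-1) (-1)"
    using split[of 1] by (simp add: nn_integral_add)
  moreover have "(\<integral>\<^sup>+\<omega>. ennreal (- (k (\<gamma> \<omega>) * Y \<omega>)) \<partial>P) = ?I 1 (-1) + ?I (-1) 1"
    using split[of "-1"] by (simp add: nn_integral_add)
  moreover have "?I \<sigma> 1 = ?I \<sigma> (-1)" for \<sigma>
    using nn_integral_gen_cond_exp_0[OF Y _ 0, of "\<lambda>x. ennreal (\<sigma> * k x)"] by simp
  ultimately have "(\<integral>\<^sup>+\<omega>. ennreal (k (\<gamma> \<omega>) * Y \<omega>) \<partial>P) = (\<integral>\<^sup>+\<omega>. ennreal (- (k (\<gamma> \<omega>) * Y \<omega>)) \<partial>P)"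
    by (simp only:)
  then show ?thesis
    using real_lebesgue_integral_def[OF True] by (simp only:)
qed (simp add: not_integrable_integral_eq)

text \<open>In Case A almost every finite value of \<open>\<gamma>\<close> lies below \<open>t_G\<close>, so the events \<open>{\<gamma> \<le> t}\<close> exhaust
\<open>{\<gamma> < \<infinity>}\<close> as \<open>t \<up> t_G\<close>.\<close>

lemma tendsto_integral_before_tG:
  fixes X :: "'a \<Rightarrow> real"
  assumes A: "case_A P \<gamma>" and X: "integrable P X"
  shows "((\<lambda>t. LINT \<omega>|P. X \<omega> * indicator {\<omega>. \<gamma> \<omega> \<le> ennreal t} \<omega>) \<longlongrightarrow>
    (LINT \<omega>|P. X \<omega> * indicator {\<omega>. \<gamma> \<omega> < \<infinity>} \<omega>)) (to_tG P \<gamma>)"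
proof (rule tendsto_to_tG_sequentially)
  fix S assume S: "\<And>n. S n \<in> before_tG P \<gamma>" "(\<lambda>n. ennreal (S n)) \<longlonglongrightarrow> t_G P \<gamma>"
  have [measurable]: "X \<in> borel_measurable P" using X by simp
  have m [measurable]: "(\<lambda>\<omega>. X \<omega> * indicator {\<omega>. \<gamma> \<omega> \<le> ennreal t} \<omega>) \<in> borel_measurable P" for t
    by measurable
  have m' [measurable]: "(\<lambda>\<omega>. X \<omega> * indicator {\<omega>. \<gamma> \<omega> < \<infinity>} \<omega>) \<in> borel_measurable P"
    by measurable
  show "(\<lambda>n. LINT \<omega>|P. X \<omega> * indicator {\<omega>. \<gamma> \<omega> \<le> ennreal (S n)} \<omega>) \<longlonglongrightarrow>
    (LINT \<omega>|P. X \<omega> * indicator {\<omega>. \<gamma> \<omega> < \<infinity>} \<omega>)"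
  proof (rule integral_dominated_convergence[where w="\<lambda>\<omega>. \<bar>X \<omega>\<bar>"])
    show "AE \<omega> in P. (\<lambda>n. X \<omega> * indicator {\<omega>. \<gamma> \<omega> \<le> ennreal (S n)} \<omega>) \<longlonglongrightarrow>
        X \<omega> * indicator {\<omega>. \<gamma> \<omega> < \<infinity>} \<omega>"
      using AE_finite_before_tG[OF A]
    proof eventually_elim
      case (elim \<omega>)
      show ?case
      proof (cases "\<gamma> \<omega> < \<infinity>")
        case True
        then have "\<gamma> \<omega> < t_G P \<gamma>" using elim by simp
        then have "\<forall>\<^sub>F n in sequentially. \<gamma> \<omega> < ennreal (S n)"
          using S(2) by (simp add: order_tendsto_iff)
        then show ?thesis
          using True by (intro tendsto_eventually) (elim eventually_mono, auto)
      next
        case False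
        then have "\<gamma> \<omega> = \<infinity>" by (cases "\<gamma> \<omega>") auto
        then show ?thesis by (simp add: top_unique)
      qed
    qed
  qed (use X in \<open>auto split: split_indicator\<close>)
qed

lemma Gbar_tendsto:
  assumes A: "case_A P \<gamma>"
  shows "(Gbar P \<gamma> \<longlongrightarrow> prob {\<omega>\<in>space P. \<gamma> \<omega> = \<infinity>}) (to_tG P \<gamma>)"
proof -
  have ind: "(LINT \<omega>|P. (1::real) * indicator {\<omega>. Q \<omega>} \<omega>) = prob {\<omega>\<in>space P. Q \<omega>}"
    if "Measurable.pred P Q" for Q
  proof -
    have "(LINT \<omega>|P. (1::real) * indicator {\<omega>. Q \<omega>} \<omega>) = (LINT \<omega>|P. indicator {\<omega>\<in>space P. Q \<omega>} \<omega>)"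
      by (intro Bochner_Integration.integral_cong) (auto simp: indicator_def)
    also have "\<dots> = prob {\<omega>\<in>space P. Q \<omega>}"
      using that by simp
    finally show ?thesis by simp
  qed
  have m1: "Measurable.pred P (\<lambda>\<omega>. \<gamma> \<omega> < \<infinity>)" and m2: "Measurable.pred P (\<lambda>\<omega>. \<gamma> \<omega> \<le> ennreal t)" for t
    by measurable
  have "(G P \<gamma> \<longlongrightarrow> prob {\<omega>\<in>space P. \<gamma> \<omega> < \<infinity>}) (to_tG P \<gamma>)"
    using tendsto_integral_before_tG[OF A integrable_const[of 1]]
    by (simp only: ind[OF m1] ind[OF m2] G_def[symmetric])
  then have "((\<lambda>t. 1 - G P \<gamma> t) \<longlongrightarrow> 1 - prob {\<omega>\<in>space P. \<gamma> \<omega> < \<infinity>}) (to_tG P \<gamma>)"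
    by (intro tendsto_intros)
  moreover have "prob {\<omega>\<in>space P. \<not> \<gamma> \<omega> < \<infinity>} = 1 - prob {\<omega>\<in>space P. \<gamma> \<omega> < \<infinity>}"
    by (rule prob_neg) measurable
  ultimately show ?thesis
    by (simp add: Gbar_def[abs_def] not_less top_unique)
qed

text \<open>Fatou's lemma along a sequence increasing to \<open>t_G\<close>.\<close>

lemma nn_integral_le_before_tG:
  assumes A: "case_A P \<gamma>" and Y [measurable]: "Y \<in> borel_measurable P"
    and le: "\<And>t. t \<in> before_tG P \<gamma> \<Longrightarrow> (\<integral>\<^sup>+\<omega>. Y \<omega> * indicator {\<omega>. \<gamma> \<omega> \<le> ennreal t} \<omega> \<partial>P) \<le> C"
  shows "(\<integral>\<^sup>+\<omega>. Y \<omega> * indicator {\<omega>. \<gamma> \<omega> < \<infinity>} \<omega> \<partial>P) \<le> C"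
proof -
  obtain S where S: "\<And>n. S n \<in> before_tG P \<gamma>" "(\<lambda>n. ennreal (S n)) \<longlonglongrightarrow> t_G P \<gamma>"
    by (rule ex_seq_to_tG) auto
  have m [measurable]: "(\<lambda>\<omega>. Y \<omega> * indicator {\<omega>. \<gamma> \<omega> \<le> ennreal t} \<omega>) \<in> borel_measurable P" for t
    by measurable
  have "(\<integral>\<^sup>+\<omega>. Y \<omega> * indicator {\<omega>. \<gamma> \<omega> < \<infinity>} \<omega> \<partial>P) \<le>
      (\<integral>\<^sup>+\<omega>. liminf (\<lambda>n. Y \<omega> * indicator {\<omega>. \<gamma> \<omega> \<le> ennreal (S n)} \<omega>) \<partial>P)"
  proof (rule nn_integral_mono_AE)
    show "AE \<omega> in P. Y \<omega> * indicator {\<omega>. \<gamma> \<omega> < \<infinity>} \<omega> \<le>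
        liminf (\<lambda>n. Y \<omega> * indicator {\<omega>. \<gamma> \<omega> \<le> ennreal (S n)} \<omega>)"
      using AE_finite_before_tG[OF A]
    proof eventually_elim
      case (elim \<omega>)
      show ?case
      proof (cases "\<gamma> \<omega> < \<infinity>")
        case True
        then have "\<gamma> \<omega> < t_G P \<gamma>" using elim by simp
        then have "\<forall>\<^sub>F n in sequentially. \<gamma> \<omega> < ennreal (S n)"
          using S(2) by (simp add: order_tendsto_iff)
        then show ?thesis
          using True by (intro Liminf_bounded) (auto elim!: eventually_mono)
      qed simp
    qed
  qed
  also have "\<dots> \<le> liminf (\<lambda>n. \<integral>\<^sup>+\<omega>. Y \<omega> * indicator {\<omega>. \<gamma> \<omega> \<le> ennreal (S n)} \<omega> \<partial>P)"
    by (rule nn_integral_liminf) measurable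
  also have "\<dots> \<le> limsup (\<lambda>n. \<integral>\<^sup>+\<omega>. Y \<omega> * indicator {\<omega>. \<gamma> \<omega> \<le> ennreal (S n)} \<omega> \<partial>P)"
    by (rule Liminf_le_Limsup) simp
  also have "\<dots> \<le> C"
    by (rule Limsup_bounded) (use le S in auto)
  finally show ?thesis .
qed

end

section \<open>The integrands of a representation\<close>

text \<open>The positive and the negative part of \<open>k\<close> are densities of measures with the same distribution
function.\<close>

lemma (in finite_borel_measure) AE_eq_0_if_integral_Iic_0:
  fixes k :: "real \<Rightarrow> real"
  assumes k: "integrable M k" and 0: "\<And>t. (LINT s|M. indicator {..t} s * k s) = 0"
  shows "AE s in M. k s = 0"
proof -
  have km [measurable]: "k \<in> borel_measurable M" using k by simp
  have fin: "(\<integral>\<^sup>+s. ennreal (k s) \<partial>M) \<noteq> \<infinity>" "(\<integral>\<^sup>+s. ennreal (- k s) \<partial>M) \<noteq> \<infinity>"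
    using k by (auto simp: real_integrable_def)
  let ?N = "\<lambda>h. density M (\<lambda>s. ennreal (h s))"
  have N: "finite_borel_measure (?N h)" if "(\<integral>\<^sup>+s. ennreal (h s) \<partial>M) \<noteq> \<infinity>" "h \<in> borel_measurable M" for h
  proof (intro finite_borel_measure.intro finite_borel_measure_axioms.intro finite_measureI)
    show "emeasure (?N h) (space (?N h)) \<noteq> \<infinity>"
      using that by (subst space_density, subst emeasure_density) (auto simp: indicator_def borel_UNIV)
  qed (simp add: M_is_borel)
  have "?N k = ?N (\<lambda>s. - k s)"
  proof (rule cdf_unique')
    show "cdf (?N k) = cdf (?N (\<lambda>s. - k s))"
    proof
      fix t
      have int: "integrable M (\<lambda>s. indicator {..t} s * k s)"
        using integrable_mult_indicator[OF _ k, of "{..t}"] by (simp add: M_is_borel)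
      have em: "emeasure (?N h) {..t} = (\<integral>\<^sup>+s. ennreal (indicator {..t} s * h s) \<partial>M)"
        if "h \<in> borel_measurable M" for h
        using that by (subst emeasure_density) (auto intro!: nn_integral_cong split: split_indicator)
      show "cdf (?N k) t = cdf (?N (\<lambda>s. - k s)) t"
        using 0[of t] real_lebesgue_integral_def[OF int]
        by (simp add: cdf_def measure_def em)
    qed
  qed (intro N fin km borel_measurable_uminus)+
  then have "AE s in M. ennreal (k s) = ennreal (- k s)"
    by (subst density_unique_iff[symmetric]) auto
  then show ?thesis
  proof eventually_elim
    case (elim s)
    then show ?case by (cases "0 \<le> k s") (auto simp: ennreal_neg ennreal_eq_0_iff)
  qed
qed

lemma (in single_jump) Gbar_measurable [measurable]: "Gbar P \<gamma> \<in> borel_measurable borel"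
proof -
  have "mono (G P \<gamma>)"
    unfolding G_def by (intro monoI finite_measure_mono) (auto intro: order_trans ennreal_leI)
  then have "G P \<gamma> \<in> borel_measurable borel"
    by (rule borel_measurable_mono)
  then show ?thesis unfolding Gbar_def[abs_def] by simp
qed

locale sj_process = single_jump P \<gamma> for P :: "'a measure" and \<gamma> +
  fixes F H f :: "real \<Rightarrow> real" and L' :: "'a \<Rightarrow> real" and M :: "real \<Rightarrow> 'a \<Rightarrow> real"
  assumes adapted_M: "adapted (\<lambda>t. sj_filtration P \<gamma> (ennreal t)) {0..} M"
    and representation: "sj_representation P \<gamma> F H L' M"
    and derivative: "has_dG_derivative P \<gamma> F f"
begin

text \<open>\<open>f\<close> and \<open>H\<close> are Borel on \<open>TT\<close> only; their continuations by \<open>0\<close> are Borel on the whole line.\<close>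

abbreviation f0 :: "real \<Rightarrow> real" where
  "f0 s \<equiv> indicator (TT P \<gamma>) s * f s"

abbreviation H0 :: "real \<Rightarrow> real" where
  "H0 s \<equiv> indicator (TT P \<gamma>) s * H s"

definition L :: "'a \<Rightarrow> real" where
  "L \<omega> = H_at P \<gamma> H \<omega> + L' \<omega>"

lemma f_L1_loc: "f \<in> L1_loc P \<gamma>" and H_L1_loc: "H \<in> L1_loc P \<gamma>"
  using derivative representation
  by (auto simp: has_dG_derivative_def sj_representation_def condition_M_def)

lemma f0_measurable [measurable]: "f0 \<in> borel_measurable borel"
  and H0_measurable [measurable]: "H0 \<in> borel_measurable borel"
  using f_L1_loc H_L1_loc by (auto simp: L1_loc_def set_borel_measurable_def)

lemma L1_loc_integrable:
  assumes "z \<in> L1_loc P \<gamma>" "t \<in> TT P \<gamma>"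
  shows "integrable (dG P \<gamma>) (\<lambda>s. indicator {0..t} s * (indicator (TT P \<gamma>) s * z s))"
proof (rule integrableI_bounded)
  have [measurable]: "(\<lambda>s. indicator (TT P \<gamma>) s * z s) \<in> borel_measurable borel"
    using assms by (auto simp: L1_loc_def set_borel_measurable_def)
  show "(\<lambda>s. indicator {0..t} s * (indicator (TT P \<gamma>) s * z s)) \<in> borel_measurable (dG P \<gamma>)"
    by measurable
  have "(\<integral>\<^sup>+s. ennreal (norm (indicator {0..t} s * (indicator (TT P \<gamma>) s * z s))) \<partial>dG P \<gamma>)
      \<le> (\<integral>\<^sup>+s\<in>{0..t}. ennreal \<bar>z s\<bar> \<partial>dG P \<gamma>)"
    by (intro nn_integral_mono) (auto split: split_indicator)
  also have "\<dots> < \<infinity>" using assms by (simp add: L1_loc_def)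
  finally show "(\<integral>\<^sup>+s. ennreal (norm (indicator {0..t} s * (indicator (TT P \<gamma>) s * z s))) \<partial>dG P \<gamma>) < \<infinity>" .
qed

lemma integrable_restrict:
  fixes z :: "real \<Rightarrow> real"
  assumes "integrable (dG P \<gamma>) (\<lambda>s. indicator {0..t} s * z s)"
    and [measurable]: "z \<in> borel_measurable borel" "A \<in> sets borel" and "A \<subseteq> {0..t}"
  shows "integrable (dG P \<gamma>) (\<lambda>s. indicator A s * z s)"
proof (rule Bochner_Integration.integrable_bound[OF assms(1)])
  show "AE s in dG P \<gamma>. norm (indicator A s * z s) \<le> norm (indicator {0..t} s * z s)"
    using assms(4) by (intro AE_I2) (auto split: split_indicator)
qed measurable

lemma integrable_f0: "t \<in> TT P \<gamma> \<Longrightarrow> A \<in> sets borel \<Longrightarrow> A \<subseteq> {0..t} \<Longrightarrow>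
    integrable (dG P \<gamma>) (\<lambda>s. indicator A s * f0 s)"
  and integrable_H0: "t \<in> TT P \<gamma> \<Longrightarrow> A \<in> sets borel \<Longrightarrow> A \<subseteq> {0..t} \<Longrightarrow>
    integrable (dG P \<gamma>) (\<lambda>s. indicator A s * H0 s)"
  by (auto intro!: integrable_restrict[OF L1_loc_integrable] f_L1_loc H_L1_loc)

lemma integrable_abs_f0: "t \<in> TT P \<gamma> \<Longrightarrow> A \<in> sets borel \<Longrightarrow> A \<subseteq> {0..t} \<Longrightarrow>
    integrable (dG P \<gamma>) (\<lambda>s. indicator A s * \<bar>f0 s\<bar>)"
  using integrable_abs[OF integrable_f0[of t A]] by (simp add: abs_mult)

lemma set_integral_TT:
  fixes z :: "real \<Rightarrow> real"
  assumes "t \<in> TT P \<gamma>"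
  shows "(LINT s:{0<..t}|dG P \<gamma>. z s) = (LINT s|dG P \<gamma>. indicator {0<..t} s * (indicator (TT P \<gamma>) s * z s))"
  unfolding set_lebesgue_integral_def using TT_down[OF assms]
  by (intro Bochner_Integration.integral_cong) (auto split: split_indicator)

lemma F_eq:
  assumes "t \<in> before_tG P \<gamma>"
  shows "F t = F 0 + (LINT s|dG P \<gamma>. indicator {0<..t} s * f0 s)"
  using derivative assms before_tG_subset_TT set_integral_TT[of t f]
  by (auto simp: has_dG_derivative_def)

lemma F_Gbar_eq:
  assumes "t \<in> before_tG P \<gamma>"
  shows "F t * Gbar P \<gamma> t = F 0 * Gbar P \<gamma> 0 - (LINT s|dG P \<gamma>. indicator {0<..t} s * H0 s)"
  using representation assms before_tG_subset_TT set_integral_TT[of t H]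
  by (force simp: sj_representation_def condition_M_def)

text \<open>The function \<open>t \<mapsto> \<integral>\<^bsub>(0,t]\<^esub> |f| dG\<close> dominates the increments of \<open>F\<close>; all bounds on paths rest on it.\<close>

lemma F_increment_le:
  assumes t: "t \<in> before_tG P \<gamma>" and s: "0 \<le> s" "s \<le> t"
  shows "\<bar>F t - F s\<bar> \<le> (LINT r|dG P \<gamma>. indicator {0<..t} r * \<bar>f0 r\<bar>) - (LINT r|dG P \<gamma>. indicator {0<..s} r * \<bar>f0 r\<bar>)"
proof -
  have tT: "t \<in> TT P \<gamma>" using t before_tG_subset_TT by auto
  have split: "(LINT r|dG P \<gamma>. indicator {0<..t} r * z r) - (LINT r|dG P \<gamma>. indicator {0<..s} r * z r) =
      (LINT r|dG P \<gamma>. indicator {s<..t} r * z r)"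
    if z: "\<And>A. A \<in> sets borel \<Longrightarrow> A \<subseteq> {0..t} \<Longrightarrow> integrable (dG P \<gamma>) (\<lambda>s. indicator A s * z s)"
    for z :: "real \<Rightarrow> real"
  proof -
    have "(LINT r|dG P \<gamma>. indicator {s<..t} r * z r) =
        (LINT r|dG P \<gamma>. indicator {0<..t} r * z r - indicator {0<..s} r * z r)"
      using s by (intro Bochner_Integration.integral_cong) (auto split: split_indicator)
    with s show ?thesis
      by (simp add: Bochner_Integration.integral_diff[OF z z] subset_eq)
  qed
  have "\<bar>F t - F s\<bar> = \<bar>LINT r|dG P \<gamma>. indicator {s<..t} r * f0 r\<bar>"
    using F_eq[OF t] F_eq[OF before_tG_down[OF t s]] split[OF integrable_f0[OF tT]] by simp
  also have "\<dots> \<le> (LINT r|dG P \<gamma>. indicator {s<..t} r * \<bar>f0 r\<bar>)"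
    using integral_abs_bound[of "dG P \<gamma>" "\<lambda>r. indicator {s<..t} r * f0 r"] by (simp add: abs_mult)
  finally show ?thesis using split[OF integrable_abs_f0[OF tT]] by simp
qed

lemma F_bound:
  assumes t: "t \<in> before_tG P \<gamma>" and s: "0 \<le> s" "s \<le> t"
  shows "\<bar>F s\<bar> \<le> \<bar>F 0\<bar> + (LINT r|dG P \<gamma>. indicator {0<..t} r * \<bar>f0 r\<bar>)"
proof -
  have "\<bar>F s - F 0\<bar> \<le> (LINT r|dG P \<gamma>. indicator {0<..s} r * \<bar>f0 r\<bar>)"
    using F_increment_le[OF before_tG_down[OF t s], of 0] s by simp
  also have "\<dots> \<le> (LINT r|dG P \<gamma>. indicator {0<..t} r * \<bar>f0 r\<bar>)"
    using F_increment_le[OF t s] by linarith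
  finally show ?thesis by linarith
qed

text \<open>The left limit of \<open>F\<close> at \<open>s\<close> in \<open>(0,t_G)\<close>. The integral form shows at once that it is a Borel function
of \<open>s\<close>.\<close>

definition F_left :: "real \<Rightarrow> real" where
  "F_left s = F 0 + (LINT r|dG P \<gamma>. (if 0 < r \<and> r < s then f0 r else 0))"

lemma F_left_measurable [measurable]: "F_left \<in> borel_measurable borel"
proof -
  have "(\<lambda>s. LINT r|dG P \<gamma>. (if 0 < r \<and> r < s then f0 r else 0)) \<in> borel_measurable borel"
    by measurable
  then show ?thesis unfolding F_left_def[abs_def] by simp
qed

lemma F_left_bound:
  assumes t: "t \<in> before_tG P \<gamma>" and s: "s \<le> t"
  shows "\<bar>F_left s\<bar> \<le> \<bar>F 0\<bar> + (LINT r|dG P \<gamma>. indicator {0<..t} r * \<bar>f0 r\<bar>)"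
proof -
  have tT: "t \<in> TT P \<gamma>" using t before_tG_subset_TT by auto
  have "\<bar>LINT r|dG P \<gamma>. (if 0 < r \<and> r < s then f0 r else 0)\<bar> \<le>
      (LINT r|dG P \<gamma>. \<bar>if 0 < r \<and> r < s then f0 r else 0\<bar>)"
    by (rule integral_abs_bound)
  also have "\<dots> \<le> (LINT r|dG P \<gamma>. indicator {0<..t} r * \<bar>f0 r\<bar>)"
  proof (rule integral_mono')
    show "integrable (dG P \<gamma>) (\<lambda>r. indicator {0<..t} r * \<bar>f0 r\<bar>)"
      by (rule integrable_abs_f0[OF tT]) auto
  qed (use s in \<open>auto split: split_indicator\<close>)
  finally show ?thesis unfolding F_left_def by linarith
qed

lemma F_left_tendsto:
  assumes s: "s \<in> before_tG P \<gamma>" "0 < s"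
  shows "(\<lambda>n. F (s - s / real (Suc n))) \<longlonglongrightarrow> F_left s"
proof -
  define S where "S n = s - s / real (Suc n)" for n
  have sT: "s \<in> TT P \<gamma>" using s before_tG_subset_TT by auto
  have S: "0 \<le> S n" "S n < s" for n
    using s by (auto simp: S_def field_simps)
  have "S \<longlonglongrightarrow> s - 0"
    unfolding S_def by (intro tendsto_intros lim_const_over_n[THEN LIMSEQ_Suc])
  then have Slim: "S \<longlonglongrightarrow> s" by simp
  have "(\<lambda>n. LINT r|dG P \<gamma>. indicator {0<..S n} r * f0 r) \<longlonglongrightarrow>
      (LINT r|dG P \<gamma>. (if 0 < r \<and> r < s then f0 r else 0))"
  proof (rule integral_dominated_convergence[where w="\<lambda>r. indicator {0<..s} r * \<bar>f0 r\<bar>"])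
    show "integrable (dG P \<gamma>) (\<lambda>r. indicator {0<..s} r * \<bar>f0 r\<bar>)"
      by (rule integrable_abs_f0[OF sT]) auto
    show "AE r in dG P \<gamma>. (\<lambda>n. indicator {0<..S n} r * f0 r) \<longlonglongrightarrow> (if 0 < r \<and> r < s then f0 r else 0)"
    proof (rule AE_I2)
      fix r
      show "(\<lambda>n. indicator {0<..S n} r * f0 r) \<longlonglongrightarrow> (if 0 < r \<and> r < s then f0 r else 0)"
      proof (cases "r < s")
        case True
        then have "\<forall>\<^sub>F n in sequentially. r < S n"
          using Slim by (simp add: order_tendsto_iff)
        with True show ?thesis
          by (intro tendsto_eventually) (elim eventually_mono, auto split: split_indicator)
      next
        case False
        then have "indicator {0<..S n} r = (0::real)" for n
          using S(2)[of n] by (auto split: split_indicator)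
        with False show ?thesis by simp
      qed
    qed
    show "AE r in dG P \<gamma>. norm (indicator {0<..S n} r * f0 r) \<le> indicator {0<..s} r * \<bar>f0 r\<bar>" for n
      using S(2)[of n] by (auto split: split_indicator)
  qed measurable
  then have "(\<lambda>n. F 0 + (LINT r|dG P \<gamma>. indicator {0<..S n} r * f0 r)) \<longlonglongrightarrow> F_left s"
    unfolding F_left_def by (intro tendsto_intros)
  moreover have "F (S n) = F 0 + (LINT r|dG P \<gamma>. indicator {0<..S n} r * f0 r)" for n
    using S[of n] s by (intro F_eq before_tG_down[OF s(1)]) auto
  ultimately have "(\<lambda>n. F (S n)) \<longlonglongrightarrow> F_left s" by simp
  then show ?thesis by (simp add: S_def)
qed

text \<open>Integration by parts. The double integral of \<open>f r\<close> over \<open>0 < r < s \<le> t\<close> is evaluated in the order that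
integrates \<open>s\<close> first, where the inner mass is \<open>dG (r,t] = Gbar r - Gbar t\<close>.\<close>

lemma integral_F_left:
  assumes t: "t \<in> before_tG P \<gamma>"
  shows "(LINT s|dG P \<gamma>. indicator {0<..t} s * F_left s) =
    F 0 * Gbar P \<gamma> 0 - F t * Gbar P \<gamma> t + (LINT r|dG P \<gamma>. indicator {0<..t} r * (Gbar P \<gamma> r * f0 r))"
    and integrable_F_left: "integrable (dG P \<gamma>) (\<lambda>s. indicator {0<..t} s * F_left s)"
    and integrable_Gbar_f0: "integrable (dG P \<gamma>) (\<lambda>s. indicator {0<..t} s * (Gbar P \<gamma> s * f0 s))"
proof -
  have tT: "t \<in> TT P \<gamma>" using t before_tG_subset_TT by auto
  have t0: "0 \<le> t" using t by (simp add: before_tG_def)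
  have If: "integrable (dG P \<gamma>) (\<lambda>s. indicator {0<..t} s * f0 s)"
    by (rule integrable_f0[OF tT]) auto
  let ?B = "\<bar>F 0\<bar> + (LINT r|dG P \<gamma>. indicator {0<..t} r * \<bar>f0 r\<bar>)"
  have "AE s in dG P \<gamma>. norm (indicator {0<..t} s * F_left s) \<le> ?B"
  proof (rule AE_I2)
    fix s
    have "0 \<le> ?B" by (intro add_nonneg_nonneg integral_nonneg) auto
    with F_left_bound[OF t, of s] show "norm (indicator {0<..t} s * F_left s) \<le> ?B"
      by (auto split: split_indicator)
  qed
  then show IF: "integrable (dG P \<gamma>) (\<lambda>s. indicator {0<..t} s * F_left s)"
    by (intro dG.integrable_const_bound[of _ ?B]) auto
  show IG: "integrable (dG P \<gamma>) (\<lambda>s. indicator {0<..t} s * (Gbar P \<gamma> s * f0 s))"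
    using Gbar_nonneg Gbar_le_1
    by (intro Bochner_Integration.integrable_bound[OF If])
      (auto simp: abs_mult split: split_indicator intro!: mult_left_le_one_le)
  interpret pair_sigma_finite "dG P \<gamma>" "dG P \<gamma>" ..
  let ?k = "\<lambda>s r. if 0 < r \<and> r < s \<and> s \<le> t then f0 r else 0"
  have km [measurable]: "case_prod ?k \<in> borel_measurable (dG P \<gamma> \<Otimes>\<^sub>M dG P \<gamma>)"
    by measurable
  have kint: "integrable (dG P \<gamma> \<Otimes>\<^sub>M dG P \<gamma>) (case_prod ?k)"
  proof (rule Fubini_integrable)
    let ?C = "LINT r|dG P \<gamma>. indicator {0<..t} r * \<bar>f0 r\<bar>"
    have k_le: "\<bar>?k s r\<bar> \<le> indicator {0<..t} r * \<bar>f0 r\<bar>" for s r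
      by (auto split: split_indicator)
    have I: "integrable (dG P \<gamma>) (\<lambda>r. indicator {0<..t} r * \<bar>f0 r\<bar>)"
      by (rule integrable_abs_f0[OF tT]) auto
    have "(LINT r|dG P \<gamma>. \<bar>?k s r\<bar>) \<le> ?C" for s
      by (rule integral_mono'[OF I k_le]) auto
    then show "integrable (dG P \<gamma>) (\<lambda>s. LINT r|dG P \<gamma>. norm (case_prod ?k (s, r)))"
      by (intro dG.integrable_const_bound[of _ ?C]) (auto simp: integral_nonneg_AE)
    show "AE s in dG P \<gamma>. integrable (dG P \<gamma>) (\<lambda>r. case_prod ?k (s, r))"
      using k_le by (intro AE_I2 Bochner_Integration.integrable_bound[OF I]) auto
  qed (rule km)
  have "(LINT s|dG P \<gamma>. indicator {0<..t} s * F_left s) =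
      (LINT s|dG P \<gamma>. F 0 * indicator {0<..t} s + (LINT r|dG P \<gamma>. ?k s r))"
  proof (intro Bochner_Integration.integral_cong refl)
    fix s
    have "(LINT r|dG P \<gamma>. ?k s r) = 0" if "\<not> (0 < s \<and> s \<le> t)"
      using that by (intro integral_eq_zero_AE AE_I2) auto
    then show "indicator {0<..t} s * F_left s = F 0 * indicator {0<..t} s + (LINT r|dG P \<gamma>. ?k s r)"
      by (cases "0 < s \<and> s \<le> t") (auto simp: F_left_def)
  qed
  also have "\<dots> = F 0 * measure (dG P \<gamma>) {0<..t} + (LINT s|dG P \<gamma>. (LINT r|dG P \<gamma>. ?k s r))"
  proof (subst Bochner_Integration.integral_add)
    show "integrable (dG P \<gamma>) (\<lambda>s. F 0 * indicator {0<..t} s)"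
      by (intro integrable_mult_right dG.integrable_const_bound[of _ 1]) auto
    show "integrable (dG P \<gamma>) (\<lambda>s. LINT r|dG P \<gamma>. ?k s r)"
      using integrable_fst[OF kint] by simp
  qed simp
  also have "(LINT s|dG P \<gamma>. (LINT r|dG P \<gamma>. ?k s r)) = (LINT r|dG P \<gamma>. (LINT s|dG P \<gamma>. ?k s r))"
    by (rule Fubini_integral[symmetric]) (rule kint)
  also have "(LINT r|dG P \<gamma>. (LINT s|dG P \<gamma>. ?k s r)) =
      (LINT r|dG P \<gamma>. indicator {0<..t} r * (Gbar P \<gamma> r * f0 r) - Gbar P \<gamma> t * (indicator {0<..t} r * f0 r))"
  proof (intro Bochner_Integration.integral_cong refl)
    fix r
    have "(LINT s|dG P \<gamma>. ?k s r) = (LINT s|dG P \<gamma>. (indicator {0<..t} r * f0 r) * indicator {r<..t} s)"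
      by (intro Bochner_Integration.integral_cong) (auto split: split_indicator)
    also have "\<dots> = indicator {0<..t} r * f0 r * measure (dG P \<gamma>) {r<..t}"
      by simp
    also have "\<dots> = indicator {0<..t} r * (Gbar P \<gamma> r * f0 r) - Gbar P \<gamma> t * (indicator {0<..t} r * f0 r)"
      by (cases "r \<in> {0<..t}") (auto simp: measure_dG_Ioc Gbar_def algebra_simps)
    finally show "(LINT s|dG P \<gamma>. ?k s r) =
      indicator {0<..t} r * (Gbar P \<gamma> r * f0 r) - Gbar P \<gamma> t * (indicator {0<..t} r * f0 r)" .
  qed
  also have "\<dots> = (LINT r|dG P \<gamma>. indicator {0<..t} r * (Gbar P \<gamma> r * f0 r)) - Gbar P \<gamma> t * (F t - F 0)"
    using If IG F_eq[OF t] by (subst Bochner_Integration.integral_diff) auto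
  finally show "(LINT s|dG P \<gamma>. indicator {0<..t} s * F_left s) =
    F 0 * Gbar P \<gamma> 0 - F t * Gbar P \<gamma> t + (LINT r|dG P \<gamma>. indicator {0<..t} r * (Gbar P \<gamma> r * f0 r))"
    using measure_dG_Ioc[OF order_refl t0] by (simp add: Gbar_def algebra_simps)
qed

text \<open>Formally \<open>d(F Gbar) = Gbar dF - F_left dG\<close>, and Condition M says that this is \<open>- H dG\<close>. Equality of the
integrals over all intervals \<open>(0,t]\<close> identifies the densities.\<close>

lemma Gbar_f_eq: "AE s in dG P \<gamma>. 0 < s \<and> s \<in> before_tG P \<gamma> \<longrightarrow> Gbar P \<gamma> s * f s = F_left s - H s"
proof -
  let ?k = "\<lambda>s. Gbar P \<gamma> s * f0 s - F_left s + H0 s"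
  have *: "AE s in dG P \<gamma>. indicator {0<..T} s * ?k s = 0" if T: "T \<in> before_tG P \<gamma>" for T
  proof (rule dG.AE_eq_0_if_integral_Iic_0)
    have int: "integrable (dG P \<gamma>) (\<lambda>s. indicator {0<..t} s * ?k s)"
      and zero: "(LINT s|dG P \<gamma>. indicator {0<..t} s * ?k s) = 0" if t: "t \<in> before_tG P \<gamma>" for t
    proof -
      have tT: "t \<in> TT P \<gamma>" using t before_tG_subset_TT by auto
      have IH: "integrable (dG P \<gamma>) (\<lambda>s. indicator {0<..t} s * H0 s)"
        by (rule integrable_H0[OF tT]) auto
      note I = integrable_F_left[OF t] integrable_Gbar_f0[OF t] IH
      have eq: "indicator {0<..t} s * ?k s = indicator {0<..t} s * (Gbar P \<gamma> s * f0 s) -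
          indicator {0<..t} s * F_left s + indicator {0<..t} s * H0 s" for s
        by (simp add: algebra_simps)
      show "integrable (dG P \<gamma>) (\<lambda>s. indicator {0<..t} s * ?k s)"
        unfolding eq by (intro Bochner_Integration.integrable_add Bochner_Integration.integrable_diff I)
      show "(LINT s|dG P \<gamma>. indicator {0<..t} s * ?k s) = 0"
        unfolding eq
        apply (subst Bochner_Integration.integral_add)
          apply (intro Bochner_Integration.integrable_diff I)
         apply (rule I)
        apply (subst Bochner_Integration.integral_diff)
          apply (rule I)+
        using F_Gbar_eq[OF t] integral_F_left[OF t] by simp
    qed
    show "integrable (dG P \<gamma>) (\<lambda>s. indicator {0<..T} s * ?k s)"
      by (rule int[OF T])
    fix t
    show "(LINT s|dG P \<gamma>. indicator {..t} s * (indicator {0<..T} s * ?k s)) = 0"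
    proof (cases "0 \<le> t")
      case True
      have "min t T \<in> before_tG P \<gamma>"
        using T True by (intro before_tG_down[OF T]) (auto simp: before_tG_def)
      from zero[OF this] show ?thesis
        by (subst Bochner_Integration.integral_cong[OF refl]) (auto split: split_indicator)
    next
      case False
      then show ?thesis
        by (intro integral_eq_zero_AE AE_I2) (auto split: split_indicator)
    qed
  qed
  obtain S where S: "\<And>n. S n \<in> before_tG P \<gamma>" "(\<lambda>n. ennreal (S n)) \<longlonglongrightarrow> t_G P \<gamma>"
    by (rule ex_seq_to_tG) auto
  have "AE s in dG P \<gamma>. \<forall>n. indicator {0<..S n} s * ?k s = 0"
    unfolding AE_all_countable using *[OF S(1)] by blast
  then show ?thesis
  proof eventually_elim
    case (elim s)
    show ?case
    proof
      assume s: "0 < s \<and> s \<in> before_tG P \<gamma>"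
      then have "ennreal s < t_G P \<gamma>" by (simp add: before_tG_def)
      then have "\<forall>\<^sub>F n in sequentially. ennreal s < ennreal (S n)"
        using S(2) by (simp add: order_tendsto_iff)
      then obtain n where "ennreal s < ennreal (S n)"
        by (auto simp: eventually_sequentially)
      then have "s \<le> S n" using s S(1)[of n] by (auto simp: ennreal_less_iff before_tG_def)
      with elim[rule_format, of n] s before_tG_subset_TT
      show "Gbar P \<gamma> s * f s = F_left s - H s" by auto
    qed
  qed
qed

end

section \<open>The jump value and the paths\<close>

text \<open>The increments of \<open>x\<close> along a partition are dominated by those of \<open>w\<close>, which telescope.\<close>

lemma variation_le:
  fixes x w :: "real \<Rightarrow> real"
  assumes w: "\<And>s t. 0 \<le> s \<Longrightarrow> s \<le> t \<Longrightarrow> \<bar>x t - x s\<bar> \<le> w t - w s"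
    and w0: "\<And>t. 0 \<le> t \<Longrightarrow> 0 \<le> w t" and C: "\<And>t. 0 \<le> t \<Longrightarrow> w t \<le> C"
  shows "variation x \<le> ennreal \<bar>x 0\<bar> + ennreal C"
  unfolding variation_def
proof (intro add_left_mono SUP_least)
  fix \<tau> :: "nat \<Rightarrow> real" and n
  assume "\<tau> \<in> {\<tau>. mono \<tau> \<and> 0 \<le> \<tau> 0}"
  then have \<tau>: "\<tau> i \<le> \<tau> (Suc i)" "0 \<le> \<tau> i" for i
    by (auto simp: mono_def intro: order_trans[of 0 "\<tau> 0"])
  have "(\<Sum>i<n. ennreal \<bar>x (\<tau> (Suc i)) - x (\<tau> i)\<bar>) \<le> (\<Sum>i<n. ennreal (w (\<tau> (Suc i)) - w (\<tau> i)))"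
    using \<tau> by (intro sum_mono ennreal_leI w)
  also have "\<dots> = ennreal (\<Sum>i<n. w (\<tau> (Suc i)) - w (\<tau> i))"
    using order_trans[OF abs_ge_zero w[OF \<tau>(2,1)]] by (intro sum_ennreal) simp
  also have "\<dots> = ennreal (w (\<tau> n) - w (\<tau> 0))"
    by (subst sum_lessThan_telescope[of "\<lambda>i. w (\<tau> i)"]) simp
  also have "\<dots> \<le> ennreal C"
    using w0[OF \<tau>(2), of 0] C[OF \<tau>(2), of n] by (intro ennreal_leI) simp
  finally show "(\<Sum>i<n. ennreal \<bar>x (\<tau> (Suc i)) - x (\<tau> i)\<bar>) \<le> ennreal C" .
qed

text \<open>Use the partition \<open>0, t, t, \<dots>\<close>.\<close>

lemma abs_le_variation:
  assumes "0 \<le> t"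
  shows "ennreal \<bar>x t\<bar> \<le> variation x"
proof -
  define \<tau> where "\<tau> i = (if i = 0 then 0 else t)" for i :: nat
  have \<tau>: "\<tau> \<in> {\<tau>. mono \<tau> \<and> 0 \<le> \<tau> 0}"
    using assms by (auto simp: mono_def \<tau>_def)
  have "ennreal \<bar>x t - x 0\<bar> = (\<Sum>i<1. ennreal \<bar>x (\<tau> (Suc i)) - x (\<tau> i)\<bar>)"
    by (simp add: \<tau>_def)
  also have "\<dots> \<le> (SUP n. \<Sum>i<n. ennreal \<bar>x (\<tau> (Suc i)) - x (\<tau> i)\<bar>)"
    by (rule SUP_upper) simp
  also have "\<dots> \<le> (SUP \<tau>\<in>{\<tau> :: nat \<Rightarrow> real. mono \<tau> \<and> 0 \<le> \<tau> 0}. SUP n. \<Sum>i<n. ennreal \<bar>x (\<tau> (Suc i)) - x (\<tau> i)\<bar>)"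
    by (rule SUP_upper[OF \<tau>])
  finally have "ennreal \<bar>x 0\<bar> + ennreal \<bar>x t - x 0\<bar> \<le> variation x"
    unfolding variation_def by (rule add_left_mono)
  moreover have "ennreal \<bar>x t\<bar> \<le> ennreal \<bar>x 0\<bar> + ennreal \<bar>x t - x 0\<bar>"
    by (simp add: ennreal_plus[symmetric] del: ennreal_plus)
  ultimately show ?thesis by (rule order_trans[rotated])
qed

context sj_process
begin

lemma L'_measurable [measurable]: "L' \<in> borel_measurable P"
  using representation by (simp add: sj_representation_def)

lemma H_at_eq: "H_at P \<gamma> H \<omega> = H0 (enn2real (\<gamma> \<omega>)) * indicator {\<omega>. \<gamma> \<omega> < \<infinity>} \<omega>"
  by (auto simp: H_at_def)

lemma H_at_measurable [measurable]: "H_at P \<gamma> H \<in> borel_measurable P"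
proof -
  have "(\<lambda>\<omega>. H0 (enn2real (\<gamma> \<omega>)) * indicator {\<omega>. \<gamma> \<omega> < \<infinity>} \<omega>) \<in> borel_measurable P"
    by measurable
  then show ?thesis by (simp only: H_at_eq[abs_def])
qed

lemma L_measurable [measurable]: "L \<in> borel_measurable P"
  unfolding L_def[abs_def] by measurable

lemma M_measurable: "0 \<le> t \<Longrightarrow> M t \<in> borel_measurable (\<FF> (ennreal t))"
  using adapted_M by (simp add: adapted_def)

lemma integral_L'_eq_0:
  fixes k :: "ennreal \<Rightarrow> real"
  assumes "k \<in> borel_measurable borel"
  shows "(LINT \<omega>|P. k (\<gamma> \<omega>) * L' \<omega>) = 0"
  using representation assms by (intro integral_gen_cond_exp_0) (auto simp: sj_representation_def)

lemma integrable_L'_le: "t \<in> TT P \<gamma> \<Longrightarrow> integrable P (\<lambda>\<omega>. L' \<omega> * indicator {\<omega>. \<gamma> \<omega> \<le> ennreal t} \<omega>)"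
proof (rule integrableI_bounded)
  assume t: "t \<in> TT P \<gamma>"
  have "(\<integral>\<^sup>+\<omega>. ennreal (norm (L' \<omega> * indicator {\<omega>. \<gamma> \<omega> \<le> ennreal t} \<omega>)) \<partial>P) =
      (\<integral>\<^sup>+\<omega>. ennreal \<bar>L' \<omega>\<bar> * indicator {\<omega>. \<gamma> \<omega> \<le> ennreal t} \<omega> \<partial>P)"
    by (intro nn_integral_cong) (auto split: split_indicator)
  also have "\<dots> < \<infinity>" using representation t by (simp add: sj_representation_def)
  finally show "(\<integral>\<^sup>+\<omega>. ennreal (norm (L' \<omega> * indicator {\<omega>. \<gamma> \<omega> \<le> ennreal t} \<omega>)) \<partial>P) < \<infinity>" .
qed measurable

lemma
  fixes A :: "real set"
  assumes t: "t \<in> TT P \<gamma>" and [measurable]: "A \<in> sets borel" and A: "A \<subseteq> {0..t}"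
  shows integrable_H_at: "integrable P (\<lambda>\<omega>. H_at P \<gamma> H \<omega> * indicator A (enn2real (\<gamma> \<omega>)))"
    and integral_H_at: "(LINT \<omega>|P. H_at P \<gamma> H \<omega> * indicator A (enn2real (\<gamma> \<omega>))) =
      (LINT s|dG P \<gamma>. indicator A s * H0 s)"
proof -
  have eq: "(\<lambda>\<omega>. H_at P \<gamma> H \<omega> * indicator A (enn2real (\<gamma> \<omega>))) =
      (\<lambda>\<omega>. (indicator A (enn2real (\<gamma> \<omega>)) * H0 (enn2real (\<gamma> \<omega>))) * indicator {\<omega>. \<gamma> \<omega> < \<infinity>} \<omega>)"
    by (simp add: fun_eq_iff H_at_eq)
  have "(\<lambda>s. indicator A s * H0 s) \<in> borel_measurable borel" by measurable
  from integral_dG[OF this] integrable_dG_iff[OF this] integrable_H0[OF t _ A]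
  show "integrable P (\<lambda>\<omega>. H_at P \<gamma> H \<omega> * indicator A (enn2real (\<gamma> \<omega>)))"
    "(LINT \<omega>|P. H_at P \<gamma> H \<omega> * indicator A (enn2real (\<gamma> \<omega>))) =
      (LINT s|dG P \<gamma>. indicator A s * H0 s)"
    unfolding eq by auto
qed

lemma H_at_le_eq:
  assumes "0 \<le> t"
  shows "H_at P \<gamma> H \<omega> * indicator {\<omega>. \<gamma> \<omega> \<le> ennreal t} \<omega> = H_at P \<gamma> H \<omega> * indicator {0..t} (enn2real (\<gamma> \<omega>))"
  using assms by (cases "\<gamma> \<omega>") (auto simp: H_at_def top_unique split: split_indicator)

lemma integrable_H_at_le:
  "t \<in> TT P \<gamma> \<Longrightarrow> integrable P (\<lambda>\<omega>. H_at P \<gamma> H \<omega> * indicator {\<omega>. \<gamma> \<omega> \<le> ennreal t} \<omega>)"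
  using integrable_H_at[of t "{0..t}"] by (subst H_at_le_eq) (auto simp: TT_def)

lemma integrable_L_le:
  "t \<in> TT P \<gamma> \<Longrightarrow> integrable P (\<lambda>\<omega>. L \<omega> * indicator {\<omega>. \<gamma> \<omega> \<le> ennreal t} \<omega>)"
  using Bochner_Integration.integrable_add[OF integrable_H_at_le integrable_L'_le, of t t]
  by (simp add: L_def distrib_right)

text \<open>The part \<open>L'\<close> has mean \<open>0\<close> on events determined by \<open>\<gamma>\<close>; the part \<open>H(\<gamma>)\<close> contributes the integral of \<open>H\<close>
over \<open>(s,t]\<close>, which Condition M expresses by \<open>F\<close>.\<close>

lemma expectation_L:
  assumes t: "t \<in> before_tG P \<gamma>" and s: "0 \<le> s" "s \<le> t"
  shows "(LINT \<omega>|P. L \<omega> * indicator {\<omega>. ennreal s < \<gamma> \<omega> \<and> \<gamma> \<omega> \<le> ennreal t} \<omega>) =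
    F s * Gbar P \<gamma> s - F t * Gbar P \<gamma> t"
proof -
  have tT: "t \<in> TT P \<gamma>" using t before_tG_subset_TT by auto
  have [measurable]: "(indicator {x. ennreal s < x \<and> x \<le> ennreal t} :: ennreal \<Rightarrow> real) \<in> borel_measurable borel"
    by measurable
  have "integrable P (\<lambda>\<omega>. L' \<omega> * indicator {\<omega>. ennreal s < \<gamma> \<omega> \<and> \<gamma> \<omega> \<le> ennreal t} \<omega>)"
    by (rule Bochner_Integration.integrable_bound[OF integrable_L'_le[OF tT]])
      (measurable, auto intro!: AE_I2 split: split_indicator)
  moreover have "(LINT \<omega>|P. L' \<omega> * indicator {\<omega>. ennreal s < \<gamma> \<omega> \<and> \<gamma> \<omega> \<le> ennreal t} \<omega>) = 0"
    using integral_L'_eq_0[of "indicator {x. ennreal s < x \<and> x \<le> ennreal t}"]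
    by (simp add: indicator_def mult.commute)
  moreover have eq: "H_at P \<gamma> H \<omega> * indicator {\<omega>. ennreal s < \<gamma> \<omega> \<and> \<gamma> \<omega> \<le> ennreal t} \<omega> =
      H_at P \<gamma> H \<omega> * indicator {s<..t} (enn2real (\<gamma> \<omega>))" for \<omega>
    using s by (cases "\<gamma> \<omega>") (auto simp: H_at_def top_unique ennreal_less_iff split: split_indicator)
  moreover note integrable_H_at[OF tT, of "{s<..t}"] integral_H_at[OF tT, of "{s<..t}"]
  ultimately have "(LINT \<omega>|P. L \<omega> * indicator {\<omega>. ennreal s < \<gamma> \<omega> \<and> \<gamma> \<omega> \<le> ennreal t} \<omega>) =
      (LINT r|dG P \<gamma>. indicator {s<..t} r * H0 r)"
    using s unfolding L_def distrib_right eq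
    by (subst Bochner_Integration.integral_add) (auto simp: subset_eq)
  also have "\<dots> = (LINT r|dG P \<gamma>. indicator {0<..t} r * H0 r - indicator {0<..s} r * H0 r)"
    using s by (intro Bochner_Integration.integral_cong) (auto split: split_indicator)
  also have "\<dots> = (LINT r|dG P \<gamma>. indicator {0<..t} r * H0 r) - (LINT r|dG P \<gamma>. indicator {0<..s} r * H0 r)"
    using s by (intro Bochner_Integration.integral_diff integrable_H0[OF tT]) auto
  finally show ?thesis
    using F_Gbar_eq[OF t] F_Gbar_eq[OF before_tG_down[OF t s]] by simp
qed

lemma nn_integral_H:
  assumes A: "case_A P \<gamma>"
  shows "(\<integral>\<^sup>+s\<in>before_tG P \<gamma>. ennreal \<bar>H s\<bar> \<partial>dG P \<gamma>) = (\<integral>\<^sup>+\<omega>. ennreal \<bar>H_at P \<gamma> H \<omega>\<bar> \<partial>P)"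
proof -
  have "(\<integral>\<^sup>+s\<in>before_tG P \<gamma>. ennreal \<bar>H s\<bar> \<partial>dG P \<gamma>) = (\<integral>\<^sup>+s. ennreal \<bar>H0 s\<bar> \<partial>dG P \<gamma>)"
    unfolding TT_eq_before_tG[OF A] by (intro nn_integral_cong) (auto split: split_indicator)
  also have "\<dots> = (\<integral>\<^sup>+\<omega>. ennreal \<bar>H0 (enn2real (\<gamma> \<omega>))\<bar> * indicator {\<omega>. \<gamma> \<omega> < \<infinity>} \<omega> \<partial>P)"
    by (rule nn_integral_dG) measurable
  also have "\<dots> = (\<integral>\<^sup>+\<omega>. ennreal \<bar>H_at P \<gamma> H \<omega>\<bar> \<partial>P)"
    by (intro nn_integral_cong) (auto simp: H_at_eq split: split_indicator)
  finally show ?thesis .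
qed

text \<open>The sign of \<open>H(\<gamma>)\<close> is a function of \<open>\<gamma>\<close>. Tested against it, \<open>L\<close> gives \<open>|H(\<gamma>)|\<close>, because \<open>L'\<close>
contributes \<open>0\<close>.\<close>

lemma nn_integral_H_at_le:
  assumes t: "t \<in> TT P \<gamma>"
  shows "(\<integral>\<^sup>+\<omega>. ennreal \<bar>H_at P \<gamma> H \<omega>\<bar> * indicator {\<omega>. \<gamma> \<omega> \<le> ennreal t} \<omega> \<partial>P) \<le>
    (\<integral>\<^sup>+\<omega>. ennreal \<bar>L \<omega>\<bar> * indicator {\<omega>. \<gamma> \<omega> < \<infinity>} \<omega> \<partial>P)"
proof -
  let ?i = "\<lambda>\<omega>. indicator {\<omega>. \<gamma> \<omega> \<le> ennreal t} \<omega> :: real"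
  let ?s = "\<lambda>\<omega>. sgn (H0 (enn2real (\<gamma> \<omega>)))"
  have im [measurable]: "?i \<in> borel_measurable P" by measurable
  have H: "\<bar>H_at P \<gamma> H \<omega>\<bar> * ?i \<omega> = ?s \<omega> * (H_at P \<gamma> H \<omega> * ?i \<omega>)" for \<omega>
    by (cases "\<gamma> \<omega>") (auto simp: H_at_eq abs_sgn algebra_simps top_unique split: split_indicator)
  have I: "integrable P (\<lambda>\<omega>. ?s \<omega> * (z \<omega> * ?i \<omega>))" if z: "integrable P (\<lambda>\<omega>. z \<omega> * ?i \<omega>)" for z
  proof (rule Bochner_Integration.integrable_bound[OF z])
    show "(\<lambda>\<omega>. ?s \<omega> * (z \<omega> * ?i \<omega>)) \<in> borel_measurable P"
      by (rule borel_measurable_times[OF _ borel_measurable_integrable[OF z]]) measurable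
    show "AE \<omega> in P. norm (?s \<omega> * (z \<omega> * ?i \<omega>)) \<le> norm (z \<omega> * ?i \<omega>)"
      by (rule AE_I2) (simp add: abs_mult sgn_if del: mult_cancel_right2)
  qed
  note IH = I[OF integrable_H_at_le[OF t]] and IL = I[OF integrable_L_le[OF t]] and IL' = I[OF integrable_L'_le[OF t]]
  have "(\<lambda>x. sgn (H0 (enn2real x)) * indicator {..ennreal t} x) \<in> borel_measurable borel"
    by measurable
  from integral_L'_eq_0[OF this] have "(LINT \<omega>|P. ?s \<omega> * (L' \<omega> * ?i \<omega>)) = 0"
    by (simp add: mult_ac indicator_def)
  then have eq: "(LINT \<omega>|P. \<bar>H_at P \<gamma> H \<omega>\<bar> * ?i \<omega>) = (LINT \<omega>|P. ?s \<omega> * (L \<omega> * ?i \<omega>))"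
    using IH IL' unfolding H L_def by (simp add: distrib_right distrib_left)
  have "(\<integral>\<^sup>+\<omega>. ennreal \<bar>H_at P \<gamma> H \<omega>\<bar> * indicator {\<omega>. \<gamma> \<omega> \<le> ennreal t} \<omega> \<partial>P) =
      (\<integral>\<^sup>+\<omega>. ennreal (\<bar>H_at P \<gamma> H \<omega>\<bar> * ?i \<omega>) \<partial>P)"
    by (intro nn_integral_cong) (auto split: split_indicator)
  also have "\<dots> = ennreal (LINT \<omega>|P. \<bar>H_at P \<gamma> H \<omega>\<bar> * ?i \<omega>)"
    using IH unfolding H[symmetric] by (intro nn_integral_eq_integral) auto
  also have "\<dots> \<le> ennreal (LINT \<omega>|P. \<bar>?s \<omega> * (L \<omega> * ?i \<omega>)\<bar>)"
    unfolding eq by (intro ennreal_leI order_trans[OF abs_ge_self integral_abs_bound])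
  also have "\<dots> = (\<integral>\<^sup>+\<omega>. ennreal \<bar>?s \<omega> * (L \<omega> * ?i \<omega>)\<bar> \<partial>P)"
    using integrable_abs[OF IL] by (intro nn_integral_eq_integral[symmetric]) auto
  also have "\<dots> \<le> (\<integral>\<^sup>+\<omega>. ennreal \<bar>L \<omega>\<bar> * indicator {\<omega>. \<gamma> \<omega> < \<infinity>} \<omega> \<partial>P)"
    by (intro nn_integral_mono)
      (auto simp: abs_mult sgn_if intro: le_less_trans[OF _ ennreal_less_top] split: split_indicator)
  finally show ?thesis .
qed

text \<open>No cancellation between \<open>H(\<gamma>)\<close> and \<open>L'\<close> can make \<open>L\<close> integrable: \<open>H(\<gamma>)\<close> is dominated in mean by \<open>L\<close>, and
then so is \<open>L' = L - H(\<gamma>)\<close>.\<close>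

lemma L_finite_iff:
  assumes A: "case_A P \<gamma>"
  shows "(\<integral>\<^sup>+\<omega>. ennreal \<bar>L \<omega>\<bar> * indicator {\<omega>. \<gamma> \<omega> < \<infinity>} \<omega> \<partial>P) < \<infinity> \<longleftrightarrow>
    (\<integral>\<^sup>+\<omega>. ennreal \<bar>L' \<omega>\<bar> * indicator {\<omega>. \<gamma> \<omega> < \<infinity>} \<omega> \<partial>P) < \<infinity> \<and>
    (\<integral>\<^sup>+s\<in>before_tG P \<gamma>. ennreal \<bar>H s\<bar> \<partial>dG P \<gamma>) < \<infinity>" (is "?L < \<infinity> \<longleftrightarrow> ?L' < \<infinity> \<and> ?H < \<infinity>")
proof -
  have [measurable]: "(indicator {\<omega>. \<gamma> \<omega> < \<infinity>} :: 'a \<Rightarrow> ennreal) \<in> borel_measurable P"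
    by measurable
  have Hat: "?H = (\<integral>\<^sup>+\<omega>. ennreal \<bar>H_at P \<gamma> H \<omega>\<bar> * indicator {\<omega>. \<gamma> \<omega> < \<infinity>} \<omega> \<partial>P)"
    unfolding nn_integral_H[OF A] by (intro nn_integral_cong) (auto simp: H_at_def split: split_indicator)
  have add: "(\<integral>\<^sup>+\<omega>. ennreal \<bar>X \<omega> + Y \<omega>\<bar> * indicator {\<omega>. \<gamma> \<omega> < \<infinity>} \<omega> \<partial>P) \<le>
    (\<integral>\<^sup>+\<omega>. ennreal \<bar>X \<omega>\<bar> * indicator {\<omega>. \<gamma> \<omega> < \<infinity>} \<omega> \<partial>P) +
    (\<integral>\<^sup>+\<omega>. ennreal \<bar>Y \<omega>\<bar> * indicator {\<omega>. \<gamma> \<omega> < \<infinity>} \<omega> \<partial>P)"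
    if [measurable]: "X \<in> borel_measurable P" "Y \<in> borel_measurable P" for X Y :: "'a \<Rightarrow> real"
  proof -
    have "(\<integral>\<^sup>+\<omega>. ennreal \<bar>X \<omega> + Y \<omega>\<bar> * indicator {\<omega>. \<gamma> \<omega> < \<infinity>} \<omega> \<partial>P) \<le>
      (\<integral>\<^sup>+\<omega>. ennreal \<bar>X \<omega>\<bar> * indicator {\<omega>. \<gamma> \<omega> < \<infinity>} \<omega> + ennreal \<bar>Y \<omega>\<bar> * indicator {\<omega>. \<gamma> \<omega> < \<infinity>} \<omega> \<partial>P)"
      by (intro nn_integral_mono)
        (auto simp: ennreal_plus[symmetric] simp del: ennreal_plus split: split_indicator intro!: ennreal_leI)
    then show ?thesis by (subst (asm) nn_integral_add) auto
  qed
  have HL: "?H \<le> ?L"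
    unfolding Hat using nn_integral_H_at_le before_tG_subset_TT
    by (intro nn_integral_le_before_tG[OF A]) auto
  have "?L \<le> ?H + ?L'"
    unfolding Hat L_def by (rule add) auto
  moreover have "?L' \<le> ?L + ?H"
    using add[of L "\<lambda>\<omega>. - H_at P \<gamma> H \<omega>"] unfolding Hat by (simp add: L_def)
  ultimately show ?thesis using HL
    by (auto simp: ennreal_add_less_top less_top[symmetric] top_unique intro: le_less_trans)
qed

lemma AE_paths: "AE \<omega> in P. \<gamma> \<omega> \<le> t_G P \<gamma> \<and>
    (\<forall>t\<ge>0. (ennreal t < \<gamma> \<omega> \<longrightarrow> M t \<omega> = F t) \<and> (\<gamma> \<omega> \<le> ennreal t \<longrightarrow> M t \<omega> = L \<omega>))"
proof -
  have "AE \<omega> in P. \<forall>t\<ge>0. M t \<omega> =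
        F t * indicator {\<omega>. ennreal t < \<gamma> \<omega>} \<omega> +
        (H_at P \<gamma> H \<omega> + L' \<omega>) * indicator {\<omega>. \<gamma> \<omega> \<le> ennreal t} \<omega>"
    using representation by (simp add: sj_representation_def)
  with AE_le_tG show ?thesis
    by eventually_elim (auto simp: L_def)
qed

text \<open>The mass of \<open>|f| dG\<close> on \<open>(0,\<gamma>)\<close>, a bound for the variation of \<open>F\<close> on \<open>[0,\<gamma>)\<close>.\<close>

definition V :: "'a \<Rightarrow> ennreal" where
  "V \<omega> = (\<integral>\<^sup>+s. (if 0 < s \<and> ennreal s < \<gamma> \<omega> then ennreal \<bar>f0 s\<bar> else 0) \<partial>dG P \<gamma>)"

lemma V_measurable [measurable]: "V \<in> borel_measurable P"
  unfolding V_def[abs_def] by measurable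

text \<open>Before \<open>\<gamma>\<close> the path moves by at most \<open>V\<close>; the jump is at most \<open>|L|\<close> plus the bound \<open>|F 0| + V\<close> for \<open>F\<close>;
the initial value adds \<open>|F 0|\<close> or \<open>|L|\<close>.\<close>

lemma AE_variation_le:
  "AE \<omega> in P. variation (\<lambda>t. M t \<omega>) \<le>
    ennreal (2 * \<bar>F 0\<bar>) + 2 * V \<omega> + 2 * (ennreal \<bar>L \<omega>\<bar> * indicator {\<omega>. \<gamma> \<omega> < \<infinity>} \<omega>)"
  using AE_paths
proof eventually_elim
  case (elim \<omega>)
  then have le: "\<gamma> \<omega> \<le> t_G P \<gamma>"
    and before: "\<And>t. 0 \<le> t \<Longrightarrow> ennreal t < \<gamma> \<omega> \<Longrightarrow> M t \<omega> = F t"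
    and after: "\<And>t. 0 \<le> t \<Longrightarrow> \<not> ennreal t < \<gamma> \<omega> \<Longrightarrow> M t \<omega> = L \<omega>" by (auto simp: not_less)
  show ?case
  proof (cases "V \<omega>")
    case (real v)
    define W where "W t = (LINT r|dG P \<gamma>. indicator {0<..t} r * \<bar>f0 r\<bar>)" for t
    define \<Lambda> where "\<Lambda> = \<bar>L \<omega>\<bar> * indicator {\<omega>. \<gamma> \<omega> < \<infinity>} \<omega>"
    \<comment> \<open>The value from \<open>\<gamma>\<close> on exceeds \<open>W\<close> by enough to pay for the jump: \<open>v\<close> covers \<open>W s\<close>, and
      \<open>v + \<bar>F 0\<bar> + \<bar>L \<omega>\<bar>\<close> covers \<open>\<bar>L \<omega> - F s\<bar>\<close>.\<close>
    define w where "w t = (if ennreal t < \<gamma> \<omega> then W t else 2 * v + \<bar>F 0\<bar> + \<bar>L \<omega>\<bar>)" for t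
    have bt: "t \<in> before_tG P \<gamma>" if "0 \<le> t" "ennreal t < \<gamma> \<omega>" for t
      using that le by (auto simp: before_tG_def)
    have W: "0 \<le> W t" "W t \<le> v" if t: "0 \<le> t" "ennreal t < \<gamma> \<omega>" for t
    proof -
      show "0 \<le> W t" unfolding W_def by (intro integral_nonneg_AE) auto
      have tT: "t \<in> TT P \<gamma>" using bt[OF t] before_tG_subset_TT by auto
      have "ennreal (W t) = (\<integral>\<^sup>+r. ennreal (indicator {0<..t} r * \<bar>f0 r\<bar>) \<partial>dG P \<gamma>)"
        unfolding W_def by (intro nn_integral_eq_integral[symmetric] integrable_abs_f0[OF tT]) auto
      also have "\<dots> \<le> V \<omega>"
        unfolding V_def using t
        by (intro nn_integral_mono) (auto split: split_indicator intro: le_less_trans ennreal_leI)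
      finally show "W t \<le> v" using real by simp
    qed
    have F: "\<bar>F t\<bar> \<le> \<bar>F 0\<bar> + W t" if t: "0 \<le> t" "ennreal t < \<gamma> \<omega>" for t
      using F_bound[OF bt[OF t] t(1) order_refl] by (simp add: W_def)
    have "variation (\<lambda>t. M t \<omega>) \<le> ennreal \<bar>M 0 \<omega>\<bar> + ennreal (2 * v + \<bar>F 0\<bar> + \<Lambda>)"
    proof (rule variation_le)
      fix s t :: real assume st: "0 \<le> s" "s \<le> t"
      show "\<bar>M t \<omega> - M s \<omega>\<bar> \<le> w t - w s"
      proof (cases "ennreal t < \<gamma> \<omega>")
        case True
        then have "ennreal s < \<gamma> \<omega>" using st by (auto intro: le_less_trans[OF ennreal_leI])
        with True st F_increment_le[OF bt[of t] st] show ?thesis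
          by (simp add: before w_def W_def)
      next
        case t: False
        show ?thesis
        proof (cases "ennreal s < \<gamma> \<omega>")
          case True
          with t st F[OF st(1) True] W[OF st(1) True] show ?thesis
            by (simp add: before after w_def)
        next
          case False
          with t st show ?thesis by (simp add: after w_def)
        qed
      qed
    next
      fix t :: real assume "0 \<le> t"
      then show "0 \<le> w t" using W real by (auto simp: w_def)
      have "\<gamma> \<omega> < \<infinity>" if "\<not> ennreal t < \<gamma> \<omega>"
        using that by (auto simp: not_less intro: le_less_trans[OF _ ennreal_less_top])
      then show "w t \<le> 2 * v + \<bar>F 0\<bar> + \<Lambda>"
        using W[OF \<open>0 \<le> t\<close>] real by (auto simp: w_def \<Lambda>_def intro: order_trans)
    qed
    also have "\<bar>M 0 \<omega>\<bar> \<le> \<bar>F 0\<bar> + \<Lambda>"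
      using before[of 0] after[of 0] by (cases "0 < \<gamma> \<omega>") (auto simp: \<Lambda>_def)
    then have "ennreal \<bar>M 0 \<omega>\<bar> + ennreal (2 * v + \<bar>F 0\<bar> + \<Lambda>) \<le> ennreal (2 * \<bar>F 0\<bar> + 2 * v + 2 * \<Lambda>)"
      using real by (auto simp: ennreal_plus[symmetric] \<Lambda>_def simp del: ennreal_plus intro!: ennreal_leI)
    also have "\<dots> = ennreal (2 * \<bar>F 0\<bar>) + 2 * V \<omega> + 2 * (ennreal \<bar>L \<omega>\<bar> * indicator {\<omega>. \<gamma> \<omega> < \<infinity>} \<omega>)"
      using real by (auto simp: \<Lambda>_def ennreal_mult split: split_indicator)
    finally show ?thesis .
  qed simp
qed

text \<open>An atom of \<open>dG\<close> at \<open>0\<close> contributes only a finite amount.\<close>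

lemma Gbar_f_finite_iff:
  "(\<integral>\<^sup>+s\<in>before_tG P \<gamma>. ennreal (Gbar P \<gamma> s * \<bar>f s\<bar>) \<partial>dG P \<gamma>) < \<infinity> \<longleftrightarrow>
    (\<integral>\<^sup>+s. (if 0 < s \<and> s \<in> before_tG P \<gamma> then ennreal (Gbar P \<gamma> s * \<bar>f s\<bar>) else 0) \<partial>dG P \<gamma>) < \<infinity>"
    (is "?I < \<infinity> \<longleftrightarrow> ?J < \<infinity>")
proof -
  have fm [measurable]: "(\<lambda>s. if 0 < s \<and> s \<in> before_tG P \<gamma> then ennreal (Gbar P \<gamma> s * \<bar>f s\<bar>) else 0) \<in> borel_measurable borel"
  proof -
    have "(\<lambda>s. if 0 < s \<and> s \<in> before_tG P \<gamma> then ennreal (Gbar P \<gamma> s * \<bar>f0 s\<bar>) else 0) \<in> borel_measurable borel"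
      by measurable
    also have "(\<lambda>s. if 0 < s \<and> s \<in> before_tG P \<gamma> then ennreal (Gbar P \<gamma> s * \<bar>f0 s\<bar>) else 0) =
      (\<lambda>s. if 0 < s \<and> s \<in> before_tG P \<gamma> then ennreal (Gbar P \<gamma> s * \<bar>f s\<bar>) else 0)"
      using before_tG_subset_TT by (auto simp: fun_eq_iff)
    finally show ?thesis .
  qed
  have "?I = (\<integral>\<^sup>+s. (if 0 < s \<and> s \<in> before_tG P \<gamma> then ennreal (Gbar P \<gamma> s * \<bar>f s\<bar>) else 0) +
      ennreal (Gbar P \<gamma> 0 * \<bar>f 0\<bar>) * indicator {0} s \<partial>dG P \<gamma>)"
    using zero_before_tG by (intro nn_integral_cong)
      (auto split: split_indicator simp: before_tG_def not_less)
  also have "\<dots> = ?J + ennreal (Gbar P \<gamma> 0 * \<bar>f 0\<bar>) * emeasure (dG P \<gamma>) {0}"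
    by (subst nn_integral_add) (auto simp: nn_integral_cmult_indicator)
  also have "\<dots> < \<infinity> \<longleftrightarrow> ?J < \<infinity>"
    using dG.emeasure_finite[of "{0}"]
    by (auto simp: ennreal_add_less_top less_top[symmetric] ennreal_mult_eq_top_iff)
  finally show ?thesis .
qed

text \<open>By Fubini, \<open>|f s|\<close> is weighted with \<open>P(s < \<gamma>) = Gbar s\<close>, which vanishes from \<open>t_G\<close> on.\<close>

lemma nn_integral_V:
  "(\<integral>\<^sup>+\<omega>. V \<omega> \<partial>P) =
    (\<integral>\<^sup>+s. (if 0 < s \<and> s \<in> before_tG P \<gamma> then ennreal (Gbar P \<gamma> s * \<bar>f s\<bar>) else 0) \<partial>dG P \<gamma>)"
proof -
  interpret pair_sigma_finite P "dG P \<gamma>" ..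
  have "(\<integral>\<^sup>+\<omega>. V \<omega> \<partial>P) =
      (\<integral>\<^sup>+s. (\<integral>\<^sup>+\<omega>. (if 0 < s \<and> ennreal s < \<gamma> \<omega> then ennreal \<bar>f0 s\<bar> else 0) \<partial>P) \<partial>dG P \<gamma>)"
    unfolding V_def by (rule Fubini'[symmetric]) measurable
  also have "\<dots> = (\<integral>\<^sup>+s. (if 0 < s \<and> s \<in> before_tG P \<gamma> then ennreal (Gbar P \<gamma> s * \<bar>f s\<bar>) else 0) \<partial>dG P \<gamma>)"
  proof (intro nn_integral_cong)
    fix s
    have "(\<integral>\<^sup>+\<omega>. (if 0 < s \<and> ennreal s < \<gamma> \<omega> then ennreal \<bar>f0 s\<bar> else 0) \<partial>P) =
        (\<integral>\<^sup>+\<omega>. (if 0 < s then ennreal \<bar>f0 s\<bar> else 0) * indicator {\<omega>\<in>space P. ennreal s < \<gamma> \<omega>} \<omega> \<partial>P)"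
      by (intro nn_integral_cong) (auto split: split_indicator)
    also have "\<dots> = (if 0 < s then ennreal \<bar>f0 s\<bar> else 0) * ennreal (Gbar P \<gamma> s)"
      by (subst nn_integral_cmult_indicator) (auto simp: Gbar_eq emeasure_eq_measure)
    also have "\<dots> = (if 0 < s \<and> s \<in> before_tG P \<gamma> then ennreal (Gbar P \<gamma> s * \<bar>f s\<bar>) else 0)"
    proof (cases "0 < s \<and> s \<notin> before_tG P \<gamma>")
      case True
      then have "Gbar P \<gamma> s = 0" using before_tG_iff[of s] Gbar_nonneg[of s] by auto
      then show ?thesis using True by simp
    next
      case False
      then show ?thesis using before_tG_subset_TT Gbar_nonneg[of s]
        by (auto simp: ennreal_mult mult.commute)
    qed
    finally show "(\<integral>\<^sup>+\<omega>. (if 0 < s \<and> ennreal s < \<gamma> \<omega> then ennreal \<bar>f0 s\<bar> else 0) \<partial>P) =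
      (if 0 < s \<and> s \<in> before_tG P \<gamma> then ennreal (Gbar P \<gamma> s * \<bar>f s\<bar>) else 0)" .
  qed
  finally show ?thesis .
qed

lemma Type4I:
  assumes L: "(\<integral>\<^sup>+\<omega>. ennreal \<bar>L \<omega>\<bar> * indicator {\<omega>. \<gamma> \<omega> < \<infinity>} \<omega> \<partial>P) < \<infinity>"
    and f: "(\<integral>\<^sup>+s\<in>before_tG P \<gamma>. ennreal (Gbar P \<gamma> s * \<bar>f s\<bar>) \<partial>dG P \<gamma>) < \<infinity>"
  shows "(\<integral>\<^sup>+\<omega>. variation (\<lambda>t. M t \<omega>) \<partial>P) < \<infinity>"
proof -
  have [measurable]: "(\<lambda>\<omega>. ennreal \<bar>L \<omega>\<bar> * indicator {\<omega>. \<gamma> \<omega> < \<infinity>} \<omega>) \<in> borel_measurable P"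
    by measurable
  have "(\<integral>\<^sup>+\<omega>. variation (\<lambda>t. M t \<omega>) \<partial>P) \<le> (\<integral>\<^sup>+\<omega>. ennreal (2 * \<bar>F 0\<bar>) + 2 * V \<omega> +
      2 * (ennreal \<bar>L \<omega>\<bar> * indicator {\<omega>. \<gamma> \<omega> < \<infinity>} \<omega>) \<partial>P)"
    by (rule nn_integral_mono_AE[OF AE_variation_le])
  also have "\<dots> = ennreal (2 * \<bar>F 0\<bar>) + 2 * (\<integral>\<^sup>+\<omega>. V \<omega> \<partial>P) +
      2 * (\<integral>\<^sup>+\<omega>. ennreal \<bar>L \<omega>\<bar> * indicator {\<omega>. \<gamma> \<omega> < \<infinity>} \<omega> \<partial>P)"
    by (simp add: nn_integral_add nn_integral_cmult emeasure_space_1)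
  also have "\<dots> < \<infinity>"
    using L f unfolding Gbar_f_finite_iff nn_integral_V[symmetric]
    by (auto simp: ennreal_add_less_top ennreal_mult_less_top less_top)
  finally show ?thesis .
qed

lemma Gbar_f_finite_if_F_left:
  assumes F: "(\<integral>\<^sup>+s. ennreal \<bar>F_left s\<bar> * indicator ({0<..} \<inter> before_tG P \<gamma>) s \<partial>dG P \<gamma>) < \<infinity>"
    and H: "(\<integral>\<^sup>+s\<in>before_tG P \<gamma>. ennreal \<bar>H s\<bar> \<partial>dG P \<gamma>) < \<infinity>"
  shows "(\<integral>\<^sup>+s\<in>before_tG P \<gamma>. ennreal (Gbar P \<gamma> s * \<bar>f s\<bar>) \<partial>dG P \<gamma>) < \<infinity>"
proof -
  have Hm [measurable]: "(\<lambda>s. ennreal \<bar>H s\<bar> * indicator (before_tG P \<gamma>) s) \<in> borel_measurable borel"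
  proof -
    have "(\<lambda>s. ennreal \<bar>H0 s\<bar> * indicator (before_tG P \<gamma>) s) \<in> borel_measurable borel" by measurable
    also have "(\<lambda>s. ennreal \<bar>H0 s\<bar> * indicator (before_tG P \<gamma>) s) = (\<lambda>s. ennreal \<bar>H s\<bar> * indicator (before_tG P \<gamma>) s)"
      using before_tG_subset_TT by (auto simp: fun_eq_iff split: split_indicator)
    finally show ?thesis .
  qed
  have "(\<integral>\<^sup>+s. (if 0 < s \<and> s \<in> before_tG P \<gamma> then ennreal (Gbar P \<gamma> s * \<bar>f s\<bar>) else 0) \<partial>dG P \<gamma>) \<le>
    (\<integral>\<^sup>+s. ennreal \<bar>F_left s\<bar> * indicator ({0<..} \<inter> before_tG P \<gamma>) s +
      ennreal \<bar>H s\<bar> * indicator (before_tG P \<gamma>) s \<partial>dG P \<gamma>)"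
  proof (rule nn_integral_mono_AE)
    show "AE s in dG P \<gamma>. (if 0 < s \<and> s \<in> before_tG P \<gamma> then ennreal (Gbar P \<gamma> s * \<bar>f s\<bar>) else 0) \<le>
      ennreal \<bar>F_left s\<bar> * indicator ({0<..} \<inter> before_tG P \<gamma>) s + ennreal \<bar>H s\<bar> * indicator (before_tG P \<gamma>) s"
      using Gbar_f_eq
    proof eventually_elim
      case (elim s)
      show ?case
      proof (cases "0 < s \<and> s \<in> before_tG P \<gamma>")
        case True
        then have "Gbar P \<gamma> s * \<bar>f s\<bar> = \<bar>F_left s - H s\<bar>"
          using elim Gbar_nonneg[of s] by (metis abs_mult abs_of_nonneg)
        with True show ?thesis
          by (auto simp: ennreal_plus[symmetric] simp del: ennreal_plus intro!: ennreal_leI)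
      qed auto
    qed
  qed
  also have "\<dots> < \<infinity>"
    using F H by (subst nn_integral_add) (auto simp: ennreal_add_less_top)
  finally show ?thesis unfolding Gbar_f_finite_iff .
qed

text \<open>The values \<open>F t\<close> for \<open>t < \<gamma>\<close> lie on the path and converge to \<open>F_left \<gamma>\<close> as \<open>t \<up> \<gamma>\<close>. An integrable
supremum therefore makes \<open>F_left\<close> integrable with respect to \<open>dG\<close>.\<close>

lemma Gbar_f_finite_if_sup:
  assumes A: "case_A P \<gamma>"
    and sup: "(\<integral>\<^sup>+\<omega>. (SUP t\<in>{0..}. ennreal \<bar>M t \<omega>\<bar>) \<partial>P) < \<infinity>"
    and H: "(\<integral>\<^sup>+s\<in>before_tG P \<gamma>. ennreal \<bar>H s\<bar> \<partial>dG P \<gamma>) < \<infinity>"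
  shows "(\<integral>\<^sup>+s\<in>before_tG P \<gamma>. ennreal (Gbar P \<gamma> s * \<bar>f s\<bar>) \<partial>dG P \<gamma>) < \<infinity>"
proof (rule Gbar_f_finite_if_F_left[OF _ H])
  have "(\<integral>\<^sup>+s. ennreal \<bar>F_left s\<bar> * indicator ({0<..} \<inter> before_tG P \<gamma>) s \<partial>dG P \<gamma>) =
      (\<integral>\<^sup>+\<omega>. (ennreal \<bar>F_left (enn2real (\<gamma> \<omega>))\<bar> * indicator ({0<..} \<inter> before_tG P \<gamma>) (enn2real (\<gamma> \<omega>)))
        * indicator {\<omega>. \<gamma> \<omega> < \<infinity>} \<omega> \<partial>P)"
    by (rule nn_integral_dG) measurable
  also have "\<dots> \<le> (\<integral>\<^sup>+\<omega>. (SUP t\<in>{0..}. ennreal \<bar>M t \<omega>\<bar>) \<partial>P)"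
  proof (rule nn_integral_mono_AE)
    show "AE \<omega> in P. (ennreal \<bar>F_left (enn2real (\<gamma> \<omega>))\<bar> * indicator ({0<..} \<inter> before_tG P \<gamma>) (enn2real (\<gamma> \<omega>)))
        * indicator {\<omega>. \<gamma> \<omega> < \<infinity>} \<omega> \<le> (SUP t\<in>{0..}. ennreal \<bar>M t \<omega>\<bar>)"
      using AE_paths
    proof eventually_elim
      case (elim \<omega>)
      let ?g = "enn2real (\<gamma> \<omega>)"
      show ?case
      proof (cases "\<gamma> \<omega> < \<infinity> \<and> 0 < ?g \<and> ?g \<in> before_tG P \<gamma>")
        case True
        let ?S = "\<lambda>n. ?g - ?g / real (Suc n)"
        have S: "0 \<le> ?S n" "ennreal (?S n) < \<gamma> \<omega>" for n
          using True by (cases "\<gamma> \<omega>"; auto simp: field_simps ennreal_less_iff)+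
        have "(\<lambda>n. ennreal \<bar>F (?S n)\<bar>) \<longlonglongrightarrow> ennreal \<bar>F_left ?g\<bar>"
          using True by (intro tendsto_ennrealI tendsto_rabs F_left_tendsto) auto
        moreover have "ennreal \<bar>F (?S n)\<bar> \<le> (SUP t\<in>{0..}. ennreal \<bar>M t \<omega>\<bar>)" for n
          using elim S[of n] by (intro SUP_upper2[of "?S n"]) auto
        ultimately have "ennreal \<bar>F_left ?g\<bar> \<le> (SUP t\<in>{0..}. ennreal \<bar>M t \<omega>\<bar>)"
          by (intro LIMSEQ_le_const2[where X="\<lambda>n. ennreal \<bar>F (?S n)\<bar>"] exI[of _ 0]) auto
        with True show ?thesis by simp
      qed (auto split: split_indicator)
    qed
  qed
  finally show "(\<integral>\<^sup>+s. ennreal \<bar>F_left s\<bar> * indicator ({0<..} \<inter> before_tG P \<gamma>) s \<partial>dG P \<gamma>) < \<infinity>"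
    using sup by (rule le_less_trans)
qed

lemma sup_le_variation: "(\<integral>\<^sup>+\<omega>. (SUP t\<in>{0..}. ennreal \<bar>M t \<omega>\<bar>) \<partial>P) \<le> (\<integral>\<^sup>+\<omega>. variation (\<lambda>t. M t \<omega>) \<partial>P)"
  by (intro nn_integral_mono SUP_least) (use abs_le_variation in auto)

end

section \<open>Conditional expectations of the process\<close>

context sj_process
begin

lemma integral_indicator_jump:
  "(LINT \<omega>|P. c * indicator {\<omega>. ennreal t < \<gamma> \<omega>} \<omega>) = c * Gbar P \<gamma> t"
proof -
  have "(LINT \<omega>|P. c * indicator {\<omega>. ennreal t < \<gamma> \<omega>} \<omega>) = (LINT \<omega>|P. c * indicator {\<omega>\<in>space P. ennreal t < \<gamma> \<omega>} \<omega>)"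
    by (intro Bochner_Integration.integral_cong) (auto split: split_indicator)
  then show ?thesis by (simp add: Gbar_eq)
qed

lemma integrable_indicator_jump:
  "integrable P (\<lambda>\<omega>. c * indicator {\<omega>. ennreal t < \<gamma> \<omega>} \<omega> :: real)"
proof (rule integrable_const_bound[of _ "\<bar>c\<bar>"])
  show "(\<lambda>\<omega>. c * indicator {\<omega>. ennreal t < \<gamma> \<omega>} \<omega>) \<in> borel_measurable P"
    by measurable
qed (auto split: split_indicator)

lemma AE_M_eq: "0 \<le> t \<Longrightarrow> AE \<omega> in P. M t \<omega> =
    F t * indicator {\<omega>. ennreal t < \<gamma> \<omega>} \<omega> + L \<omega> * indicator {\<omega>. \<gamma> \<omega> \<le> ennreal t} \<omega>"
  using AE_paths by eventually_elim (auto split: split_indicator)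

lemma integrable_M:
  assumes t: "t \<in> before_tG P \<gamma>"
  shows "integrable P (M t)"
proof -
  have t0: "0 \<le> t" and tT: "t \<in> TT P \<gamma>" using t before_tG_subset_TT by (auto simp: before_tG_def)
  have I: "integrable P (\<lambda>\<omega>. F t * indicator {\<omega>. ennreal t < \<gamma> \<omega>} \<omega> + L \<omega> * indicator {\<omega>. \<gamma> \<omega> \<le> ennreal t} \<omega>)"
    by (intro Bochner_Integration.integrable_add integrable_indicator_jump integrable_L_le tT)
  show ?thesis
    by (rule integrable_cong_AE_imp[OF I measurable_from_sj[OF M_measurable[OF t0]]])
      (use AE_M_eq[OF t0] in eventually_elim, simp)
qed

text \<open>Until time \<open>t\<close> the event \<open>{s < \<gamma>}\<close> splits into \<open>{t < \<gamma>}\<close>, where \<open>M t = F t\<close>, and \<open>{s < \<gamma> \<le> t}\<close>, where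
\<open>M t = L\<close>; the two contributions add up to a value that does not depend on \<open>t\<close>.\<close>

lemma expectation_M_jump:
  assumes t: "t \<in> before_tG P \<gamma>" and s: "0 \<le> s" "s \<le> t"
  shows "(LINT \<omega>|P. M t \<omega> * indicator {\<omega>. ennreal s < \<gamma> \<omega>} \<omega>) = F s * Gbar P \<gamma> s"
proof -
  have t0: "0 \<le> t" and tT: "t \<in> TT P \<gamma>" using t before_tG_subset_TT by (auto simp: before_tG_def)
  have [measurable]: "M t \<in> borel_measurable P"
    by (rule measurable_from_sj[OF M_measurable[OF t0]])
  have IL: "integrable P (\<lambda>\<omega>. L \<omega> * indicator {\<omega>. ennreal s < \<gamma> \<omega> \<and> \<gamma> \<omega> \<le> ennreal t} \<omega>)"
    by (rule Bochner_Integration.integrable_bound[OF integrable_L_le[OF tT]])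
      (measurable, auto intro!: AE_I2 split: split_indicator)
  have "(LINT \<omega>|P. M t \<omega> * indicator {\<omega>. ennreal s < \<gamma> \<omega>} \<omega>) =
      (LINT \<omega>|P. F t * indicator {\<omega>. ennreal t < \<gamma> \<omega>} \<omega> +
        L \<omega> * indicator {\<omega>. ennreal s < \<gamma> \<omega> \<and> \<gamma> \<omega> \<le> ennreal t} \<omega>)"
  proof (rule integral_cong_AE)
    show "AE \<omega> in P. M t \<omega> * indicator {\<omega>. ennreal s < \<gamma> \<omega>} \<omega> =
      F t * indicator {\<omega>. ennreal t < \<gamma> \<omega>} \<omega> + L \<omega> * indicator {\<omega>. ennreal s < \<gamma> \<omega> \<and> \<gamma> \<omega> \<le> ennreal t} \<omega>"
      using AE_M_eq[OF t0]
    proof eventually_elim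
      case (elim \<omega>)
      have "ennreal s < \<gamma> \<omega>" if "ennreal t < \<gamma> \<omega>"
        using le_less_trans[OF ennreal_leI[OF s(2)] that] .
      with elim show ?case by (auto split: split_indicator)
    qed
  qed measurable
  also have "\<dots> = F t * Gbar P \<gamma> t + (F s * Gbar P \<gamma> s - F t * Gbar P \<gamma> t)"
    using Bochner_Integration.integral_add[OF integrable_indicator_jump[of "F t" t] IL]
      expectation_L[OF t s] integral_indicator_jump[of "F t" t] by simp
  finally show ?thesis by simp
qed

lemma AE_M_stable:
  assumes "0 \<le> s" "s \<le> t"
  shows "AE \<omega> in P. \<gamma> \<omega> \<le> ennreal s \<longrightarrow> M t \<omega> = M s \<omega>"
  using AE_paths
proof eventually_elim
  case (elim \<omega>)
  with assms show ?case using order_trans[OF _ ennreal_leI[OF assms(2)], of "\<gamma> \<omega>"] by auto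
qed

lemma cond_exp_M:
  assumes t: "t \<in> before_tG P \<gamma>" and s: "0 \<le> s" "s \<le> t"
  shows "AE \<omega> in P. real_cond_exp P (\<FF> (ennreal s)) (M t) \<omega> = M s \<omega>"
  using real_cond_exp_sj[OF integrable_M[OF t] integrable_M[OF before_tG_down[OF t s]] M_measurable[OF s(1)] AE_M_stable[OF s]]
  unfolding expectation_M_jump[OF t s] expectation_M_jump[OF before_tG_down[OF t s] s(1) order_refl]
  by simp

section \<open>Limits\<close>

lemma integrable_L_finite:
  assumes "(\<integral>\<^sup>+\<omega>. ennreal \<bar>L \<omega>\<bar> * indicator {\<omega>. \<gamma> \<omega> < \<infinity>} \<omega> \<partial>P) < \<infinity>"
  shows "integrable P (\<lambda>\<omega>. L \<omega> * indicator {\<omega>. \<gamma> \<omega> < \<infinity>} \<omega>)"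
proof (rule integrableI_bounded)
  have "(\<integral>\<^sup>+\<omega>. ennreal (norm (L \<omega> * indicator {\<omega>. \<gamma> \<omega> < \<infinity>} \<omega>)) \<partial>P) =
      (\<integral>\<^sup>+\<omega>. ennreal \<bar>L \<omega>\<bar> * indicator {\<omega>. \<gamma> \<omega> < \<infinity>} \<omega> \<partial>P)"
    by (intro nn_integral_cong) (auto split: split_indicator)
  with assms show "(\<integral>\<^sup>+\<omega>. ennreal (norm (L \<omega> * indicator {\<omega>. \<gamma> \<omega> < \<infinity>} \<omega>)) \<partial>P) < \<infinity>" by simp
qed measurable

text \<open>The limit of \<open>F * Gbar\<close> at \<open>t_G\<close> when \<open>L\<close> is integrable on \<open>{\<gamma> < \<infinity>}\<close>. If moreover \<open>\<gamma>\<close> is almost surely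
finite in Case A, this is the expectation that is lost in the limit, \<open>E (M 0) - E (M \<infinity>)\<close>.\<close>

definition limit_loss :: real where
  "limit_loss = F 0 * Gbar P \<gamma> 0 - (LINT \<omega>|P. L \<omega> * indicator {\<omega>. 0 < \<gamma> \<omega> \<and> \<gamma> \<omega> < \<infinity>} \<omega>)"

lemma F_Gbar_tendsto:
  assumes A: "case_A P \<gamma>" and L: "(\<integral>\<^sup>+\<omega>. ennreal \<bar>L \<omega>\<bar> * indicator {\<omega>. \<gamma> \<omega> < \<infinity>} \<omega> \<partial>P) < \<infinity>"
  shows "((\<lambda>t. F t * Gbar P \<gamma> t) \<longlongrightarrow> limit_loss) (to_tG P \<gamma>)"
proof -
  let ?X = "\<lambda>\<omega>. L \<omega> * indicator {\<omega>. 0 < \<gamma> \<omega> \<and> \<gamma> \<omega> < \<infinity>} \<omega>"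
  have X: "integrable P ?X"
    by (rule Bochner_Integration.integrable_bound[OF integrable_L_finite[OF L]])
      (measurable, auto intro!: AE_I2 split: split_indicator)
  have "((\<lambda>t. F 0 * Gbar P \<gamma> 0 - (LINT \<omega>|P. ?X \<omega> * indicator {\<omega>. \<gamma> \<omega> \<le> ennreal t} \<omega>)) \<longlongrightarrow>
      F 0 * Gbar P \<gamma> 0 - (LINT \<omega>|P. ?X \<omega> * indicator {\<omega>. \<gamma> \<omega> < \<infinity>} \<omega>)) (to_tG P \<gamma>)"
    by (intro tendsto_intros tendsto_integral_before_tG[OF A X])
  moreover have "(LINT \<omega>|P. ?X \<omega> * indicator {\<omega>. \<gamma> \<omega> < \<infinity>} \<omega>) = (LINT \<omega>|P. ?X \<omega>)"
    by (intro Bochner_Integration.integral_cong) (auto split: split_indicator)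
  moreover have "\<forall>\<^sub>F t in to_tG P \<gamma>. F 0 * Gbar P \<gamma> 0 - (LINT \<omega>|P. ?X \<omega> * indicator {\<omega>. \<gamma> \<omega> \<le> ennreal t} \<omega>) =
      F t * Gbar P \<gamma> t"
    unfolding eventually_to_tG
  proof (intro bexI[of _ 0] ballI impI)
    fix t assume t: "t \<in> before_tG P \<gamma>" "0 < t"
    have "(LINT \<omega>|P. ?X \<omega> * indicator {\<omega>. \<gamma> \<omega> \<le> ennreal t} \<omega>) =
        (LINT \<omega>|P. L \<omega> * indicator {\<omega>. ennreal 0 < \<gamma> \<omega> \<and> \<gamma> \<omega> \<le> ennreal t} \<omega>)"
      by (intro Bochner_Integration.integral_cong) (auto split: split_indicator intro: le_less_trans[OF _ ennreal_less_top])
    then show "F 0 * Gbar P \<gamma> 0 - (LINT \<omega>|P. ?X \<omega> * indicator {\<omega>. \<gamma> \<omega> \<le> ennreal t} \<omega>) = F t * Gbar P \<gamma> t"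
      using expectation_L[OF t(1), of 0] t(2) by simp
  qed (rule zero_before_tG)
  ultimately show ?thesis unfolding limit_loss_def by (simp add: tendsto_cong)
qed

lemma F_Gbar_bounded:
  assumes L: "(\<integral>\<^sup>+\<omega>. ennreal \<bar>L \<omega>\<bar> * indicator {\<omega>. \<gamma> \<omega> < \<infinity>} \<omega> \<partial>P) < \<infinity>"
  obtains C where "\<And>t. t \<in> before_tG P \<gamma> \<Longrightarrow> \<bar>F t * Gbar P \<gamma> t\<bar> \<le> C"
proof (rule that)
  fix t assume t: "t \<in> before_tG P \<gamma>"
  then have t0: "0 \<le> t" by (simp add: before_tG_def)
  let ?X = "\<lambda>\<omega>. L \<omega> * indicator {\<omega>. ennreal 0 < \<gamma> \<omega> \<and> \<gamma> \<omega> \<le> ennreal t} \<omega>"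
  have "\<bar>LINT \<omega>|P. ?X \<omega>\<bar> \<le> (LINT \<omega>|P. \<bar>?X \<omega>\<bar>)"
    by (rule integral_abs_bound)
  also have "\<dots> \<le> (LINT \<omega>|P. \<bar>L \<omega> * indicator {\<omega>. \<gamma> \<omega> < \<infinity>} \<omega>\<bar>)"
    by (intro integral_mono' integrable_abs integrable_L_finite[OF L])
      (auto split: split_indicator intro: le_less_trans[OF _ ennreal_less_top])
  finally show "\<bar>F t * Gbar P \<gamma> t\<bar> \<le> \<bar>F 0 * Gbar P \<gamma> 0\<bar> + (LINT \<omega>|P. \<bar>L \<omega> * indicator {\<omega>. \<gamma> \<omega> < \<infinity>} \<omega>\<bar>)"
    using expectation_L[OF t order_refl t0] by linarith
qed

lemma M_limit_if_finite:
  assumes "\<gamma> \<omega> < \<infinity>" and "\<And>t. 0 \<le> t \<Longrightarrow> \<gamma> \<omega> \<le> ennreal t \<Longrightarrow> M t \<omega> = L \<omega>"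
  shows "((\<lambda>t. M t \<omega>) \<longlongrightarrow> L \<omega>) at_top"
proof (rule tendsto_eventually)
  obtain g where "\<gamma> \<omega> = ennreal g" "0 \<le> g" using assms(1) by (cases "\<gamma> \<omega>") auto
  with assms(2) show "\<forall>\<^sub>F t in at_top. M t \<omega> = L \<omega>"
    by (auto simp: eventually_at_top_linorder intro!: exI[of _ g])
qed

lemma terminal_eq: "((\<lambda>t. M t \<omega>) \<longlongrightarrow> l) at_top \<Longrightarrow> terminal M \<omega> = l"
  unfolding terminal_def by (intro limI filterlim_compose[OF _ filterlim_real_sequentially])

lemma AE_terminal: "AE \<omega> in P. \<gamma> \<omega> < \<infinity> \<longrightarrow> terminal M \<omega> = L \<omega>"
  using AE_paths by eventually_elim (auto intro!: terminal_eq M_limit_if_finite)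

lemma terminal_measurable [measurable]: "terminal M \<in> borel_measurable P"
proof -
  have [measurable]: "M (real n) \<in> borel_measurable P" for n
    by (rule measurable_from_sj[OF M_measurable]) simp
  show ?thesis unfolding terminal_def[abs_def] by measurable
qed

section \<open>The types\<close>

text \<open>Here \<open>t_G\<close> belongs to \<open>TT\<close>, so local integrability on \<open>TT\<close> is integrability.\<close>

lemma Type4_case_B:
  assumes "case_B P \<gamma>"
  shows "has_type P \<FF> M Type4"
proof -
  obtain r where r: "t_G P \<gamma> = ennreal r" "0 < r" "r \<in> TT P \<gamma>"
    by (rule case_B_tG[OF assms])
  have "(\<integral>\<^sup>+\<omega>. ennreal \<bar>L \<omega>\<bar> * indicator {\<omega>. \<gamma> \<omega> < \<infinity>} \<omega> \<partial>P) \<le>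
      (\<integral>\<^sup>+\<omega>. ennreal (norm (L \<omega> * indicator {\<omega>. \<gamma> \<omega> \<le> ennreal r} \<omega>)) \<partial>P)"
    using AE_le_tG by (intro nn_integral_mono_AE) (auto elim!: eventually_mono simp: r split: split_indicator)
  also have "\<dots> < \<infinity>"
    using integrable_L_le[OF r(3)] by (simp add: integrable_iff_bounded)
  finally have L: "(\<integral>\<^sup>+\<omega>. ennreal \<bar>L \<omega>\<bar> * indicator {\<omega>. \<gamma> \<omega> < \<infinity>} \<omega> \<partial>P) < \<infinity>" .
  have "(\<integral>\<^sup>+s\<in>before_tG P \<gamma>. ennreal (Gbar P \<gamma> s * \<bar>f s\<bar>) \<partial>dG P \<gamma>) \<le> (\<integral>\<^sup>+s\<in>{0..r}. ennreal \<bar>f s\<bar> \<partial>dG P \<gamma>)"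
    using Gbar_nonneg Gbar_le_1 r
    by (intro nn_integral_mono) (auto simp: before_tG_def ennreal_less_iff intro!: ennreal_leI mult_left_le_one_le split: split_indicator)
  also have "\<dots> < \<infinity>"
    using f_L1_loc r by (simp add: L1_loc_def)
  finally show ?thesis using Type4I[OF L] by simp
qed

text \<open>On \<open>{\<gamma> < \<infinity>}\<close> the limit of the path is \<open>L\<close>. If \<open>L\<close> is integrable there and \<open>\<gamma> = \<infinity>\<close> has positive
probability, then \<open>F = (F * Gbar) / Gbar\<close> converges, because \<open>Gbar\<close> has a positive limit.\<close>

lemma Type1_iff:
  assumes A: "case_A P \<gamma>"
  shows "has_type P \<FF> M Type1 \<longleftrightarrow> (\<integral>\<^sup>+\<omega>. ennreal \<bar>L \<omega>\<bar> * indicator {\<omega>. \<gamma> \<omega> < \<infinity>} \<omega> \<partial>P) = \<infinity>"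
    (is "_ \<longleftrightarrow> ?L = \<infinity>")
proof
  assume inf: "?L = \<infinity>"
  have "?L \<le> (\<integral>\<^sup>+\<omega>. ennreal \<bar>terminal M \<omega>\<bar> \<partial>P)"
    using AE_terminal by (intro nn_integral_mono_AE) (auto elim!: eventually_mono split: split_indicator)
  with inf show "has_type P \<FF> M Type1" by (simp add: top_unique)
next
  assume type: "has_type P \<FF> M Type1"
  show "?L = \<infinity>"
  proof (rule ccontr)
    assume "?L \<noteq> \<infinity>"
    then have fin: "?L < \<infinity>" by (simp add: less_top)
    have "\<exists>l. AE \<omega> in P. \<gamma> \<omega> = \<infinity> \<longrightarrow> (F \<longlongrightarrow> l) at_top"
    proof (cases "prob {\<omega>\<in>space P. \<gamma> \<omega> = \<infinity>} = 0")
      case True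
      then have "AE \<omega> in P. \<gamma> \<omega> \<noteq> \<infinity>"
        by (subst (asm) prob_Collect_eq_0) auto
      then have "AE \<omega> in P. \<gamma> \<omega> = \<infinity> \<longrightarrow> (F \<longlongrightarrow> 0) at_top"
        by eventually_elim simp
      then show ?thesis by blast
    next
      case False
      have "t_G P \<gamma> = \<infinity>"
      proof (rule ccontr)
        assume "t_G P \<gamma> \<noteq> \<infinity>"
        with AE_le_tG have "AE \<omega> in P. \<gamma> \<omega> \<noteq> \<infinity>"
          by (auto elim!: eventually_mono simp: top_unique)
        then have "prob {\<omega>\<in>space P. \<gamma> \<omega> = \<infinity>} = 0"
          by (subst prob_Collect_eq_0) auto
        with False show False by simp
      qed
      then have to: "to_tG P \<gamma> = at_top" by (simp add: to_tG_def)
      have "((\<lambda>t. F t * Gbar P \<gamma> t / Gbar P \<gamma> t) \<longlongrightarrow> limit_loss / prob {\<omega>\<in>space P. \<gamma> \<omega> = \<infinity>}) (to_tG P \<gamma>)"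
        by (intro tendsto_divide F_Gbar_tendsto Gbar_tendsto A fin False)
      moreover have "\<forall>\<^sub>F t in to_tG P \<gamma>. F t * Gbar P \<gamma> t / Gbar P \<gamma> t = F t"
        unfolding eventually_to_tG using before_tG_iff zero_before_tG by (intro bexI[of _ 0]) auto
      ultimately have "(F \<longlongrightarrow> limit_loss / prob {\<omega>\<in>space P. \<gamma> \<omega> = \<infinity>}) at_top"
        unfolding to by (simp add: tendsto_cong)
      then show ?thesis by auto
    qed
    then obtain l where l: "AE \<omega> in P. \<gamma> \<omega> = \<infinity> \<longrightarrow> (F \<longlongrightarrow> l) at_top" by auto
    have lim: "AE \<omega> in P. ((\<lambda>t. M t \<omega>) \<longlongrightarrow> (if \<gamma> \<omega> = \<infinity> then l else L \<omega>)) at_top"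
      using AE_paths l
    proof eventually_elim
      case (elim \<omega>)
      show ?case
      proof (cases "\<gamma> \<omega> = \<infinity>")
        case True
        then have "\<forall>\<^sub>F t in at_top. M t \<omega> = F t"
          using elim by (auto simp: eventually_at_top_linorder intro!: exI[of _ 0])
        then show ?thesis using elim True by (simp add: tendsto_cong)
      next
        case False
        then show ?thesis using elim M_limit_if_finite[of \<omega>] by (simp add: less_top)
      qed
    qed
    then have "has_limit P M"
      unfolding has_limit_def by eventually_elim auto
    moreover have "(\<integral>\<^sup>+\<omega>. ennreal \<bar>terminal M \<omega>\<bar> \<partial>P) < \<infinity>"
    proof -
      have "(\<integral>\<^sup>+\<omega>. ennreal \<bar>terminal M \<omega>\<bar> \<partial>P) \<le> (\<integral>\<^sup>+\<omega>. ennreal \<bar>l\<bar> + ennreal \<bar>L \<omega>\<bar> * indicator {\<omega>. \<gamma> \<omega> < \<infinity>} \<omega> \<partial>P)"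
        using lim by (intro nn_integral_mono_AE)
          (auto elim!: eventually_mono dest!: terminal_eq simp: less_top split: split_indicator)
      also have "\<dots> = ennreal \<bar>l\<bar> + ?L"
        by (subst nn_integral_add) (measurable, simp add: emeasure_space_1)
      finally show ?thesis using fin by (simp add: ennreal_add_less_top le_less_trans)
    qed
    ultimately show False using type by simp
  qed
qed

text \<open>Since \<open>Gbar\<close> is bounded away from \<open>0\<close> and \<open>F * Gbar\<close> is bounded, \<open>F\<close> and \<open>F_left\<close> are bounded, hence
integrable with respect to the finite measure \<open>dG\<close>.\<close>

lemma Type4_if_infinite:
  assumes A: "case_A P \<gamma>" and p: "0 < prob {\<omega>\<in>space P. \<gamma> \<omega> = \<infinity>}"
    and L: "(\<integral>\<^sup>+\<omega>. ennreal \<bar>L \<omega>\<bar> * indicator {\<omega>. \<gamma> \<omega> < \<infinity>} \<omega> \<partial>P) < \<infinity>"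
  shows "has_type P \<FF> M Type4"
proof -
  let ?p = "prob {\<omega>\<in>space P. \<gamma> \<omega> = \<infinity>}"
  have H: "(\<integral>\<^sup>+s\<in>before_tG P \<gamma>. ennreal \<bar>H s\<bar> \<partial>dG P \<gamma>) < \<infinity>"
    using L L_finite_iff[OF A] by simp
  obtain C where C: "\<And>t. t \<in> before_tG P \<gamma> \<Longrightarrow> \<bar>F t * Gbar P \<gamma> t\<bar> \<le> C"
    using F_Gbar_bounded[OF L] by blast
  have F: "\<bar>F t\<bar> \<le> C / ?p" if t: "t \<in> before_tG P \<gamma>" for t
  proof -
    have "?p \<le> Gbar P \<gamma> t"
      unfolding Gbar_eq by (intro finite_measure_mono) auto
    then have "\<bar>F t\<bar> * ?p \<le> \<bar>F t\<bar> * Gbar P \<gamma> t" by (intro mult_left_mono) auto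
    also have "\<dots> \<le> C" using C[OF t] Gbar_nonneg[of t] by (simp add: abs_mult)
    finally show ?thesis using p by (simp add: pos_le_divide_eq)
  qed
  have "\<bar>F_left s\<bar> \<le> C / ?p" if s: "s \<in> before_tG P \<gamma>" "0 < s" for s
  proof (rule LIMSEQ_le_const2)
    show "(\<lambda>n. \<bar>F (s - s / real (Suc n))\<bar>) \<longlonglongrightarrow> \<bar>F_left s\<bar>"
      by (intro tendsto_rabs F_left_tendsto s)
    show "\<exists>N. \<forall>n\<ge>N. \<bar>F (s - s / real (Suc n))\<bar> \<le> C / ?p"
      using s by (intro exI[of _ 0] allI impI F before_tG_down[OF s(1)]) (auto simp: field_simps)
  qed
  then have "(\<integral>\<^sup>+s. ennreal \<bar>F_left s\<bar> * indicator ({0<..} \<inter> before_tG P \<gamma>) s \<partial>dG P \<gamma>) \<le>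
      (\<integral>\<^sup>+s. ennreal (C / ?p) \<partial>dG P \<gamma>)"
    by (intro nn_integral_mono) (auto split: split_indicator intro!: ennreal_leI)
  also have "\<dots> < \<infinity>"
    using dG.emeasure_finite[of UNIV] by (simp add: ennreal_mult_eq_top_iff less_top[symmetric])
  finally show ?thesis using Type4I[OF L] Gbar_f_finite_if_F_left[OF _ H] by simp
qed

end

locale sj_process_finite = sj_process +
  assumes case_A: "case_A P \<gamma>"
    and finite_jump: "prob {\<omega>\<in>space P. \<gamma> \<omega> = \<infinity>} = 0"
    and L_finite: "(\<integral>\<^sup>+\<omega>. ennreal \<bar>L \<omega>\<bar> * indicator {\<omega>. \<gamma> \<omega> < \<infinity>} \<omega> \<partial>P) < \<infinity>"
begin

lemma AE_finite_jump: "AE \<omega> in P. \<gamma> \<omega> < \<infinity>"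
proof -
  have "AE \<omega> in P. \<gamma> \<omega> \<noteq> \<infinity>"
    using finite_jump by (subst (asm) prob_Collect_eq_0) auto
  then show ?thesis by (simp add: less_top)
qed

lemma H_finite: "(\<integral>\<^sup>+s\<in>before_tG P \<gamma>. ennreal \<bar>H s\<bar> \<partial>dG P \<gamma>) < \<infinity>"
  using L_finite L_finite_iff[OF case_A] by simp

lemma integrable_L: "integrable P L"
  using AE_finite_jump
  by (intro integrable_cong_AE_imp[OF integrable_L_finite[OF L_finite]]) (auto elim!: eventually_mono)

lemma has_limit_M: "has_limit P M"
  unfolding has_limit_def using AE_paths AE_finite_jump
  by eventually_elim (auto intro!: exI M_limit_if_finite)

lemma AE_terminal_L: "AE \<omega> in P. terminal M \<omega> = L \<omega>"
  using AE_terminal AE_finite_jump by eventually_elim auto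

lemma integrable_L_jump: "integrable P (\<lambda>\<omega>. L \<omega> * indicator {\<omega>. s < \<gamma> \<omega>} \<omega>)"
  by (rule Bochner_Integration.integrable_bound[OF integrable_L])
    (measurable, auto intro!: AE_I2 split: split_indicator)

lemma expectation_L_jump:
  assumes s: "s \<in> before_tG P \<gamma>"
  shows "(LINT \<omega>|P. L \<omega> * indicator {\<omega>. ennreal s < \<gamma> \<omega>} \<omega>) = F s * Gbar P \<gamma> s - limit_loss"
proof -
  have s0: "0 \<le> s" using s by (simp add: before_tG_def)
  let ?X = "\<lambda>\<omega>. L \<omega> * indicator {\<omega>. ennreal 0 < \<gamma> \<omega> \<and> \<gamma> \<omega> \<le> ennreal s} \<omega>"
  have IX: "integrable P ?X"
    by (rule Bochner_Integration.integrable_bound[OF integrable_L])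
      (measurable, auto intro!: AE_I2 split: split_indicator)
  have "(LINT \<omega>|P. L \<omega> * indicator {\<omega>. 0 < \<gamma> \<omega> \<and> \<gamma> \<omega> < \<infinity>} \<omega>) =
      (LINT \<omega>|P. ?X \<omega> + L \<omega> * indicator {\<omega>. ennreal s < \<gamma> \<omega>} \<omega>)"
  proof (rule integral_cong_AE)
    show "AE \<omega> in P. L \<omega> * indicator {\<omega>. 0 < \<gamma> \<omega> \<and> \<gamma> \<omega> < \<infinity>} \<omega> =
        ?X \<omega> + L \<omega> * indicator {\<omega>. ennreal s < \<gamma> \<omega>} \<omega>"
      using AE_finite_jump
      by eventually_elim (auto split: split_indicator simp: not_le intro: le_less_trans[OF zero_le])
  qed measurable
  also have "\<dots> = (F 0 * Gbar P \<gamma> 0 - F s * Gbar P \<gamma> s) + (LINT \<omega>|P. L \<omega> * indicator {\<omega>. ennreal s < \<gamma> \<omega>} \<omega>)"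
    using expectation_L[OF s order_refl s0] IX integrable_L_jump by simp
  finally show ?thesis by (simp add: limit_loss_def)
qed

abbreviation X :: "ennreal \<Rightarrow> 'a \<Rightarrow> real" where
  "X \<equiv> closed_process M"

lemma AE_X_eq: "AE \<omega> in P. X t \<omega> = (if t < \<gamma> \<omega> then F (enn2real t) else L \<omega>)"
proof (cases "t = \<infinity>")
  case True
  then show ?thesis using AE_terminal_L by (simp add: closed_process_def)
next
  case False
  from AE_paths show ?thesis
  proof eventually_elim
    case (elim \<omega>)
    from False elim show ?case
      by (cases t) (auto simp: closed_process_def not_less)
  qed
qed

lemma X_measurable: "X t \<in> borel_measurable (\<FF> t)"
proof (cases t)
  case (real r)
  then show ?thesis using M_measurable[of r] by (simp add: closed_process_def)
next
  case top
  then show ?thesis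
    using measurable_sj_top[OF terminal_measurable] by (simp add: closed_process_def)
qed

lemma X_measurable' [measurable]: "X t \<in> borel_measurable P"
  by (rule measurable_from_sj[OF X_measurable])

lemma integrable_X: "integrable P (X t)"
proof (rule Bochner_Integration.integrable_bound)
  show "integrable P (\<lambda>\<omega>. \<bar>F (enn2real t)\<bar> + \<bar>L \<omega>\<bar>)"
    using integrable_L by simp
  show "AE \<omega> in P. norm (X t \<omega>) \<le> norm (\<bar>F (enn2real t)\<bar> + \<bar>L \<omega>\<bar>)"
    using AE_X_eq[of t] by eventually_elim auto
qed measurable

text \<open>From \<open>t_G\<close> on the process equals \<open>L\<close>, and the mean over \<open>{s < \<gamma>}\<close> drops by the loss.\<close>

lemma expectation_X_jump:
  assumes "s \<in> before_tG P \<gamma>" and "ennreal s \<le> t"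
  shows "(LINT \<omega>|P. X t \<omega> * indicator {\<omega>. ennreal s < \<gamma> \<omega>} \<omega>) =
    F s * Gbar P \<gamma> s - (if t < t_G P \<gamma> then 0 else limit_loss)"
proof (cases "t < t_G P \<gamma>")
  case True
  then obtain r where r: "t = ennreal r" "0 \<le> r" by (cases t) auto
  with assms True have "r \<in> before_tG P \<gamma>" "0 \<le> s" "s \<le> r" by (auto simp: before_tG_def)
  from expectation_M_jump[OF this] show ?thesis
    using True r by (simp add: closed_process_def)
next
  case False
  have "(LINT \<omega>|P. X t \<omega> * indicator {\<omega>. ennreal s < \<gamma> \<omega>} \<omega>) = (LINT \<omega>|P. L \<omega> * indicator {\<omega>. ennreal s < \<gamma> \<omega>} \<omega>)"
  proof (rule integral_cong_AE)
    show "AE \<omega> in P. X t \<omega> * indicator {\<omega>. ennreal s < \<gamma> \<omega>} \<omega> = L \<omega> * indicator {\<omega>. ennreal s < \<gamma> \<omega>} \<omega>"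
      using AE_X_eq[of t] AE_le_tG
    proof eventually_elim
      case (elim \<omega>)
      then have "\<not> t < \<gamma> \<omega>" using False by auto
      with elim show ?case by simp
    qed
  qed measurable
  with expectation_L_jump[OF assms(1)] False show ?thesis by simp
qed

text \<open>The factor \<open>q\<close> is \<open>0\<close> as long as \<open>t < t_G\<close>, and \<open>1 / P(s < \<gamma>)\<close> if \<open>s < t_G \<le> t\<close>; the sign of the loss
alone decides between supermartingale, submartingale and martingale.\<close>

lemma cond_exp_X:
  assumes st: "s \<le> t"
  shows "\<exists>q\<ge>0. AE \<omega> in P. real_cond_exp P (\<FF> s) (X t) \<omega> = X s \<omega> - limit_loss * q * indicator {\<omega>. s < \<gamma> \<omega>} \<omega>"
proof -
  have "AE \<omega> in P. \<gamma> \<omega> \<le> s \<longrightarrow> X t \<omega> = X s \<omega>"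
    using AE_X_eq[of t] AE_X_eq[of s]
  proof eventually_elim
    case (elim \<omega>)
    with st show ?case using order_trans[of "\<gamma> \<omega>" s t] by (auto simp: not_less)
  qed
  note * = real_cond_exp_sj[OF integrable_X integrable_X X_measurable this]
  show ?thesis
  proof (cases "s < t_G P \<gamma>")
    case True
    then obtain r where r: "s = ennreal r" "0 \<le> r" by (cases s) auto
    with True have b: "r \<in> before_tG P \<gamma>" by (simp add: before_tG_def)
    define q where "q = (if t < t_G P \<gamma> then 0 else 1 / prob {\<omega>\<in>space P. s < \<gamma> \<omega>})"
    have "0 \<le> q" by (simp add: q_def)
    moreover have "((LINT \<omega>|P. X t \<omega> * indicator {\<omega>. s < \<gamma> \<omega>} \<omega>) - (LINT \<omega>|P. X s \<omega> * indicator {\<omega>. s < \<gamma> \<omega>} \<omega>)) /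
        prob {\<omega>\<in>space P. s < \<gamma> \<omega>} = - limit_loss * q"
      using expectation_X_jump[OF b] st True unfolding r by (simp add: q_def r)
    ultimately show ?thesis using * by (intro exI[of _ q]) simp
  next
    case False
    have "AE \<omega> in P. \<not> s < \<gamma> \<omega>"
      using AE_le_tG False by (auto elim!: eventually_mono)
    then have "prob {\<omega>\<in>space P. s < \<gamma> \<omega>} = 0"
      by (subst prob_Collect_eq_0) auto
    then show ?thesis using * by (intro exI[of _ 0]) simp
  qed
qed

lemma expectation_terminal: "(LINT \<omega>|P. terminal M \<omega>) = (LINT \<omega>|P. M 0 \<omega>) - limit_loss"
proof -
  have IX: "integrable P (\<lambda>\<omega>. X t \<omega> * indicator {\<omega>. ennreal 0 < \<gamma> \<omega>} \<omega>)" for t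
    by (rule Bochner_Integration.integrable_bound[OF integrable_X[of t]])
      (measurable, auto intro!: AE_I2 split: split_indicator)
  have "(LINT \<omega>|P. X \<infinity> \<omega> - X 0 \<omega>) =
      (LINT \<omega>|P. X \<infinity> \<omega> * indicator {\<omega>. ennreal 0 < \<gamma> \<omega>} \<omega> - X 0 \<omega> * indicator {\<omega>. ennreal 0 < \<gamma> \<omega>} \<omega>)"
    using AE_X_eq[of 0] AE_X_eq[of \<infinity>]
    by (intro integral_cong_AE) (measurable, auto elim!: eventually_elim2 split: split_indicator)
  then have "(LINT \<omega>|P. X \<infinity> \<omega>) - (LINT \<omega>|P. X 0 \<omega>) = - limit_loss"
    using expectation_X_jump[OF zero_before_tG, of 0] expectation_X_jump[OF zero_before_tG, of \<infinity>] tG_pos IX integrable_X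
    by simp
  then show ?thesis by (simp add: closed_process_def)
qed

lemma closed_supermartingale_if_positive_loss:
  assumes "0 < limit_loss"
  shows "closed_supermartingale P \<FF> M"
  unfolding closed_supermartingale_def supermartingale_def adapted_def
proof (intro conjI ballI impI has_limit_M X_measurable integrable_X)
  fix s t :: ennreal assume "s \<le> t"
  from cond_exp_X[OF this] obtain q where q: "0 \<le> q"
    "AE \<omega> in P. real_cond_exp P (\<FF> s) (X t) \<omega> = X s \<omega> - limit_loss * q * indicator {\<omega>. s < \<gamma> \<omega>} \<omega>" by auto
  from q(2) show "AE \<omega> in P. real_cond_exp P (\<FF> s) (X t) \<omega> \<le> X s \<omega>"
  proof eventually_elim
    case (elim \<omega>)
    with assms q(1) show ?case by (auto split: split_indicator)
  qed
qed

lemma closed_submartingale_if_negative_loss: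
  assumes "limit_loss < 0"
  shows "closed_submartingale P \<FF> M"
  unfolding closed_submartingale_def submartingale_def adapted_def
proof (intro conjI ballI impI has_limit_M X_measurable integrable_X)
  fix s t :: ennreal assume "s \<le> t"
  from cond_exp_X[OF this] obtain q where q: "0 \<le> q"
    "AE \<omega> in P. real_cond_exp P (\<FF> s) (X t) \<omega> = X s \<omega> - limit_loss * q * indicator {\<omega>. s < \<gamma> \<omega>} \<omega>" by auto
  from q(2) show "AE \<omega> in P. X s \<omega> \<le> real_cond_exp P (\<FF> s) (X t) \<omega>"
  proof eventually_elim
    case (elim \<omega>)
    with assms q(1) show ?case by (auto split: split_indicator simp: mult_nonpos_nonneg)
  qed
qed

lemma martingale_if_no_loss:
  assumes "limit_loss = 0"
  shows "martingale P (\<lambda>t. \<FF> (ennreal t)) {0..} M"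
proof -
  have X: "X (ennreal t) = M t" if "0 \<le> t" for t
    using that by (simp add: closed_process_def)
  show ?thesis
    unfolding martingale_def
  proof (intro conjI ballI impI adapted_M)
    fix t :: real assume "t \<in> {0..}"
    then show "integrable P (M t)" using integrable_X[of "ennreal t"] X[of t] by simp
  next
    fix s t :: real assume st: "s \<in> {0..}" "t \<in> {0..}" "s \<le> t"
    with cond_exp_X[of "ennreal s" "ennreal t"] X[of s] X[of t] assms
    show "AE \<omega> in P. real_cond_exp P (\<FF> (ennreal s)) (M t) \<omega> = M s \<omega>"
      by (auto simp: ennreal_leI)
  qed
qed

text \<open>The contribution of \<open>{t < \<gamma>}\<close> to the tail of \<open>M t\<close> beyond \<open>c\<close> is \<open>|F t| * Gbar t\<close> if \<open>|F t| > c\<close> and \<open>0\<close>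
otherwise. Without loss it is small near \<open>t_G\<close>, while away from \<open>t_G\<close> it vanishes for large \<open>c\<close> as \<open>F\<close> is
locally bounded. With loss, \<open>|F t|\<close> tends to infinity since \<open>Gbar\<close> tends to \<open>0\<close>, so some such
contribution exceeds half of the absolute loss for every \<open>c\<close>.\<close>

lemma uniformly_integrable_iff: "uniformly_integrable P {0..} M \<longleftrightarrow> limit_loss = 0"
proof
  assume 0: "limit_loss = 0"
  show "uniformly_integrable P {0..} M"
  proof (rule uniformly_integrableI)
    fix \<epsilon> :: real assume \<epsilon>: "0 < \<epsilon>"
    then have "\<forall>\<^sub>F c in at_top. (\<integral>\<^sup>+\<omega>. ennreal \<bar>L \<omega>\<bar> * indicator {\<omega>. c < \<bar>L \<omega>\<bar>} \<omega> \<partial>P) < ennreal (\<epsilon> / 2)"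
      using tendsto_nn_integral_tail_0[OF integrable_L] by (simp add: order_tendsto_iff)
    then obtain c1 where c1: "\<And>c. c1 \<le> c \<Longrightarrow>
        (\<integral>\<^sup>+\<omega>. ennreal \<bar>L \<omega>\<bar> * indicator {\<omega>. c < \<bar>L \<omega>\<bar>} \<omega> \<partial>P) < ennreal (\<epsilon> / 2)"
      by (auto simp: eventually_at_top_linorder)
    have "((\<lambda>t. F t * Gbar P \<gamma> t) \<longlongrightarrow> 0) (to_tG P \<gamma>)"
      using F_Gbar_tendsto[OF case_A L_finite] 0 by simp
    from tendstoD[OF this, of "\<epsilon> / 2"] \<epsilon>
    have "\<forall>\<^sub>F t in to_tG P \<gamma>. \<bar>F t * Gbar P \<gamma> t\<bar> < \<epsilon> / 2"
      by (simp only: dist_real_def diff_0_right)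
    then obtain b where b: "b \<in> before_tG P \<gamma>"
        "\<And>t. t \<in> before_tG P \<gamma> \<Longrightarrow> b < t \<Longrightarrow> \<bar>F t * Gbar P \<gamma> t\<bar> < \<epsilon> / 2"
      unfolding eventually_to_tG by blast
    define B where "B = \<bar>F 0\<bar> + (LINT r|dG P \<gamma>. indicator {0<..b} r * \<bar>f0 r\<bar>)"
    have B: "\<bar>F t\<bar> \<le> B" if "0 \<le> t" "t \<le> b" for t
      unfolding B_def by (rule F_bound[OF b(1) that])
    show "\<exists>c0. \<forall>c\<ge>c0. \<forall>t\<in>{0..}.
      (\<integral>\<^sup>+\<omega>. ennreal \<bar>M t \<omega>\<bar> * indicator {\<omega>. c < \<bar>M t \<omega>\<bar>} \<omega> \<partial>P) \<le> ennreal \<epsilon>"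
    proof (intro exI allI ballI impI)
      fix c t :: real assume c: "max c1 B \<le> c" and "t \<in> {0..}"
      then have t: "0 \<le> t" by simp
      define k where "k = (if c < \<bar>F t\<bar> then \<bar>F t\<bar> else 0)"
      have "(\<integral>\<^sup>+\<omega>. ennreal \<bar>M t \<omega>\<bar> * indicator {\<omega>. c < \<bar>M t \<omega>\<bar>} \<omega> \<partial>P) \<le>
          (\<integral>\<^sup>+\<omega>. ennreal k * indicator {\<omega>\<in>space P. ennreal t < \<gamma> \<omega>} \<omega> + ennreal \<bar>L \<omega>\<bar> * indicator {\<omega>. c < \<bar>L \<omega>\<bar>} \<omega> \<partial>P)"
      proof (rule nn_integral_mono_AE)
        show "AE \<omega> in P. ennreal \<bar>M t \<omega>\<bar> * indicator {\<omega>. c < \<bar>M t \<omega>\<bar>} \<omega> \<le>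
          ennreal k * indicator {\<omega>\<in>space P. ennreal t < \<gamma> \<omega>} \<omega> + ennreal \<bar>L \<omega>\<bar> * indicator {\<omega>. c < \<bar>L \<omega>\<bar>} \<omega>"
          using AE_paths AE_space
        proof eventually_elim
          case (elim \<omega>)
          with t show ?case
            by (cases "ennreal t < \<gamma> \<omega>") (auto simp: k_def not_less split: split_indicator)
        qed
      qed
      also have "\<dots> = ennreal k * ennreal (Gbar P \<gamma> t) +
          (\<integral>\<^sup>+\<omega>. ennreal \<bar>L \<omega>\<bar> * indicator {\<omega>. c < \<bar>L \<omega>\<bar>} \<omega> \<partial>P)"
        by (subst nn_integral_add) (auto simp: nn_integral_cmult_indicator Gbar_eq emeasure_eq_measure)
      also have "\<dots> \<le> ennreal (\<epsilon> / 2) + ennreal (\<epsilon> / 2)"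
      proof (rule add_mono)
        have "k * Gbar P \<gamma> t \<le> \<epsilon> / 2"
        proof (cases "t \<in> before_tG P \<gamma>")
          case True
          show ?thesis
          proof (cases "t \<le> b")
            case True
            with B[OF t] c \<epsilon> show ?thesis by (simp add: k_def)
          next
            case False
            with b(2)[OF True] Gbar_nonneg[of t] \<epsilon> show ?thesis by (simp add: k_def abs_mult)
          qed
        next
          case False
          then have "Gbar P \<gamma> t = 0" using t before_tG_iff[of t] Gbar_nonneg[of t] by auto
          with \<epsilon> show ?thesis by simp
        qed
        then show "ennreal k * ennreal (Gbar P \<gamma> t) \<le> ennreal (\<epsilon> / 2)"
          using Gbar_nonneg[of t] by (simp add: ennreal_mult[symmetric] k_def ennreal_leI)
      qed (use c1[of c] c in auto)
      also have "\<dots> = ennreal \<epsilon>"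
        using \<epsilon> by (simp add: ennreal_plus[symmetric] del: ennreal_plus)
      finally show "(\<integral>\<^sup>+\<omega>. ennreal \<bar>M t \<omega>\<bar> * indicator {\<omega>. c < \<bar>M t \<omega>\<bar>} \<omega> \<partial>P) \<le> ennreal \<epsilon>" .
    qed
  qed
next
  assume ui: "uniformly_integrable P {0..} M"
  show "limit_loss = 0"
  proof (rule ccontr)
    assume l: "limit_loss \<noteq> 0"
    then have "0 < \<bar>limit_loss\<bar> / 2" by simp
    from uniformly_integrableD[OF ui this] obtain c where c: "\<And>t. 0 \<le> t \<Longrightarrow>
        (\<integral>\<^sup>+\<omega>. ennreal \<bar>M t \<omega>\<bar> * indicator {\<omega>. c < \<bar>M t \<omega>\<bar>} \<omega> \<partial>P) < ennreal (\<bar>limit_loss\<bar> / 2)"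
      by (metis atLeast_iff)
    have "((\<lambda>t. \<bar>F t * Gbar P \<gamma> t\<bar>) \<longlongrightarrow> \<bar>limit_loss\<bar>) (to_tG P \<gamma>)"
      by (intro tendsto_rabs F_Gbar_tendsto case_A L_finite)
    moreover have "\<bar>limit_loss\<bar> / 2 < \<bar>limit_loss\<bar>" using l by simp
    ultimately have 1: "\<forall>\<^sub>F t in to_tG P \<gamma>. \<bar>limit_loss\<bar> / 2 < \<bar>F t * Gbar P \<gamma> t\<bar>"
      by (rule order_tendstoD)
    have "((\<lambda>t. \<bar>c\<bar> * Gbar P \<gamma> t) \<longlongrightarrow> \<bar>c\<bar> * 0) (to_tG P \<gamma>)"
      using Gbar_tendsto[OF case_A] finite_jump by (intro tendsto_intros) simp
    from order_tendstoD(2)[OF this, of "\<bar>limit_loss\<bar> / 2"] l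
    have 2: "\<forall>\<^sub>F t in to_tG P \<gamma>. \<bar>c\<bar> * Gbar P \<gamma> t < \<bar>limit_loss\<bar> / 2"
      by simp
    have 3: "\<forall>\<^sub>F t in to_tG P \<gamma>. 0 \<le> t"
      unfolding eventually_to_tG using zero_before_tG by (intro bexI[of _ 0]) auto
    obtain t where t: "\<bar>limit_loss\<bar> / 2 < \<bar>F t * Gbar P \<gamma> t\<bar>" "\<bar>c\<bar> * Gbar P \<gamma> t < \<bar>limit_loss\<bar> / 2" "0 \<le> t"
      using eventually_happens'[OF to_tG_neq_bot eventually_conj[OF 1 eventually_conj[OF 2 3]]] by auto
    have "\<bar>c\<bar> * Gbar P \<gamma> t < \<bar>F t\<bar> * Gbar P \<gamma> t"
      using t Gbar_nonneg[of t] by (simp add: abs_mult)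
    then have cF: "c < \<bar>F t\<bar>"
      using Gbar_nonneg[of t] by (meson abs_ge_self le_less_trans mult_right_less_imp_less)
    have "ennreal (\<bar>limit_loss\<bar> / 2) \<le> ennreal (\<bar>F t\<bar> * Gbar P \<gamma> t)"
      using t Gbar_nonneg[of t] by (intro ennreal_leI) (simp add: abs_mult)
    also have "\<dots> = (\<integral>\<^sup>+\<omega>. ennreal \<bar>F t\<bar> * indicator {\<omega>\<in>space P. ennreal t < \<gamma> \<omega>} \<omega> \<partial>P)"
      using Gbar_nonneg[of t] by (subst nn_integral_cmult_indicator) (auto simp: ennreal_mult Gbar_eq emeasure_eq_measure)
    also have "\<dots> \<le> (\<integral>\<^sup>+\<omega>. ennreal \<bar>M t \<omega>\<bar> * indicator {\<omega>. c < \<bar>M t \<omega>\<bar>} \<omega> \<partial>P)"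
    proof (rule nn_integral_mono_AE)
      show "AE \<omega> in P. ennreal \<bar>F t\<bar> * indicator {\<omega>\<in>space P. ennreal t < \<gamma> \<omega>} \<omega> \<le>
          ennreal \<bar>M t \<omega>\<bar> * indicator {\<omega>. c < \<bar>M t \<omega>\<bar>} \<omega>"
        using AE_paths
      proof eventually_elim
        case (elim \<omega>)
        with cF t(3) show ?case by (auto split: split_indicator)
      qed
    qed
    finally show False using c[OF t(3)] by simp
  qed
qed

lemma Type2a_iff: "has_type P \<FF> M Type2a \<longleftrightarrow> 0 < limit_loss"
  using closed_supermartingale_if_positive_loss expectation_terminal by auto

lemma Type2b_iff: "has_type P \<FF> M Type2b \<longleftrightarrow> limit_loss < 0"
  using closed_submartingale_if_negative_loss expectation_terminal by auto

lemma Type4_iff: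
  "has_type P \<FF> M Type4 \<longleftrightarrow> (\<integral>\<^sup>+s\<in>before_tG P \<gamma>. ennreal (Gbar P \<gamma> s * \<bar>f s\<bar>) \<partial>dG P \<gamma>) < \<infinity>"
  using Type4I[OF L_finite] Gbar_f_finite_if_sup[OF case_A _ H_finite] le_less_trans[OF sup_le_variation]
  by auto

text \<open>The supremum is integrable exactly when the variation is, by the two bounds on the integral of
\<open>Gbar * |f|\<close>.\<close>

lemma Type3_iff: "has_type P \<FF> M Type3 \<longleftrightarrow> limit_loss = 0 \<and>
    (\<integral>\<^sup>+s\<in>before_tG P \<gamma>. ennreal (Gbar P \<gamma> s * \<bar>f s\<bar>) \<partial>dG P \<gamma>) = \<infinity>" (is "_ \<longleftrightarrow> _ \<and> ?I = \<infinity>")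
proof -
  have "(\<integral>\<^sup>+\<omega>. (SUP t\<in>{0..}. ennreal \<bar>M t \<omega>\<bar>) \<partial>P) < \<infinity> \<longleftrightarrow> ?I < \<infinity>"
    using Type4I[OF L_finite] Gbar_f_finite_if_sup[OF case_A _ H_finite] le_less_trans[OF sup_le_variation] by auto
  then have "(\<integral>\<^sup>+\<omega>. (SUP t\<in>{0..}. ennreal \<bar>M t \<omega>\<bar>) \<partial>P) = \<infinity> \<longleftrightarrow> ?I = \<infinity>"
    by (simp add: less_top[symmetric])
  then show ?thesis
    using martingale_if_no_loss uniformly_integrable_iff by (auto simp: ui_martingale_def)
qed

lemma F_Gbar_tendsto_iff: "((\<lambda>t. F t * Gbar P \<gamma> t) \<longlongrightarrow> l) (to_tG P \<gamma>) \<longleftrightarrow> l = limit_loss"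
  using F_Gbar_tendsto[OF case_A L_finite] tendsto_unique[OF to_tG_neq_bot] by blast

end

section \<open>Examples with an exponential jump time\<close>

lemma cadlag_single_jump:
  fixes x F :: "real \<Rightarrow> real" and g :: ennreal
  assumes before: "\<And>t. 0 \<le> t \<Longrightarrow> ennreal t < g \<Longrightarrow> x t = F t"
    and after: "\<And>t. 0 \<le> t \<Longrightarrow> g \<le> ennreal t \<Longrightarrow> x t = c"
    and F: "\<And>t. 0 \<le> t \<Longrightarrow> isCont F t"
  shows "cadlag x"
  unfolding cadlag_def
proof (intro conjI allI impI)
  fix t :: real assume t: "0 \<le> t"
  show "continuous (at_right t) x"
  proof (cases "ennreal t < g")
    case True
    obtain r where r: "t < r" "\<And>s. 0 \<le> s \<Longrightarrow> s < r \<Longrightarrow> ennreal s < g"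
    proof (cases g)
      case (real y)
      with t True that[of y] show ?thesis by (auto simp: ennreal_less_iff)
    next
      case top
      with that[of "t + 1"] show ?thesis by auto
    qed
    have "\<forall>\<^sub>F s in at_right t. F s = x s"
      by (rule eventually_at_rightI[OF _ r(1)]) (use before r(2) t in auto)
    moreover have "(F \<longlongrightarrow> F t) (at_right t)"
      using F[OF t] unfolding isCont_def by (rule tendsto_mono[OF at_le, rotated]) simp
    ultimately have "(x \<longlongrightarrow> F t) (at_right t)"
      by (rule Lim_transform_eventually[rotated])
    with before[OF t True] show ?thesis by (simp add: continuous_within)
  next
    case False
    then have g: "g \<le> ennreal t" by (simp add: not_less)
    have "x s = c" if "t < s" for s
      by (rule after) (use that t order_trans[OF g ennreal_leI] in auto)
    then have "\<forall>\<^sub>F s in at_right t. x s = c"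
      by (intro eventually_at_rightI[of t "t + 1"]) auto
    with after[OF t g] show ?thesis by (simp add: continuous_within tendsto_eventually)
  qed
next
  fix t :: real assume t: "0 < t"
  show "\<exists>l. (x \<longlongrightarrow> l) (at_left t)"
  proof (cases "ennreal t \<le> g")
    case True
    have "\<forall>\<^sub>F s in at_left t. F s = x s"
    proof (rule eventually_at_leftI[OF _ t])
      fix s assume s: "s \<in> {0<..<t}"
      then have "ennreal s < ennreal t" by (simp add: ennreal_less_iff)
      with True s before[of s] show "F s = x s" by simp
    qed
    moreover have "(F \<longlongrightarrow> F t) (at_left t)"
      using F[OF less_imp_le[OF t]] unfolding isCont_def by (rule tendsto_mono[OF at_le, rotated]) simp
    ultimately have "(x \<longlongrightarrow> F t) (at_left t)"
      by (rule Lim_transform_eventually[rotated])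
    then show ?thesis ..
  next
    case False
    then obtain r where r: "g = ennreal r" "0 \<le> r" "r < t"
      by (cases g) (auto simp: not_le ennreal_less_iff)
    have "\<forall>\<^sub>F s in at_left t. x s = c"
      by (rule eventually_at_leftI[OF _ r(3)]) (use after r in \<open>auto simp: ennreal_leI\<close>)
    then show ?thesis by (intro exI[of _ c] tendsto_eventually)
  qed
qed

context sj_process
begin

text \<open>The constant times \<open>n\<close> localize: up to time \<open>n < t_G\<close> the process is a martingale, dominated by a bound
of \<open>F\<close> on \<open>[0,n]\<close> plus \<open>|L|\<close> on \<open>{\<gamma> \<le> n}\<close>.\<close>

lemma local_martingale_if_tG_top:
  assumes top: "t_G P \<gamma> = \<infinity>" and F: "\<And>t. 0 \<le> t \<Longrightarrow> isCont F t"
  shows "local_martingale P \<FF> M"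
  unfolding local_martingale_def
proof (intro conjI adapted_M exI[of _ "\<lambda>n _. of_nat n"] allI)
  have b: "t \<in> before_tG P \<gamma>" if "0 \<le> t" for t
    using that top by (simp add: before_tG_def)
  show "AE \<omega> in P. cadlag (\<lambda>t. M t \<omega>)"
    using AE_paths by eventually_elim (rule cadlag_single_jump[OF _ _ F], auto)
  show "stopping_time \<FF> (\<lambda>_. of_nat n)" for n
    by (rule stopping_time_const)
  show "AE \<omega> in P. incseq (\<lambda>n. of_nat n :: ennreal) \<and> (\<lambda>n. of_nat n :: ennreal) \<longlonglongrightarrow> \<infinity>"
    by (simp add: of_nat_tendsto_top_ennreal incseq_def)
  fix n :: nat
  have S: "stopped M (\<lambda>_. of_nat n) t = M (min t (real n))" if "0 \<le> t" for t
  proof -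
    have "min (ennreal t) (of_nat n) = ennreal (min t (real n))"
      using that by (simp add: ennreal_of_nat_eq_real_of_nat min_def)
    with that show ?thesis by (simp add: stopped_def fun_eq_iff)
  qed
  have Sm: "M (min t (real n)) \<in> borel_measurable (\<FF> (ennreal t))" if "0 \<le> t" for t
  proof -
    have "sets (\<FF> (ennreal (min t (real n)))) \<subseteq> sets (\<FF> (ennreal t))"
      by (intro filtration.sets_F_mono[OF filtration_sj_filtration] ennreal_leI) simp
    then have "subalgebra (\<FF> (ennreal t)) (\<FF> (ennreal (min t (real n))))"
      by (simp add: subalgebra_def space_sj_filtration)
    from measurable_from_subalg[OF this M_measurable] that show ?thesis by simp
  qed
  show "ui_martingale P \<FF> (stopped M (\<lambda>_. of_nat n))"
    unfolding ui_martingale_def martingale_def adapted_def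
  proof (intro conjI ballI impI)
    fix t :: real assume "t \<in> {0..}"
    then have t: "0 \<le> t" by simp
    show "stopped M (\<lambda>_. of_nat n) t \<in> borel_measurable (\<FF> (ennreal t))"
      using Sm[OF t] by (simp add: S[OF t])
    show "integrable P (stopped M (\<lambda>_. of_nat n) t)"
      unfolding S[OF t] using t by (intro integrable_M b) simp
  next
    fix s t :: real assume "s \<in> {0..}" "t \<in> {0..}" and st: "s \<le> t"
    then have s: "0 \<le> s" and t: "0 \<le> t" by auto
    show "AE \<omega> in P. real_cond_exp P (\<FF> (ennreal s)) (stopped M (\<lambda>_. of_nat n) t) \<omega> =
        stopped M (\<lambda>_. of_nat n) s \<omega>"
    proof (cases "s \<le> real n")
      case True
      then show ?thesis
        unfolding S[OF s] S[OF t] using s t st cond_exp_M[OF b, of "min t (real n)" s] by simp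
    next
      case False
      interpret S: finite_measure_subalgebra P "\<FF> (ennreal s)"
        by unfold_locales (rule subalgebra_sj)
      have "AE \<omega> in P. real_cond_exp P (\<FF> (ennreal s)) (M (min s (real n))) \<omega> = M (min s (real n)) \<omega>"
        using s by (intro S.real_cond_exp_F_meas integrable_M b Sm) auto
      with False st show ?thesis unfolding S[OF s] S[OF t] by (simp add: min_def split: if_splits)
    qed
  next
    have nT: "real n \<in> TT P \<gamma>" using b[of "real n"] before_tG_subset_TT by auto
    let ?B = "\<bar>F 0\<bar> + (LINT r|dG P \<gamma>. indicator {0<..real n} r * \<bar>f0 r\<bar>)"
    let ?D = "\<lambda>\<omega>. ?B + \<bar>L \<omega> * indicator {\<omega>. \<gamma> \<omega> \<le> ennreal (real n)} \<omega>\<bar>"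
    have "integrable P ?D"
      using integrable_L_le[OF nT] by (intro Bochner_Integration.integrable_add integrable_const integrable_abs)
    then show "uniformly_integrable P {0..} (stopped M (\<lambda>_. of_nat n))"
    proof (rule uniformly_integrable_dominated)
      fix t :: real assume "t \<in> {0..}"
      then have t: "0 \<le> t" by simp
      let ?t = "min t (real n)"
      have F: "\<bar>F ?t\<bar> \<le> ?B" using t by (intro F_bound b) auto
      from AE_paths show "AE \<omega> in P. \<bar>stopped M (\<lambda>_. of_nat n) t \<omega>\<bar> \<le> ?D \<omega>"
        unfolding S[OF t]
      proof eventually_elim
        case (elim \<omega>)
        show ?case
        proof (cases "ennreal ?t < \<gamma> \<omega>")
          case True
          with elim t have "M ?t \<omega> = F ?t" by auto
          moreover have "\<bar>F ?t\<bar> \<le> ?D \<omega>" using F by linarith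
          ultimately show ?thesis by simp
        next
          case False
          then have g: "\<gamma> \<omega> \<le> ennreal ?t" by (simp add: not_less)
          with elim t have "M ?t \<omega> = L \<omega>" by auto
          moreover have "\<gamma> \<omega> \<le> ennreal (real n)"
            by (rule order_trans[OF g]) (simp add: ennreal_leI)
          moreover have "0 \<le> ?B" using F by linarith
          ultimately show ?thesis by simp
        qed
      qed
    qed
  qed
qed

end

definition exp_law :: "real measure" where
  "exp_law = density lborel (exponential_density 1)"

lemma sets_exp_law [simp, measurable_cong]: "sets exp_law = sets borel"
  and space_exp_law [simp]: "space exp_law = UNIV"
  by (simp_all add: exp_law_def)

interpretation exp_law: prob_space exp_law
  unfolding exp_law_def by (rule prob_space_exponential_density) simp

lemma prob_exp_law_greater:
  assumes "0 \<le> t"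
  shows "exp_law.prob {x. ennreal t < ennreal x} = exp (- t)"
proof -
  have "distributed exp_law lborel (\<lambda>x. x) (exponential_density 1)"
    unfolding distributed_def
  proof (intro conjI)
    show "distr exp_law lborel (\<lambda>x. x) = density lborel (\<lambda>x. ennreal (exponential_density 1 x))"
      by (simp add: distr_id2 exp_law_def)
    show "(\<lambda>x. x) \<in> measurable exp_law lborel"
      by (rule measurable_ident_sets) simp
  qed measurable
  from exp_law.exponential_distributedD_gt[OF this assms] show ?thesis
    using assms by (simp add: ennreal_less_iff)
qed

interpretation exp_jump: single_jump exp_law ennreal
  by unfold_locales (use prob_exp_law_greater[of 0] in auto)

lemma Gbar_exp_law: "0 \<le> t \<Longrightarrow> Gbar exp_law ennreal t = exp (- t)"
  using exp_jump.Gbar_eq[of t] prob_exp_law_greater[of t] by simp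

lemma before_tG_exp_law: "before_tG exp_law ennreal = {0..}"
  by (auto simp: exp_jump.before_tG_iff Gbar_exp_law)

lemma TT_exp_law: "TT exp_law ennreal = {0..}"
  using exp_jump.before_tG_subset_TT by (auto simp: before_tG_exp_law TT_def)

lemma tG_exp_law: "t_G exp_law ennreal = \<infinity>"
proof (rule ccontr)
  assume "t_G exp_law ennreal \<noteq> \<infinity>"
  then obtain r where "t_G exp_law ennreal = ennreal r" "0 \<le> r" by (cases "t_G exp_law ennreal") auto
  then have "r \<notin> before_tG exp_law ennreal" by (simp add: before_tG_def)
  with \<open>0 \<le> r\<close> show False by (simp add: before_tG_exp_law)
qed

lemma nn_integral_dG_exp_law:
  assumes [measurable]: "h \<in> borel_measurable borel"
  shows "(\<integral>\<^sup>+s\<in>{0..}. h s \<partial>dG exp_law ennreal) = (\<integral>\<^sup>+x\<in>{0..}. ennreal (exp (- x)) * h x \<partial>lborel)"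
proof -
  have "(\<integral>\<^sup>+s\<in>{0..}. h s \<partial>dG exp_law ennreal) =
      (\<integral>\<^sup>+x. h (enn2real (ennreal x)) * indicator {0..} (enn2real (ennreal x)) * indicator {x. ennreal x < \<infinity>} x \<partial>exp_law)"
    by (rule exp_jump.nn_integral_dG) measurable
  also have "\<dots> = (\<integral>\<^sup>+x. ennreal (exponential_density 1 x) *
      (h (enn2real (ennreal x)) * indicator {0..} (enn2real (ennreal x)) * indicator {x. ennreal x < \<infinity>} x) \<partial>lborel)"
    unfolding exp_law_def by (rule nn_integral_density) measurable
  also have "\<dots> = (\<integral>\<^sup>+x\<in>{0..}. ennreal (exp (- x)) * h x \<partial>lborel)"
    by (intro nn_integral_cong) (auto simp: exponential_density_def split: split_indicator)
  finally show ?thesis .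
qed

text \<open>The density \<open>exp (- s)\<close> of \<open>dG\<close> cancels the factor \<open>exp s\<close>, leaving the fundamental theorem of
calculus.\<close>

lemma integral_dG_exp_law:
  fixes w w' :: "real \<Rightarrow> real"
  assumes w: "\<And>x. 0 \<le> x \<Longrightarrow> (w has_real_derivative w' x) (at x)"
    and w': "continuous_on {0..} w'" and [measurable]: "w' \<in> borel_measurable borel" and t: "0 \<le> t"
  shows "(LINT s:{0<..t}|dG exp_law ennreal. exp s * w' s) = w t - w 0"
proof -
  have "(LINT s:{0<..t}|dG exp_law ennreal. exp s * w' s) =
      (LINT x|exp_law. indicator {0<..t} (enn2real (ennreal x)) *\<^sub>R (exp (enn2real (ennreal x)) * w' (enn2real (ennreal x)))
        * indicator {x. ennreal x < \<infinity>} x)"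
    unfolding set_lebesgue_integral_def by (rule exp_jump.integral_dG) measurable
  also have "\<dots> = (LINT x|lborel. exponential_density 1 x *\<^sub>R (indicator {0<..t} (enn2real (ennreal x)) *\<^sub>R (exp (enn2real (ennreal x)) * w' (enn2real (ennreal x)))
        * indicator {x. ennreal x < \<infinity>} x))"
    unfolding exp_law_def by (rule integral_density) (auto simp: exponential_density_nonneg)
  also have "\<dots> = (LINT x|lborel. indicator {0..t} x *\<^sub>R w' x)"
  proof (rule integral_cong_AE)
    have "AE x in lborel. x \<noteq> (0::real)" by (rule AE_lborel_singleton)
    then show "AE x in lborel. exponential_density 1 x *\<^sub>R (indicator {0<..t} (enn2real (ennreal x)) *\<^sub>R (exp (enn2real (ennreal x)) * w' (enn2real (ennreal x)))
        * indicator {x. ennreal x < \<infinity>} x) = indicator {0..t} x *\<^sub>R w' x"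
      by eventually_elim (auto simp: exponential_density_def exp_minus split: split_indicator)
  qed measurable
  also have "\<dots> = w t - w 0"
  proof (rule integral_FTC_Icc[OF t])
    show "(w has_vector_derivative w' x) (at x within {0..t})" if "0 \<le> x" "x \<le> t" for x
      using w[OF that(1)] by (auto simp: has_real_derivative_iff_has_vector_derivative intro: has_vector_derivative_at_within)
    show "continuous_on {0..t} w'" by (rule continuous_on_subset[OF w']) auto
  qed
  finally show ?thesis .
qed

lemma L1_loc_exp_law:
  assumes z: "continuous_on {0..} z" and [measurable]: "z \<in> borel_measurable borel"
  shows "z \<in> L1_loc exp_law ennreal"
  unfolding L1_loc_def
proof (intro CollectI conjI ballI)
  show "set_borel_measurable borel (TT exp_law ennreal) z"
    unfolding set_borel_measurable_def by measurable
  fix t assume "t \<in> TT exp_law ennreal"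
  have "compact (z ` {0..t})"
    by (intro compact_continuous_image continuous_on_subset[OF z]) auto
  then obtain B where B: "\<And>x. 0 \<le> x \<Longrightarrow> x \<le> t \<Longrightarrow> \<bar>z x\<bar> \<le> B"
    using compact_imp_bounded by (force simp: bounded_iff)
  have "(\<integral>\<^sup>+s\<in>{0..t}. ennreal \<bar>z s\<bar> \<partial>dG exp_law ennreal) \<le> (\<integral>\<^sup>+s. ennreal B \<partial>dG exp_law ennreal)"
    using B by (intro nn_integral_mono) (auto split: split_indicator intro!: ennreal_leI)
  also have "\<dots> < \<infinity>"
    using exp_jump.dG.emeasure_finite[of UNIV] by (simp add: ennreal_mult_eq_top_iff less_top[symmetric])
  finally show "(\<integral>\<^sup>+s\<in>{0..t}. ennreal \<bar>z s\<bar> \<partial>dG exp_law ennreal) < \<infinity>" .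
qed

text \<open>With \<open>Gbar t = exp (- t)\<close> and \<open>dG = exp (- s) ds\<close>, the choice \<open>F = exp * u\<close> gives \<open>F * Gbar = u\<close>, and
Condition M then requires \<open>H = - exp * u'\<close>. The integrals of \<open>|H|\<close> and of \<open>Gbar * |dF/dG|\<close> become the
Lebesgue integrals of \<open>|u'|\<close> and \<open>|u + u'|\<close>.\<close>

locale exp_example =
  fixes u u' :: "real \<Rightarrow> real"
  assumes u: "\<And>x. 0 \<le> x \<Longrightarrow> (u has_real_derivative u' x) (at x)"
    and u'_cont: "continuous_on {0..} u'"
    and u_meas [measurable]: "u \<in> borel_measurable borel"
    and u'_meas [measurable]: "u' \<in> borel_measurable borel"
begin

definition F :: "real \<Rightarrow> real" where "F t = exp t * u t"
definition H :: "real \<Rightarrow> real" where "H s = exp s * - u' s"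
definition f :: "real \<Rightarrow> real" where "f s = exp s * (exp s * (u s + u' s))"
text \<open>The negative half-line is a null set on which the jump time is \<open>0\<close>; there the value is set to \<open>0\<close>.\<close>

definition M :: "real \<Rightarrow> real \<Rightarrow> real" where
  "M t x = (if ennreal t < ennreal x then F t else indicator {0..} x * H x)"

lemma F_meas [measurable]: "F \<in> borel_measurable borel"
  and H_meas [measurable]: "H \<in> borel_measurable borel"
  and f_meas [measurable]: "f \<in> borel_measurable borel"
  unfolding F_def[abs_def] H_def[abs_def] f_def[abs_def] by measurable

lemma F_deriv: "0 \<le> x \<Longrightarrow> (F has_real_derivative exp x * (u x + u' x)) (at x)"
  unfolding F_def[abs_def] by (auto intro!: derivative_eq_intros u simp: algebra_simps)

lemma u_cont: "continuous_on {0..} u"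
  using u by (intro continuous_at_imp_continuous_on ballI DERIV_isCont) auto

lemma derivative_F: "has_dG_derivative exp_law ennreal F f"
  unfolding has_dG_derivative_def
proof (intro conjI ballI)
  show "f \<in> L1_loc exp_law ennreal"
    unfolding f_def[abs_def] by (intro L1_loc_exp_law continuous_intros u_cont u'_cont) measurable
  fix t assume "t \<in> before_tG exp_law ennreal"
  then have "0 \<le> t" by (simp add: before_tG_exp_law)
  then have "(LINT s:{0<..t}|dG exp_law ennreal. exp s * (exp s * (u s + u' s))) = F t - F 0"
    by (intro integral_dG_exp_law F_deriv continuous_intros u_cont u'_cont) auto
  then show "F t = F 0 + (LINT s:{0<..t}|dG exp_law ennreal. f s)"
    by (simp add: f_def)
qed

lemma not_case_B: "\<not> case_B exp_law ennreal" and case_A: "case_A exp_law ennreal"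
  by (simp_all add: case_B_def case_A_def tG_exp_law)

lemma condition_M_example: "condition_M exp_law ennreal F H"
  unfolding condition_M_def
proof (intro conjI ballI impI)
  show "loc_abs_cont exp_law ennreal F"
    using derivative_F by (auto simp: loc_abs_cont_def)
  show "H \<in> L1_loc exp_law ennreal"
    unfolding H_def[abs_def] by (intro L1_loc_exp_law continuous_intros u'_cont) measurable
  fix t assume "t \<in> before_tG exp_law ennreal"
  then have t: "0 \<le> t" by (simp add: before_tG_exp_law)
  have "(LINT s:{0<..t}|dG exp_law ennreal. exp s * - u' s) = - u t - - u 0"
    by (intro integral_dG_exp_law continuous_intros u'_cont t) (auto intro!: derivative_eq_intros u)
  with t show "F t * Gbar exp_law ennreal t + (LINT s:{0<..t}|dG exp_law ennreal. H s) = F 0 * Gbar exp_law ennreal 0"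
    by (simp add: H_def F_def Gbar_exp_law exp_minus)
qed (use not_case_B in simp)

lemma AE_exp_law_pos: "AE x in exp_law. 0 < x"
proof -
  have "exp_law.prob {x \<in> space exp_law. 0 < x} = 1"
    using prob_exp_law_greater[of 0] by simp
  then show ?thesis
    by (subst (asm) exp_law.prob_Collect_eq_1) auto
qed

lemma representation_example: "sj_representation exp_law ennreal F H (\<lambda>_. 0) M"
  unfolding sj_representation_def
proof (intro conjI ballI condition_M_example)
  show "\<forall>t\<ge>0. t_G exp_law ennreal \<le> ennreal t \<longrightarrow> continuous (at_right t) F"
    by (simp add: tG_exp_law top_unique)
  let ?A = "vimage_algebra (space exp_law) ennreal borel"
  have "subalgebra exp_law ?A"
    by (auto simp: subalgebra_def sets_vimage_algebra2 intro!: measurable_sets_borel[of _ borel])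
  then interpret S: finite_measure_subalgebra exp_law ?A
    by unfold_locales
  have "AE x in exp_law. 0 = nn_cond_exp exp_law ?A (\<lambda>_. 0) x"
    by (rule S.nn_cond_exp_F_meas) simp
  then show "AE x in exp_law. gen_cond_exp exp_law ?A (\<lambda>_. 0) x = 0"
    by eventually_elim (simp add: gen_cond_exp_def)
  show "AE x in exp_law. \<forall>t\<ge>0. M t x =
        F t * indicator {x. ennreal t < ennreal x} x +
        (H_at exp_law ennreal H x + 0) * indicator {x. ennreal x \<le> ennreal t} x"
    using AE_exp_law_pos
    by eventually_elim (auto simp: M_def H_at_def TT_exp_law ennreal_less_iff split: split_indicator)
qed auto

sublocale sj_process exp_law ennreal F H f "\<lambda>_. 0" M
proof
  show "adapted (\<lambda>t. sj_filtration exp_law ennreal (ennreal t)) {0..} M"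
    unfolding adapted_def
  proof
    fix t :: real
    show "M t \<in> borel_measurable (sj_filtration exp_law ennreal (ennreal t))"
    proof (rule exp_jump.measurable_sjI)
      show "M t \<in> borel_measurable exp_law"
        unfolding M_def[abs_def] by measurable
      show "M t x = F t" if "ennreal t < ennreal x" for x
        using that by (simp add: M_def)
    qed
  qed
qed (rule representation_example derivative_F)+

lemma local_martingale_example: "local_martingale exp_law (sj_filtration exp_law ennreal) M"
  by (rule local_martingale_if_tG_top[OF tG_exp_law]) (rule DERIV_isCont[OF F_deriv])

lemma nn_integral_H_example:
  "(\<integral>\<^sup>+s\<in>{0..}. ennreal \<bar>H s\<bar> \<partial>dG exp_law ennreal) = (\<integral>\<^sup>+x\<in>{0..}. ennreal \<bar>u' x\<bar> \<partial>lborel)"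
proof -
  have "ennreal (exp (- x)) * ennreal \<bar>H x\<bar> = ennreal \<bar>u' x\<bar>" for x
    by (simp add: H_def abs_mult ennreal_mult[symmetric] mult.assoc[symmetric] exp_minus)
  then show ?thesis by (subst nn_integral_dG_exp_law) simp_all
qed

lemma nn_integral_f_example:
  "(\<integral>\<^sup>+s\<in>{0..}. ennreal (Gbar exp_law ennreal s * \<bar>f s\<bar>) \<partial>dG exp_law ennreal) =
    (\<integral>\<^sup>+x\<in>{0..}. ennreal \<bar>u x + u' x\<bar> \<partial>lborel)"
proof -
  have *: "exp (- x) * (exp (- x) * (exp x * (exp x * y))) = y" for x y :: real
    by (simp add: exp_minus field_simps)
  have "ennreal (exp (- x)) * ennreal (Gbar exp_law ennreal x * \<bar>f x\<bar>) = ennreal \<bar>u x + u' x\<bar>" if "0 \<le> x" for x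
    using that *[of x "\<bar>u x + u' x\<bar>"] by (simp add: f_def Gbar_exp_law abs_mult ennreal_mult[symmetric] del: distrib_left)
  then show ?thesis
    by (subst nn_integral_dG_exp_law) (auto intro!: nn_integral_cong split: split_indicator)
qed

lemma L_finite_example_iff:
  "(\<integral>\<^sup>+x. ennreal \<bar>L x\<bar> * indicator {x. ennreal x < \<infinity>} x \<partial>exp_law) < \<infinity> \<longleftrightarrow>
    (\<integral>\<^sup>+x\<in>{0..}. ennreal \<bar>u' x\<bar> \<partial>lborel) < \<infinity>"
  using L_finite_iff[OF case_A] by (simp add: before_tG_exp_law nn_integral_H_example)

lemma F_Gbar_example:
  assumes "(u \<longlongrightarrow> l) at_top"
  shows "((\<lambda>t. F t * Gbar exp_law ennreal t) \<longlongrightarrow> l) (to_tG exp_law ennreal)"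
proof -
  have "\<forall>\<^sub>F t in at_top. u t = F t * Gbar exp_law ennreal t"
    using eventually_ge_at_top[of 0] by eventually_elim (simp add: F_def Gbar_exp_law exp_minus)
  with assms show ?thesis
    by (simp add: to_tG_def tG_exp_law Lim_transform_eventually)
qed

lemma process_finite_example:
  assumes "(\<integral>\<^sup>+x\<in>{0..}. ennreal \<bar>u' x\<bar> \<partial>lborel) < \<infinity>"
  shows "sj_process_finite exp_law ennreal F H f (\<lambda>_. 0) M"
  using assms L_finite_example_iff by unfold_locales (auto simp: case_A)

lemma example:
  "has_type exp_law (sj_filtration exp_law ennreal) M k \<Longrightarrow>
    \<exists>(P' :: real measure) \<gamma>' M' F' H' L''.
        jump_time P' \<gamma>' \<and> case_A P' \<gamma>' \<and> local_martingale P' (sj_filtration P' \<gamma>') M' \<and>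
        sj_representation P' \<gamma>' F' H' L'' M' \<and> has_type P' (sj_filtration P' \<gamma>') M' k"
  using exp_law.prob_space_axioms exp_jump.jump_pos exp_jump.borel_measurable_jump case_A
    local_martingale_example representation_example
  by (intro exI[of _ exp_law] exI[of _ ennreal] exI[of _ M] exI[of _ F] exI[of _ H] exI[of _ "\<lambda>_. 0"])
    (simp add: jump_time_def)

end

text \<open>Type 1: \<open>u t = - t\<close>, whose derivative is not integrable. Types 2a and 2b: \<open>u = 1\<close> and \<open>u = - 1\<close>, so the loss
is \<open>1\<close> and \<open>- 1\<close>. Type 3: \<open>u t = 1 / (1 + t)\<close>, which tends to \<open>0\<close>; its derivative \<open>u'\<close> is
integrable, but \<open>u\<close> and hence \<open>u + u'\<close> are not. Type 4: \<open>u = 0\<close>.\<close>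

lemma all_types_occur:
  "\<exists>(P' :: real measure) \<gamma>' M' F' H' L''.
        jump_time P' \<gamma>' \<and> case_A P' \<gamma>' \<and> local_martingale P' (sj_filtration P' \<gamma>') M' \<and>
        sj_representation P' \<gamma>' F' H' L'' M' \<and> has_type P' (sj_filtration P' \<gamma>') M' k"
proof -
  have const: "exp_example (\<lambda>_. c) (\<lambda>_. 0)" for c
    by unfold_locales auto
  have const_finite: "sj_process_finite exp_law ennreal (exp_example.F (\<lambda>_. c)) (exp_example.H (\<lambda>_. 0))
      (exp_example.f (\<lambda>_. c) (\<lambda>_. 0)) (\<lambda>_. 0) (exp_example.M (\<lambda>_. c) (\<lambda>_. 0))" for c
    by (rule exp_example.process_finite_example[OF const]) simp
  have const_loss: "sj_process.limit_loss exp_law ennreal (exp_example.F (\<lambda>_. c)) (exp_example.H (\<lambda>_. 0)) (\<lambda>_. 0) = c" for c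
    using sj_process_finite.F_Gbar_tendsto_iff[OF const_finite] exp_example.F_Gbar_example[OF const tendsto_const]
    by metis
  show ?thesis
  proof (cases k)
    case Type1
    interpret E: exp_example "\<lambda>t. - t" "\<lambda>_. - 1"
      by unfold_locales (auto intro!: derivative_eq_intros)
    have "(\<integral>\<^sup>+x\<in>{0..}. ennreal \<bar>- 1\<bar> \<partial>(lborel :: real measure)) = (\<integral>\<^sup>+x. indicator {0::real..} x \<partial>lborel)"
      by simp
    also have "\<dots> = emeasure lborel {0::real..}"
      by (rule nn_integral_indicator) simp
    also have "\<dots> = \<infinity>"
    proof (rule ccontr)
      assume "emeasure lborel {0::real..} \<noteq> \<infinity>"
      then obtain r where r: "emeasure lborel {0::real..} = ennreal r" "0 \<le> r"
        by (cases "emeasure lborel {0::real..}") auto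
      have "ennreal (r + 1) = emeasure lborel {0..r + 1}" using r by simp
      also have "\<dots> \<le> ennreal r" unfolding r(1)[symmetric] by (intro emeasure_mono) auto
      finally show False using r by simp
    qed
    finally show ?thesis
      unfolding Type1 using E.L_finite_example_iff E.Type1_iff[OF E.case_A]
      by (intro E.example) (auto simp: less_top)
  next
    case Type2a
    interpret E: exp_example "\<lambda>_. 1" "\<lambda>_. 0" by (rule const)
    show ?thesis unfolding Type2a
      using sj_process_finite.Type2a_iff[OF const_finite, of 1] const_loss[of 1] by (intro E.example) simp
  next
    case Type2b
    interpret E: exp_example "\<lambda>_. - 1" "\<lambda>_. 0" by (rule const)
    show ?thesis unfolding Type2b
      using sj_process_finite.Type2b_iff[OF const_finite, of "- 1"] const_loss[of "- 1"] by (intro E.example) simp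
  next
    case Type3
    interpret E: exp_example "\<lambda>t. 1 / (1 + t)" "\<lambda>t. - 1 / (1 + t)\<^sup>2"
      by unfold_locales (auto intro!: derivative_eq_intros continuous_intros simp: power2_eq_square)
    have "(\<integral>\<^sup>+x\<in>{0..}. ennreal \<bar>- 1 / (1 + x)\<^sup>2\<bar> \<partial>lborel) = (\<integral>\<^sup>+x\<in>{0..}. ennreal (1 / (1 + x)\<^sup>2) \<partial>lborel)"
      by simp
    also have "\<dots> = ennreal (0 - - 1 / (1 + 0))"
    proof (rule nn_integral_FTC_atLeast)
      show "((\<lambda>x::real. - 1 / (1 + x)) \<longlongrightarrow> 0) at_top" by real_asymp
    qed (auto intro!: derivative_eq_intros simp: power2_eq_square)
    finally have H: "(\<integral>\<^sup>+x\<in>{0..}. ennreal \<bar>- 1 / (1 + x)\<^sup>2\<bar> \<partial>lborel) < \<infinity>" by simp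
    interpret E: sj_process_finite exp_law ennreal E.F E.H E.f "\<lambda>_. 0" E.M
      by (rule E.process_finite_example[OF H])
    have "((\<lambda>t::real. 1 / (1 + t)) \<longlongrightarrow> 0) at_top" by real_asymp
    from E.F_Gbar_tendsto_iff[THEN iffD1, OF E.F_Gbar_example[OF this]]
    have loss: "E.limit_loss = 0" by (rule sym)
    let ?I = "\<integral>\<^sup>+x\<in>{0..}. ennreal \<bar>1 / (1 + x) + - 1 / (1 + x)\<^sup>2\<bar> \<partial>lborel"
    have "?I = \<infinity>"
    proof (rule ccontr)
      assume "?I \<noteq> \<infinity>"
      then obtain r where r: "?I = ennreal r" "0 \<le> r" by (cases ?I) auto
      \<comment> \<open>The integral up to \<open>N\<close> is \<open>ln (1 + N) + 1 / (1 + N) - 1\<close>, which exceeds \<open>r\<close> for this \<open>N\<close>.\<close>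
      define N where "N = exp (r + 1)"
      have "ennreal ((ln (1 + N) + 1 / (1 + N)) - (ln (1 + 0) + 1 / (1 + 0))) =
          (\<integral>\<^sup>+x. ennreal (x / (1 + x)\<^sup>2) * indicator {0..N} x \<partial>lborel)"
      proof (rule nn_integral_FTC_Icc[where F="\<lambda>x. ln (1 + x) + 1 / (1 + x)", symmetric])
        fix x :: real assume "x \<in> {0..N}"
        then have x: "0 \<le> x" by simp
        then have "1 / (1 + x) - 1 / (1 + x)\<^sup>2 = x / (1 + x)\<^sup>2"
          by (simp add: power2_eq_square divide_simps)
        moreover have "((\<lambda>x. ln (1 + x) + 1 / (1 + x)) has_real_derivative 1 / (1 + x) - 1 / (1 + x)\<^sup>2) (at x)"
          using x by (auto intro!: derivative_eq_intros simp: power2_eq_square)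
        ultimately show "((\<lambda>x. ln (1 + x) + 1 / (1 + x)) has_real_derivative x / (1 + x)\<^sup>2) (at x)"
          by simp
      qed (auto simp: N_def)
      also have "\<dots> \<le> ?I"
        by (intro nn_integral_mono) (auto split: split_indicator intro!: ennreal_leI simp: power2_eq_square divide_simps)
      finally have "ln (1 + N) + 1 / (1 + N) - 1 \<le> r"
        using r by simp
      moreover have "r + 1 < ln (1 + N)"
      proof -
        have "ln N < ln (1 + N)" by (subst ln_less_cancel_iff) (auto simp: N_def add_pos_pos)
        then show ?thesis by (simp add: N_def)
      qed
      moreover have "0 < 1 / (1 + N)" by (simp add: N_def add_pos_pos)
      ultimately show False by linarith
    qed
    then show ?thesis unfolding Type3
      using E.Type3_iff loss E.nn_integral_f_example by (intro E.example) (simp add: before_tG_exp_law)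
  next
    case Type4
    interpret E: exp_example "\<lambda>_. 0" "\<lambda>_. 0" by (rule const)
    show ?thesis unfolding Type4
      using sj_process_finite.Type4_iff[OF const_finite, of 0] E.nn_integral_f_example
      by (intro E.example) (simp add: before_tG_exp_law)
  qed
qed

section \<open>The classification\<close>

theorem theorem4:
  fixes P :: "'a measure" and \<gamma> :: "'a \<Rightarrow> ennreal" and M :: "real \<Rightarrow> 'a \<Rightarrow> real"
    and F H f :: "real \<Rightarrow> real" and L' :: "'a \<Rightarrow> real"
  assumes "jump_time P \<gamma>"
    and "local_martingale P (sj_filtration P \<gamma>) M"
    and "sj_representation P \<gamma> F H L' M"
    and "has_dG_derivative P \<gamma> F f"
  shows
    "(case_B P \<gamma> \<longrightarrow> has_type P (sj_filtration P \<gamma>) M Type4) \<and>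
     (\<forall>k. \<exists>(P' :: real measure) \<gamma>' M' F' H' L''.
        jump_time P' \<gamma>' \<and> case_A P' \<gamma>' \<and> local_martingale P' (sj_filtration P' \<gamma>') M' \<and>
        sj_representation P' \<gamma>' F' H' L'' M' \<and> has_type P' (sj_filtration P' \<gamma>') M' k) \<and>
     (case_A P \<gamma> \<longrightarrow>
        (has_type P (sj_filtration P \<gamma>) M Type1 \<longleftrightarrow>
           (\<integral>\<^sup>+\<omega>. ennreal \<bar>L' \<omega>\<bar> * indicator {\<omega>. \<gamma> \<omega> < \<infinity>} \<omega> \<partial>P) = \<infinity> \<or>
           (\<integral>\<^sup>+s\<in>before_tG P \<gamma>. ennreal \<bar>H s\<bar> \<partial>dG P \<gamma>) = \<infinity>) \<and>
        (measure P {\<omega>\<in>space P. \<gamma> \<omega> = \<infinity>} > 0 \<and>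
         (\<integral>\<^sup>+\<omega>. ennreal \<bar>L' \<omega>\<bar> * indicator {\<omega>. \<gamma> \<omega> < \<infinity>} \<omega> \<partial>P) < \<infinity> \<and>
         (\<integral>\<^sup>+s\<in>{0..}. ennreal \<bar>H s\<bar> \<partial>dG P \<gamma>) < \<infinity> \<longrightarrow>
           has_type P (sj_filtration P \<gamma>) M Type4) \<and>
        (measure P {\<omega>\<in>space P. \<gamma> \<omega> = \<infinity>} = 0 \<and>
         (\<integral>\<^sup>+\<omega>. ennreal \<bar>L' \<omega>\<bar> \<partial>P) < \<infinity> \<and>
         (\<integral>\<^sup>+s\<in>before_tG P \<gamma>. ennreal \<bar>H s\<bar> \<partial>dG P \<gamma>) < \<infinity> \<longrightarrow>
           (has_type P (sj_filtration P \<gamma>) M Type2a \<longleftrightarrow>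
              (\<exists>l>0. ((\<lambda>t. F t * Gbar P \<gamma> t) \<longlongrightarrow> l) (to_tG P \<gamma>))) \<and>
           (has_type P (sj_filtration P \<gamma>) M Type2b \<longleftrightarrow>
              (\<exists>l<0. ((\<lambda>t. F t * Gbar P \<gamma> t) \<longlongrightarrow> l) (to_tG P \<gamma>))) \<and>
           (has_type P (sj_filtration P \<gamma>) M Type3 \<longleftrightarrow>
              ((\<lambda>t. F t * Gbar P \<gamma> t) \<longlongrightarrow> 0) (to_tG P \<gamma>) \<and>
              (\<integral>\<^sup>+s\<in>before_tG P \<gamma>. ennreal (Gbar P \<gamma> s * \<bar>f s\<bar>) \<partial>dG P \<gamma>) = \<infinity>) \<and>
           (has_type P (sj_filtration P \<gamma>) M Type4 \<longleftrightarrow>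
              (\<integral>\<^sup>+s\<in>before_tG P \<gamma>. ennreal (Gbar P \<gamma> s * \<bar>f s\<bar>) \<partial>dG P \<gamma>) < \<infinity>)))"
proof -
  interpret single_jump P \<gamma>
    using assms(1) by (simp add: jump_time_def single_jump_def single_jump_axioms_def)
  interpret sj_process P \<gamma> F H f L' M
    using assms(2-4) by unfold_locales (auto simp: local_martingale_def)
  let ?L = "\<integral>\<^sup>+\<omega>. ennreal \<bar>L \<omega>\<bar> * indicator {\<omega>. \<gamma> \<omega> < \<infinity>} \<omega> \<partial>P"
  let ?L' = "\<integral>\<^sup>+\<omega>. ennreal \<bar>L' \<omega>\<bar> * indicator {\<omega>. \<gamma> \<omega> < \<infinity>} \<omega> \<partial>P"
  let ?H = "\<integral>\<^sup>+s\<in>before_tG P \<gamma>. ennreal \<bar>H s\<bar> \<partial>dG P \<gamma>"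
  show ?thesis
  proof (intro conjI impI)
    show "has_type P \<FF> M Type4" if "case_B P \<gamma>"
      using that by (rule Type4_case_B)
    show "\<forall>k. \<exists>(P' :: real measure) \<gamma>' M' F' H' L''.
        jump_time P' \<gamma>' \<and> case_A P' \<gamma>' \<and> local_martingale P' (sj_filtration P' \<gamma>') M' \<and>
        sj_representation P' \<gamma>' F' H' L'' M' \<and> has_type P' (sj_filtration P' \<gamma>') M' k"
      by (intro allI all_types_occur)
  next
    assume A: "case_A P \<gamma>"
    show "has_type P \<FF> M Type1 \<longleftrightarrow> ?L' = \<infinity> \<or> ?H = \<infinity>"
      unfolding Type1_iff[OF A] using L_finite_iff[OF A] by (auto simp: less_top[symmetric])
    show "has_type P \<FF> M Type4"
      if "prob {\<omega>\<in>space P. \<gamma> \<omega> = \<infinity>} > 0 \<and> ?L' < \<infinity> \<and> (\<integral>\<^sup>+s\<in>{0..}. ennreal \<bar>H s\<bar> \<partial>dG P \<gamma>) < \<infinity>"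
    proof (rule Type4_if_infinite[OF A])
      have "?H \<le> (\<integral>\<^sup>+s\<in>{0..}. ennreal \<bar>H s\<bar> \<partial>dG P \<gamma>)"
        by (intro nn_integral_mono) (auto simp: before_tG_def split: split_indicator)
      with that show "?L < \<infinity>" using L_finite_iff[OF A] by (auto intro: le_less_trans)
    qed (use that in simp)
    assume fin: "prob {\<omega>\<in>space P. \<gamma> \<omega> = \<infinity>} = 0 \<and> (\<integral>\<^sup>+\<omega>. ennreal \<bar>L' \<omega>\<bar> \<partial>P) < \<infinity> \<and> ?H < \<infinity>"
    have "?L' \<le> (\<integral>\<^sup>+\<omega>. ennreal \<bar>L' \<omega>\<bar> \<partial>P)"
      by (intro nn_integral_mono) (auto split: split_indicator)
    with fin have "?L < \<infinity>" using L_finite_iff[OF A] by (auto intro: le_less_trans)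
    then interpret sj_process_finite P \<gamma> F H f L' M
      using fin A by unfold_locales auto
    show "has_type P \<FF> M Type2a \<longleftrightarrow> (\<exists>l>0. ((\<lambda>t. F t * Gbar P \<gamma> t) \<longlongrightarrow> l) (to_tG P \<gamma>))"
      unfolding Type2a_iff F_Gbar_tendsto_iff by blast
    show "has_type P \<FF> M Type2b \<longleftrightarrow> (\<exists>l<0. ((\<lambda>t. F t * Gbar P \<gamma> t) \<longlongrightarrow> l) (to_tG P \<gamma>))"
      unfolding Type2b_iff F_Gbar_tendsto_iff by blast
    show "has_type P \<FF> M Type3 \<longleftrightarrow> ((\<lambda>t. F t * Gbar P \<gamma> t) \<longlongrightarrow> 0) (to_tG P \<gamma>) \<and>
        (\<integral>\<^sup>+s\<in>before_tG P \<gamma>. ennreal (Gbar P \<gamma> s * \<bar>f s\<bar>) \<partial>dG P \<gamma>) = \<infinity>"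
      unfolding Type3_iff F_Gbar_tendsto_iff by auto
    show "has_type P \<FF> M Type4 \<longleftrightarrow>
        (\<integral>\<^sup>+s\<in>before_tG P \<gamma>. ennreal (Gbar P \<gamma> s * \<bar>f s\<bar>) \<partial>dG P \<gamma>) < \<infinity>"
      by (rule Type4_iff)
  qed
qed

end
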